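(* Let $\mathcal{F}$ be a financial network in which every bank uses an edge-ranking rule, and let $v$ be a bank. Every sequence of successively applied debt swaps starting from $\mathcal{F}$, each of which is semi-positive and $v$-improving, has length bounded by a polynomial in the size of the network. Consequently, $\textsc{SemiSwap}(v)$ can be solved in polynomial time.
   Context: A financial network consists of a finite directed graph $G=(V,E)$ without loops or parallel edges (banks are nodes), liabilities $l_e\in\mathbb{N}_{>0}$ ($e=(u,w)$ means $u$ owes $w$ the amount $l_e$), external assets $a^x_v\in\mathbb{N}$, and payment functions $f_e$ for outgoing edges. The clearing state is the pointwise maximal vector of total assets $(a_w)$ with $a_w=a^x_w+\sum_{e=(u,w)\in E^-(w)}f_e(a_u)$, with payments $p_e=f_e(a_u)$. In an edge-ranking rule each bank has a linear order of its outgoing edges and pays its assets to them in that order, paying each edge fully before the next; the clearing state can be computed in polynomial time. A debt swap $\sigma$ of edges $e_1=(u_1,v_1)$, $e_2=(u_2,v_2)$ with $l_{e_1}=l_{e_2}$ and pairwise distinct $u_1,v_1,u_2,v_2$ removes $e_1,e_2$ and adds $(u_1,v_2)$ (taking over the payment function/ranking position of $e_1$) and $(u_2,v_1)$ (taking over that of $e_2$), with the same liability. With $a_w,a^\sigma_w$ the total assets before/after, the swap is semi-positive if $a^\sigma_{v_1}\ge a_{v_1}$, $a^\sigma_{v_2}\ge a_{v_2}$ with exactly one strict, and $v$-improving if $a^\sigma_v>a_v$ ($v$ need not be one of the creditors). $\textsc{SemiSwap}(v)$: given a financial network with edge-ranking rules and a bank $v$, compute a sequence of semi-positive $v$-improving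 debt swaps leading to a network that admits no semi-positive $v$-improving debt swap. *)

theory Defs
  imports
    Complex_Main
    "HOL-Computational_Algebra.Polynomial"
    "Graph_Theory.Pair_Digraph"
begin

section \<open>Financial networks with edge-ranking rules\<close>

text \<open>
  The list \<open>ranking N u\<close> enumerates the outgoing edges of \<open>u\<close> in the order in which
  \<open>u\<close> pays them. The values of \<open>liab\<close> off the edges, and of \<open>ext_assets\<close> and \<open>ranking\<close>
  off the banks, are irrelevant.
\<close>

record 'v network =
  graph :: "'v pair_pre_digraph"
  liab :: "'v \<times> 'v \<Rightarrow> nat"
  ext_assets :: "'v \<Rightarrow> nat"
  ranking :: "'v \<Rightarrow> ('v \<times> 'v) list"

abbreviation banks :: "'v network \<Rightarrow> 'v set" where
  "banks N \<equiv> pverts (graph N)"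

abbreviation debts :: "'v network \<Rightarrow> ('v \<times> 'v) set" where
  "debts N \<equiv> parcs (graph N)"

definition edge_ranking_network :: "'v network \<Rightarrow> bool" where
  "edge_ranking_network N \<longleftrightarrow>
     pair_digraph (graph N) \<and>
     (\<forall>e \<in> debts N. 0 < liab N e) \<and>
     (\<forall>u \<in> banks N. distinct (ranking N u) \<and>
        set (ranking N u) = out_arcs (with_proj (graph N)) u)"

definition network_size :: "'v network \<Rightarrow> nat" where
  "network_size N = card (banks N) + card (debts N)"

text \<open>
  What is left of the assets \<open>x\<close> of the debtor after paying all edges ranked before \<open>e\<close>
  is used to pay \<open>e\<close>, up to its liability.
\<close>

definition payment :: "'v network \<Rightarrow> 'v \<times> 'v \<Rightarrow> real \<Rightarrow> real" where
  "payment N e x =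
     (let earlier = takeWhile (\<lambda>e'. e' \<noteq> e) (ranking N (fst e))
      in min (real (liab N e)) (max 0 (x - (\<Sum>e' \<leftarrow> earlier. real (liab N e')))))"

text \<open>Asset vectors are set to 0 outside the banks, so that they are compared on banks only.\<close>

definition feasible_assets :: "'v network \<Rightarrow> ('v \<Rightarrow> real) \<Rightarrow> bool" where
  "feasible_assets N a \<longleftrightarrow>
     (\<forall>w \<in> banks N. a w = real (ext_assets N w) +
        (\<Sum>e \<in> in_arcs (with_proj (graph N)) w. payment N e (a (fst e)))) \<and>
     (\<forall>w. w \<notin> banks N \<longrightarrow> a w = 0)"

definition total_assets :: "'v network \<Rightarrow> 'v \<Rightarrow> real" where
  "total_assets N = (GREATEST a. feasible_assets N a)"

lemma payment_mono: "x \<le> y \<Longrightarrow> payment N e x \<le> payment N e y"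
  by (auto simp: payment_def Let_def)

lemma payment_nonneg: "0 \<le> payment N e x"
  by (auto simp: payment_def Let_def)

lemma payment_le: "payment N e x \<le> real (liab N e)"
  by (auto simp: payment_def Let_def)

lemma greatest_feasible_assets:
  "feasible_assets N (total_assets N)"
  "feasible_assets N b \<Longrightarrow> b \<le> total_assets N"
proof -
  define F where "F = (\<lambda>a w. if w \<in> banks N then real (ext_assets N w) +
    (\<Sum>e \<in> in_arcs (with_proj (graph N)) w. payment N e (a (fst e))) else 0)"
  have feas: "feasible_assets N a \<longleftrightarrow> F a = a" for a
    by (auto simp: feasible_assets_def F_def fun_eq_iff)
  have mono: "F a \<le> F b" if "a \<le> b" for a b
    using that unfolding F_def le_fun_def by (auto intro!: add_left_mono sum_mono payment_mono)
  have F0: "0 \<le> F a w" for a w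
    by (auto simp: F_def intro!: add_nonneg_nonneg sum_nonneg payment_nonneg)
  define B where "B = (\<lambda>w. real (ext_assets N w) +
    (\<Sum>e \<in> in_arcs (with_proj (graph N)) w. real (liab N e)))"
  have B: "F a w \<le> B w" for a w
    unfolding F_def B_def by (auto intro!: sum_mono payment_le add_nonneg_nonneg sum_nonneg)
  define H where "H = {a. a \<le> F a}"
  define g where "g = (\<lambda>w. SUP a \<in> H. a w)"
  have ne: "H \<noteq> {}" using F0 by (auto simp: H_def le_fun_def intro!: exI[of _ "\<lambda>_. 0"])
  have bdd: "bdd_above ((\<lambda>a. a w) ` H)" for w
    by (rule bdd_aboveI2[of _ _ "B w"]) (auto simp: H_def le_fun_def intro: order_trans[OF _ B])
  have ub: "a \<le> g" if "a \<in> H" for a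
    unfolding g_def le_fun_def using that bdd by (auto intro: cSUP_upper)
  have lub: "g w \<le> z" if "\<And>a. a \<in> H \<Longrightarrow> a w \<le> z" for w z
    unfolding g_def using ne that by (rule cSUP_least)
  have le: "g \<le> F g"
    unfolding le_fun_def
  proof (intro allI lub)
    fix w a assume "a \<in> H"
    then show "a w \<le> F g w" using mono[OF ub, of a] by (auto simp: H_def le_fun_def intro: order_trans)
  qed
  then have "F g \<in> H" using mono by (auto simp: H_def)
  with le have g: "F g = g" using ub by (auto intro: antisym)
  have up: "b \<le> g" if "F b = b" for b using that by (auto simp: H_def intro!: ub)
  have "total_assets N = g"
    unfolding total_assets_def by (rule Greatest_equality) (use g up feas in auto)
  then show "feasible_assets N (total_assets N)"
    and "feasible_assets N b \<Longrightarrow> b \<le> total_assets N"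
    using g up feas by auto
qed


section \<open>Debt swaps\<close>

type_synonym 'v debt_swap = "('v \<times> 'v) \<times> ('v \<times> 'v)"

text \<open>
  The last two conditions say that the swap does not create parallel edges, i.e. that the
  result is again a network.
\<close>

fun is_debt_swap :: "'v network \<Rightarrow> 'v debt_swap \<Rightarrow> bool" where
  "is_debt_swap N ((u1, v1), (u2, v2)) \<longleftrightarrow>
     (u1, v1) \<in> debts N \<and> (u2, v2) \<in> debts N \<and>
     liab N (u1, v1) = liab N (u2, v2) \<and>
     distinct [u1, v1, u2, v2] \<and>
     (u1, v2) \<notin> debts N \<and> (u2, v1) \<notin> debts N"

fun apply_swap :: "'v debt_swap \<Rightarrow> 'v network \<Rightarrow> 'v network" where
  "apply_swap ((u1, v1), (u2, v2)) N =
     N\<lparr>graph := (graph N)\<lparr>parcs := debts N - {(u1, v1), (u2, v2)} \<union> {(u1, v2), (u2, v1)}\<rparr>,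
       liab := (liab N)((u1, v2) := liab N (u1, v1), (u2, v1) := liab N (u2, v2)),
       ranking := (\<lambda>u. map (id((u1, v1) := (u1, v2), (u2, v2) := (u2, v1))) (ranking N u))\<rparr>"

lemma edge_ranking_network_apply_swap:
  assumes "edge_ranking_network N" "is_debt_swap N \<sigma>"
  shows "edge_ranking_network (apply_swap \<sigma> N)"
proof -
  obtain u1 v1 u2 v2 where s: "\<sigma> = ((u1, v1), (u2, v2))" by (metis surj_pair)
  interpret G: pair_digraph "graph N" using assms by (simp add: edge_ranking_network_def)
  let ?f = "id((u1, v1) := (u1, v2), (u2, v2) := (u2, v1))"
  have inj: "inj_on ?f (debts N)" using assms(2) unfolding s by (auto simp: inj_on_def)
  have rk: "distinct (ranking N u)" "set (ranking N u) = {e \<in> debts N. fst e = u}"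
    if "u \<in> banks N" for u
    using assms(1) that by (auto simp: edge_ranking_network_def)
  have img: "?f ` {e \<in> debts N. fst e = u} =
    {e \<in> debts (apply_swap \<sigma> N). fst e = u}" for u
    using assms(2) unfolding s by (auto simp: image_iff)
  have "u1 \<in> banks N" "v1 \<in> banks N" "u2 \<in> banks N" "v2 \<in> banks N"
    using assms(2) unfolding s by (auto dest: G.wellformed')
  then have ends: "fst e \<in> banks N" "snd e \<in> banks N" "fst e \<noteq> snd e"
    if "e \<in> debts (apply_swap \<sigma> N)" for e
    using that assms(2) G.arc_fst_in_verts G.arc_snd_in_verts G.pair_no_loops unfolding s by auto
  show ?thesis
    unfolding edge_ranking_network_def
  proof (intro conjI ballI)
    show "pair_digraph (graph (apply_swap \<sigma> N))"
      by unfold_locales (use ends G.pair_finite_verts G.pair_finite_arcs in \<open>auto simp: s\<close>)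
  next
    fix e assume "e \<in> debts (apply_swap \<sigma> N)"
    then show "0 < liab (apply_swap \<sigma> N) e"
      using assms unfolding s by (auto simp: edge_ranking_network_def)
  next
    fix u assume "u \<in> banks (apply_swap \<sigma> N)"
    then have u: "u \<in> banks N" by (simp add: s)
    show "distinct (ranking (apply_swap \<sigma> N) u)"
      using rk[OF u] inj_on_subset[OF inj, of "{e \<in> debts N. fst e = u}"]
      by (simp add: s distinct_map)
    have "ranking (apply_swap \<sigma> N) u = map ?f (ranking N u)" by (simp add: s)
    then have "set (ranking (apply_swap \<sigma> N) u) = ?f ` {e \<in> debts N. fst e = u}"
      by (simp only: set_map rk(2)[OF u])
    then show "set (ranking (apply_swap \<sigma> N) u) = out_arcs (with_proj (graph (apply_swap \<sigma> N))) u"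
      unfolding img out_arcs_def by (simp only: with_proj_simps)
  qed
qed

fun semi_positive :: "'v network \<Rightarrow> 'v debt_swap \<Rightarrow> bool" where
  "semi_positive N ((u1, v1), (u2, v2)) \<longleftrightarrow>
     (let a = total_assets N; a' = total_assets (apply_swap ((u1, v1), (u2, v2)) N)
      in a' v1 \<ge> a v1 \<and> a' v2 \<ge> a v2 \<and> ((a' v1 > a v1) \<noteq> (a' v2 > a v2)))"

definition improving :: "'v \<Rightarrow> 'v network \<Rightarrow> 'v debt_swap \<Rightarrow> bool" where
  "improving v N \<sigma> \<longleftrightarrow> total_assets (apply_swap \<sigma> N) v > total_assets N v"

definition semi_swap_step :: "'v \<Rightarrow> 'v network \<Rightarrow> 'v debt_swap \<Rightarrow> bool" where
  "semi_swap_step v N \<sigma> \<longleftrightarrow> is_debt_swap N \<sigma> \<and> semi_positive N \<sigma> \<and> improving v N \<sigma>"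

fun semi_swap_sequence :: "'v \<Rightarrow> 'v network \<Rightarrow> 'v debt_swap list \<Rightarrow> bool" where
  "semi_swap_sequence v N [] \<longleftrightarrow> True"
| "semi_swap_sequence v N (\<sigma> # \<sigma>s) \<longleftrightarrow>
     semi_swap_step v N \<sigma> \<and> semi_swap_sequence v (apply_swap \<sigma> N) \<sigma>s"


section \<open>Polynomial time\<close>

text \<open>
  The machine model is a first-order functional language over binary trees of cons cells
  (in the style of Jones, ``Computability and Complexity from a Programming Perspective'').
  Time is the number of evaluation steps. The basic operations only copy, create or follow
  pointers and there is no primitive arithmetic, so a run of time \<open>t\<close> creates at most \<open>t\<close>
  new cells and is simulated by a Turing machine in time polynomial in \<open>t\<close> and the size of
  the input, and vice versa.
\<close>

datatype tree = Leaf | Cell tree tree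

fun cells :: "tree \<Rightarrow> nat" where
  "cells Leaf = 0"
| "cells (Cell s t) = Suc (cells s + cells t)"

datatype expr =
    EVar nat
  | ENil
  | ECons expr expr
  | EHd expr
  | ETl expr
  | EIf expr expr expr
  | ELet expr expr
  | ECall nat "expr list"

text \<open>
  A program is a list of function bodies. Variables are de Bruijn indices into the
  environment, which initially consists of the arguments of the call; \<open>ELet\<close> pushes a value.
  \<open>EIf\<close> takes its second branch on \<open>Leaf\<close>. The last argument of \<open>eval\<close> is the running time.
\<close>

type_synonym program = "expr list"

inductive eval :: "program \<Rightarrow> tree list \<Rightarrow> expr \<Rightarrow> tree \<Rightarrow> nat \<Rightarrow> bool"
  and evals :: "program \<Rightarrow> tree list \<Rightarrow> expr list \<Rightarrow> tree list \<Rightarrow> nat \<Rightarrow> bool"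
  for P :: program where
  Var: "i < length env \<Longrightarrow> eval P env (EVar i) (env ! i) 1"
| Nil: "eval P env ENil Leaf 1"
| Cons: "eval P env e x m \<Longrightarrow> eval P env e' y n \<Longrightarrow>
    eval P env (ECons e e') (Cell x y) (Suc (m + n))"
| Hd_Cell: "eval P env e (Cell x y) n \<Longrightarrow> eval P env (EHd e) x (Suc n)"
| Hd_Leaf: "eval P env e Leaf n \<Longrightarrow> eval P env (EHd e) Leaf (Suc n)"
| Tl_Cell: "eval P env e (Cell x y) n \<Longrightarrow> eval P env (ETl e) y (Suc n)"
| Tl_Leaf: "eval P env e Leaf n \<Longrightarrow> eval P env (ETl e) Leaf (Suc n)"
| If_Cell: "eval P env e (Cell x y) m \<Longrightarrow> eval P env e1 z n \<Longrightarrow>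
    eval P env (EIf e e1 e2) z (Suc (m + n))"
| If_Leaf: "eval P env e Leaf m \<Longrightarrow> eval P env e2 z n \<Longrightarrow>
    eval P env (EIf e e1 e2) z (Suc (m + n))"
| Let: "eval P env e x m \<Longrightarrow> eval P (x # env) e' y n \<Longrightarrow>
    eval P env (ELet e e') y (Suc (m + n))"
| Call: "evals P env es xs m \<Longrightarrow> f < length P \<Longrightarrow> eval P xs (P ! f) y n \<Longrightarrow>
    eval P env (ECall f es) y (Suc (m + n))"
| Args_Nil: "evals P env [] [] 1"
| Args_Cons: "eval P env e x m \<Longrightarrow> evals P env es xs n \<Longrightarrow>
    evals P env (e # es) (x # xs) (Suc (m + n))"

lemma eval_deterministic:
  "eval P env e x m \<Longrightarrow> eval P env e x' m' \<Longrightarrow> x = x' \<and> m = m'"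
  "evals P env es xs m \<Longrightarrow> evals P env es xs' m' \<Longrightarrow> xs = xs' \<and> m = m'"
proof (induction arbitrary: x' m' and xs' m' rule: eval_evals.inducts)
  case Var
  from Var.prems show ?case by (cases rule: eval.cases) auto
next
  case Nil
  from Nil.prems show ?case by (cases rule: eval.cases) auto
next
  case Cons
  from Cons.prems show ?case
    by (cases rule: eval.cases) (auto dest: Cons.IH(2,4))
next
  case Hd_Cell
  from Hd_Cell.prems show ?case
    by (cases rule: eval.cases) (auto dest: Hd_Cell.IH(2))
next
  case Hd_Leaf
  from Hd_Leaf.prems show ?case
    by (cases rule: eval.cases) (auto dest: Hd_Leaf.IH(2))
next
  case Tl_Cell
  from Tl_Cell.prems show ?case
    by (cases rule: eval.cases) (auto dest: Tl_Cell.IH(2))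
next
  case Tl_Leaf
  from Tl_Leaf.prems show ?case
    by (cases rule: eval.cases) (auto dest: Tl_Leaf.IH(2))
next
  case If_Cell
  from If_Cell.prems show ?case
    by (cases rule: eval.cases) (auto dest: If_Cell.IH(2,4))
next
  case If_Leaf
  from If_Leaf.prems show ?case
    by (cases rule: eval.cases) (auto dest: If_Leaf.IH(2,4))
next
  case Let
  from Let.prems show ?case
    by (cases rule: eval.cases) (auto dest: Let.IH(2,4))
next
  case Call
  from Call.prems show ?case
    by (cases rule: eval.cases) (auto dest: Call.IH(2,5))
next
  case Args_Nil
  from Args_Nil.prems show ?case by (cases rule: evals.cases) auto
next
  case Args_Cons
  from Args_Cons.prems show ?case
    by (cases rule: evals.cases) (auto dest: Args_Cons.IH(2,4))
qed

text \<open>The main function of a program is its first one, called with the input.\<close>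

definition computes :: "program \<Rightarrow> tree \<Rightarrow> tree \<Rightarrow> nat \<Rightarrow> bool" where
  "computes P x y t \<longleftrightarrow> P \<noteq> [] \<and> eval P [x] (P ! 0) y t"

text \<open>
  A search problem is given by its set of instances and by the relation between instances and
  their solutions; inputs and outputs are presented by their encodings.
\<close>

definition poly_time_solvable ::
  "('i \<Rightarrow> tree) \<Rightarrow> ('o \<Rightarrow> tree) \<Rightarrow> 'i set \<Rightarrow> ('i \<Rightarrow> 'o \<Rightarrow> bool) \<Rightarrow> bool" where
  "poly_time_solvable enc_in enc_out I sol \<longleftrightarrow>
     (\<exists>(P :: program) (q :: nat poly). \<forall>x \<in> I. \<exists>y t.
        sol x y \<and> computes P (enc_in x) (enc_out y) t \<and> t \<le> poly q (cells (enc_in x)))"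


section \<open>Encodings\<close>

fun enc_list :: "('a \<Rightarrow> tree) \<Rightarrow> 'a list \<Rightarrow> tree" where
  "enc_list f [] = Leaf"
| "enc_list f (x # xs) = Cell (f x) (enc_list f xs)"

definition enc_pair :: "('a \<Rightarrow> tree) \<Rightarrow> ('b \<Rightarrow> tree) \<Rightarrow> 'a \<times> 'b \<Rightarrow> tree" where
  "enc_pair f g p = Cell (f (fst p)) (g (snd p))"

definition enc_bool :: "bool \<Rightarrow> tree" where
  "enc_bool b = (if b then Cell Leaf Leaf else Leaf)"

text \<open>Natural numbers are encoded in binary, least significant bit first.\<close>

fun bits :: "nat \<Rightarrow> bool list" where
  "bits n = (if n = 0 then [] else odd n # bits (n div 2))"

declare bits.simps [simp del]

definition enc_nat :: "nat \<Rightarrow> tree" where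
  "enc_nat n = enc_list enc_bool (bits n)"

text \<open>
  A network is encoded as the list of its banks, in increasing order of their names, each with
  its external assets and with the list of its creditors and liabilities in payment order.
\<close>

definition enc_bank :: "nat network \<Rightarrow> nat \<Rightarrow> tree" where
  "enc_bank N u = enc_pair enc_nat (enc_pair enc_nat (enc_list (enc_pair enc_nat enc_nat)))
     (u, ext_assets N u, map (\<lambda>e. (snd e, liab N e)) (ranking N u))"

definition enc_network :: "nat network \<Rightarrow> tree" where
  "enc_network N = enc_list (enc_bank N) (sorted_list_of_set (banks N))"

definition enc_swaps :: "nat debt_swap list \<Rightarrow> tree" where
  "enc_swaps = enc_list (enc_pair (enc_pair enc_nat enc_nat) (enc_pair enc_nat enc_nat))"


section \<open>The problem SemiSwap\<close>

definition semi_swap_instances :: "(nat network \<times> nat) set" where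
  "semi_swap_instances = {(N, v). edge_ranking_network N \<and> v \<in> banks N}"

fun semi_swap_solution :: "'v network \<times> 'v \<Rightarrow> 'v debt_swap list \<Rightarrow> bool" where
  "semi_swap_solution (N, v) \<sigma>s \<longleftrightarrow>
     semi_swap_sequence v N \<sigma>s \<and>
     (\<nexists>\<sigma>. semi_swap_step v (fold apply_swap \<sigma>s N) \<sigma>)"

end

theory Submission
  imports Defs
begin

text \<open>
  A bank spends additional money on its live debt, the first one in its ranking that is not paid
  in full. Since the clearing state is maximal, the live debts form a forest. A semi-positive swap
  decreases no assets, so debts paid in full remain so, which can happen anew only once per debt.
  If no debt becomes paid in full, the extra money flows along the live debts from the gaining
  creditor through \<open>v\<close> to the other one, and the swap exchanges a larger payment into the set \<open>D\<close>
  of banks below \<open>v\<close> in the forest for a smaller one, where \<open>D\<close> stays the same. This decreases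
  the number of pairs of a payment into \<open>D\<close> and a smaller payment to a bank outside \<open>D\<close>.

  The clearing state is computed from below: raise all banks on cycles of live debts until one of
  these debts is paid in full, then let every bank receive its payments. As long as no debt becomes
  paid in full, the live debts are an acyclic graph through which the changes leave after as many
  rounds as there are banks.
\<close>

section \<open>Live debts and the number of swaps\<close>

text \<open>Amounts are written in binary, so neither swaps nor rounds may be counted in units of
  money. The potential therefore sees amounts only through comparisons of payments, and a round of
  the algorithm raises a live cycle at one stroke. Plain iteration from zero has two defects. A
  single unit entering a live cycle passes round it until some debt is paid, which takes
  exponentially many rounds; and the limit is the least solution, while the clearing state is the
  greatest and lets money circulate that nobody brought in. Raising live cycles cures both. The
  amount of the raise is a difference of integers, so no division occurs. Maximality is always used
  in the same way: a vector \<open>b\<close> that is at most its own inflow lies below the clearing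
  state. Suitable choices of \<open>b\<close> are a raised cycle, which shows that live debts are
  acyclic, and the maximum of the assets before and after a swap, which shows that the assets only
  grow.\<close>

definition slice :: "real \<Rightarrow> real \<Rightarrow> real \<Rightarrow> real" where
  "slice l h x = min (h - l) (max 0 (x - l))"

lemma slice_mono: "x \<le> y \<Longrightarrow> slice l h x \<le> slice l h y"
  by (auto simp: slice_def)

lemma slice_nonneg: "l \<le> h \<Longrightarrow> 0 \<le> slice l h x"
  by (auto simp: slice_def)

lemma slice_le: "slice l h x \<le> h - l"
  by (auto simp: slice_def)

lemma ex_pos_of_sum_pos:
  fixes g :: "'a \<Rightarrow> real"
  shows "0 < sum g A \<Longrightarrow> \<exists>x\<in>A. 0 < g x"
  by (meson not_less sum_nonpos)

text \<open>Along a path the set of elements from which its current end can be reached grows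
  strictly: it keeps all former members, and acyclicity makes the new end a new one.\<close>

lemma acyclic_relpow_less_card:
  assumes acyc: "acyclic R" and fin: "finite A" and R: "R \<subseteq> A \<times> A"
    and xy: "(x, y) \<in> R ^^ k" "y \<in> A"
  shows "k < card A"
proof -
  have fin': "finite {z \<in> A. (z, y) \<in> R\<^sup>*}" for y using fin by simp
  have "k < card {z \<in> A. (z, y) \<in> R\<^sup>*}"
    using xy
  proof (induction k arbitrary: y)
    case 0
    then have "x \<in> {z \<in> A. (z, y) \<in> R\<^sup>*}" by simp
    then show ?case using fin'[of y] by (metis card_gt_0_iff empty_iff)
  next
    case (Suc k)
    then obtain u where u: "(x, u) \<in> R ^^ k" "(u, y) \<in> R" by auto
    then have "Suc k \<le> card {z \<in> A. (z, u) \<in> R\<^sup>*}" using Suc R by (auto intro!: Suc_leI)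
    also have "\<dots> < card {z \<in> A. (z, y) \<in> R\<^sup>*}"
    proof (rule psubset_card_mono[OF fin'])
      have "(y, u) \<notin> R\<^sup>*"
        using acyc u(2) by (meson acyclic_def rtrancl_into_trancl1)
      then show "{z \<in> A. (z, u) \<in> R\<^sup>*} \<subset> {z \<in> A. (z, y) \<in> R\<^sup>*}"
        using u(2) Suc.prems(2) by (auto intro: rtrancl_into_rtrancl)
    qed
    finally show ?case .
  qed
  also have "\<dots> \<le> card A" using fin by (intro card_mono) auto
  finally show ?thesis .
qed

text \<open>
  The debt \<open>e\<close> is paid by the part of the assets of \<open>tail e\<close> between \<open>lo e\<close> and \<open>hi e\<close>. The
  creditors are not fixed, because they are all that a swap changes.
\<close>

locale debt_system =
  fixes V :: "'v set" and E :: "'e set" and tail :: "'e \<Rightarrow> 'v"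
    and lo hi :: "'e \<Rightarrow> real" and ext :: "'v \<Rightarrow> real"
  assumes finV: "finite V" and finE: "finite E"
    and tailV: "e \<in> E \<Longrightarrow> tail e \<in> V"
    and lo_hi: "e \<in> E \<Longrightarrow> lo e < hi e"
    and ext_nonneg: "w \<in> V \<Longrightarrow> 0 \<le> ext w"
    and disj: "e \<in> E \<Longrightarrow> e' \<in> E \<Longrightarrow> tail e = tail e' \<Longrightarrow> e \<noteq> e' \<Longrightarrow>
      hi e \<le> lo e' \<or> hi e' \<le> lo e"
    and cover: "e \<in> E \<Longrightarrow> 0 \<le> x \<Longrightarrow> x < hi e \<Longrightarrow>
      \<exists>e0\<in>E. tail e0 = tail e \<and> lo e0 \<le> x \<and> x < hi e0"
    and nonexpansive: "u \<in> V \<Longrightarrow> x \<le> y \<Longrightarrow>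
      (\<Sum>e | e \<in> E \<and> tail e = u. slice (lo e) (hi e) y - slice (lo e) (hi e) x) \<le> y - x"
begin

section \<open>Clearing states and live debts\<close>

abbreviation pay :: "('v \<Rightarrow> real) \<Rightarrow> 'e \<Rightarrow> real" where
  "pay a e \<equiv> slice (lo e) (hi e) (a (tail e))"

definition inflow :: "('e \<Rightarrow> 'v) \<Rightarrow> ('v \<Rightarrow> real) \<Rightarrow> 'v \<Rightarrow> real" where
  "inflow h a w = ext w + (\<Sum>e\<in>E. if h e = w then pay a e else 0)"

text \<open>Maximality is required among all \<open>b\<close> with \<open>b \<le> inflow h b\<close>
  on \<open>V\<close>, not only among solutions. By Knaster-Tarski this is the same state, but such
  a \<open>b\<close> is far easier to exhibit than a solution.\<close>

definition clearing :: "('e \<Rightarrow> 'v) \<Rightarrow> ('v \<Rightarrow> real) \<Rightarrow> bool" where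
  "clearing h a \<longleftrightarrow> (\<forall>w\<in>V. a w = inflow h a w) \<and> (\<forall>w. w \<notin> V \<longrightarrow> a w = 0) \<and>
     (\<forall>b. (\<forall>w\<in>V. b w \<le> inflow h b w) \<longrightarrow> (\<forall>w\<in>V. b w \<le> a w))"

text \<open>The half-open interval selects the debt that receives the next unit of money: at
  \<open>hi e\<close> the debt \<open>e\<close> is already paid, and the next one takes
  over.\<close>

definition live :: "('v \<Rightarrow> real) \<Rightarrow> 'e set" where
  "live a = {e \<in> E. lo e \<le> a (tail e) \<and> a (tail e) < hi e}"

definition live_graph :: "('e \<Rightarrow> 'v) \<Rightarrow> ('v \<Rightarrow> real) \<Rightarrow> ('v \<times> 'v) set" where
  "live_graph h a = (\<lambda>e. (tail e, h e)) ` live a"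

definition unpaid :: "('v \<Rightarrow> real) \<Rightarrow> 'e set" where
  "unpaid a = {e \<in> E. a (tail e) < hi e}"

lemma inflow_mono: "(\<And>w. w \<in> V \<Longrightarrow> a w \<le> b w) \<Longrightarrow> inflow h a w \<le> inflow h b w"
  unfolding inflow_def by (intro add_left_mono sum_mono) (simp add: slice_mono tailV)

lemma inflow_cong: "(\<And>w. w \<in> V \<Longrightarrow> a w = b w) \<Longrightarrow> inflow h a w = inflow h b w"
  unfolding inflow_def by (auto intro!: sum.cong simp: tailV)

lemma inflow_nonneg: "w \<in> V \<Longrightarrow> 0 \<le> inflow h a w"
  unfolding inflow_def
  by (intro add_nonneg_nonneg sum_nonneg) (auto simp: ext_nonneg lo_hi less_imp_le slice_nonneg)

lemma live_unique: "e \<in> live a \<Longrightarrow> e' \<in> live a \<Longrightarrow> tail e = tail e' \<Longrightarrow> e = e'"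
  using disj[of e e'] by (auto simp: live_def)

lemma single_valued_live_graph: "single_valued (live_graph h a)"
  unfolding single_valued_def live_graph_def using live_unique by blast

lemma finite_live_graph: "finite (live_graph h a)"
  using finE by (auto simp: live_graph_def live_def)

text \<open>Knaster-Tarski: the pointwise supremum of all vectors that are at most their own inflow
  is again such a vector, and so is its image, which is therefore not larger.\<close>

lemma ex_clearing: "\<exists>a. clearing h a"
proof -
  define H where "H = {b. (\<forall>w\<in>V. b w \<le> inflow h b w) \<and> (\<forall>w. w \<notin> V \<longrightarrow> b w = 0)}"
  define g where "g = (\<lambda>w. SUP b\<in>H. b w)"
  define F where "F = (\<lambda>b w. if w \<in> V then inflow h b w else 0)"
  have ub: "inflow h b w \<le> ext w + (\<Sum>e\<in>E. hi e - lo e)" for b w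
    unfolding inflow_def
    by (intro add_left_mono sum_mono) (auto simp: slice_le lo_hi less_imp_le)
  \<comment> \<open>The maximum with 0 covers the arguments outside \<open>V\<close>, where the
    vectors vanish but \<open>ext\<close> may be negative.\<close>
  have bdd: "bdd_above ((\<lambda>b. b w) ` H)" for w
  proof (rule bdd_aboveI2[of _ _ "max 0 (ext w + (\<Sum>e\<in>E. hi e - lo e))"])
    fix b assume "b \<in> H"
    then show "b w \<le> max 0 (ext w + (\<Sum>e\<in>E. hi e - lo e))"
      using ub[of b w] by (cases "w \<in> V") (force simp: H_def)+
  qed
  have ne: "H \<noteq> {}"
    using inflow_nonneg by (auto simp: H_def intro!: exI[of _ "\<lambda>_. 0"])
  have up: "b w \<le> g w" if "b \<in> H" for b w
    unfolding g_def using that bdd by (auto intro: cSUP_upper)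
  have least: "g w \<le> z" if "\<And>b. b \<in> H \<Longrightarrow> b w \<le> z" for w z
    unfolding g_def using ne that by (rule cSUP_least)
  have g0: "g w = 0" if "w \<notin> V" for w
    unfolding g_def using that ne by (simp add: H_def)
  have g1: "g w \<le> inflow h g w" if "w \<in> V" for w
  proof (rule least)
    fix b assume b: "b \<in> H"
    then have "b w \<le> inflow h b w" using that by (auto simp: H_def)
    also have "\<dots> \<le> inflow h g w" by (rule inflow_mono) (rule up[OF b])
    finally show "b w \<le> inflow h g w" .
  qed
  have "F g \<in> H"
    unfolding H_def mem_Collect_eq
  proof (intro conjI ballI)
    fix w assume w: "w \<in> V"
    have "F g w = inflow h g w" using w by (simp add: F_def)
    also have "\<dots> \<le> inflow h (F g) w" by (rule inflow_mono) (use g1 in \<open>auto simp: F_def\<close>)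
    finally show "F g w \<le> inflow h (F g) w" .
  qed (simp add: F_def)
  then have g2: "inflow h g w \<le> g w" if "w \<in> V" for w
    using up[of "F g" w] that by (simp add: F_def)
  have "b w \<le> g w" if b: "\<forall>w\<in>V. b w \<le> inflow h b w" and w: "w \<in> V" for b w
  proof -
    \<comment> \<open>Cutting \<open>b\<close> off outside \<open>V\<close> puts it into
      \<open>H\<close> without changing its inflow, since all debtors are in
      \<open>V\<close>.\<close>
    define c where "c = (\<lambda>w. if w \<in> V then b w else 0)"
    have "inflow h c w = inflow h b w" for w by (rule inflow_cong) (simp add: c_def)
    then have "c \<in> H" using b by (auto simp: H_def c_def)
    then show ?thesis using up[of c w] w by (simp add: c_def)
  qed
  then show ?thesis
    unfolding clearing_def using g0 g1 g2 by (intro exI[of _ g]) (auto intro: antisym)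
qed

lemma clearing_nonneg: "clearing h a \<Longrightarrow> 0 \<le> a w"
  using inflow_nonneg unfolding clearing_def by (cases "w \<in> V") auto

text \<open>A live debt passes on an increase one for one until it is paid in full. If each member
  of \<open>Z\<close> is fed by a live debt from \<open>Z\<close>, a common raise of
  \<open>Z\<close> thus finances itself.\<close>

lemma raise_le_inflow:
  assumes le: "\<And>w. w \<in> V \<Longrightarrow> a w \<le> inflow h a w"
    and Z: "\<And>w. w \<in> Z \<Longrightarrow> \<exists>e\<in>live a. tail e \<in> Z \<and> h e = w"
    and eps: "0 \<le> \<epsilon>" "\<And>e. e \<in> live a \<Longrightarrow> tail e \<in> Z \<Longrightarrow> a (tail e) + \<epsilon> \<le> hi e"
    and w: "w \<in> V"
  defines "b \<equiv> \<lambda>w. if w \<in> Z then a w + \<epsilon> else a w"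
  shows "b w \<le> inflow h b w"
proof (cases "w \<in> Z")
  case True
  then obtain e where e: "e \<in> live a" "tail e \<in> Z" "h e = w" using Z by blast
  then have eE: "e \<in> E" by (simp add: live_def)
  have rest: "(\<Sum>e'\<in>E - {e}. if h e' = w then pay a e' else 0)
      \<le> (\<Sum>e'\<in>E - {e}. if h e' = w then pay b e' else 0)"
    by (intro sum_mono) (use eps(1) in \<open>auto simp: b_def intro!: slice_mono\<close>)
  have one: "pay b e = pay a e + \<epsilon>"
    using eps e by (auto simp: b_def slice_def live_def)
  have "b w = a w + \<epsilon>" using True by (simp add: b_def)
  also have "\<dots> \<le> inflow h a w + \<epsilon>" using le w by simp
  also have "\<dots> \<le> inflow h b w"
    unfolding inflow_def using rest one e(3) by (simp add: sum.remove[OF finE eE])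
  finally show ?thesis .
next
  case False
  then have "b w = a w" by (simp add: b_def)
  also have "\<dots> \<le> inflow h a w" using le w by simp
  also have "\<dots> \<le> inflow h b w" by (rule inflow_mono) (use eps(1) in \<open>simp add: b_def\<close>)
  finally show ?thesis .
qed

text \<open>\<open>Z\<close> consists of all banks reached from \<open>x\<close> in at least one
  step. As \<open>x\<close> is among them, so is the predecessor of each of them on its path from
  \<open>x\<close>.\<close>

lemma live_cycle:
  assumes x: "(x, x) \<in> (live_graph h a)\<^sup>+"
  obtains Z where "x \<in> Z" "\<And>w. w \<in> Z \<Longrightarrow> \<exists>e\<in>live a. tail e \<in> Z \<and> h e = w"
proof
  let ?Z = "{y. (x, y) \<in> (live_graph h a)\<^sup>+}"
  show "x \<in> ?Z" using x by simp
  fix w assume "w \<in> ?Z"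
  then obtain z where "(x, z) \<in> (live_graph h a)\<^sup>*" "(z, w) \<in> live_graph h a"
    unfolding mem_Collect_eq by (meson tranclD2)
  moreover from this have "z \<in> ?Z" using x by (auto simp: rtrancl_eq_or_trancl)
  ultimately show "\<exists>e\<in>live a. tail e \<in> ?Z \<and> h e = w" by (auto simp: live_graph_def)
qed

text \<open>A live cycle could be raised by the smallest amount still missing on a live debt,
  contradicting maximality.\<close>

lemma acyclic_live_graph:
  assumes hV: "\<And>e. e \<in> E \<Longrightarrow> h e \<in> V" and cl: "clearing h a"
  shows "acyclic (live_graph h a)"
proof (rule acyclicI, rule allI, rule notI)
  fix x assume "(x, x) \<in> (live_graph h a)\<^sup>+"
  then obtain Z where x: "x \<in> Z" and Z: "\<And>w. w \<in> Z \<Longrightarrow> \<exists>e\<in>live a. tail e \<in> Z \<and> h e = w"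
    by (rule live_cycle) blast
  define \<epsilon> where "\<epsilon> = Min ((\<lambda>e. hi e - a (tail e)) ` live a)"
  have fin: "finite (live a)" using finE by (simp add: live_def)
  have ne: "live a \<noteq> {}" using Z[OF x] by auto
  have eps: "0 < \<epsilon>" "\<And>e. e \<in> live a \<Longrightarrow> \<epsilon> \<le> hi e - a (tail e)"
    using fin ne by (auto simp: \<epsilon>_def live_def)
  obtain e where "e \<in> live a" "h e = x" using Z[OF x] by auto
  then have xV: "x \<in> V" using hV by (auto simp: live_def)
  define b where "b = (\<lambda>w. if w \<in> Z then a w + \<epsilon> else a w)"
  have le: "a w \<le> inflow h a w" if "w \<in> V" for w using cl that by (simp add: clearing_def)
  have slack: "a (tail e) + \<epsilon> \<le> hi e" if "e \<in> live a" for e using eps(2)[OF that] by simp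
  have "\<forall>w\<in>V. b w \<le> inflow h b w"
    unfolding b_def using raise_le_inflow[OF le Z less_imp_le[OF eps(1)] slack] by blast
  then have "b x \<le> a x" using cl xV unfolding clearing_def by blast
  then show False using eps x by (simp add: b_def)
qed

text \<open>The maximum of both states is at most its inflow after the swap: at the two creditors it
  equals \<open>a'\<close>, and every other bank has the same incoming debts before and after.
  Maximality of \<open>a'\<close> then gives the claim.\<close>

lemma swap_assets_mono:
  assumes h': "h' = h(e1 := h e2, e2 := h e1)"
    and cl: "clearing h a" "clearing h' a'"
    and le: "a (h e1) \<le> a' (h e1)" "a (h e2) \<le> a' (h e2)"
  shows "a w \<le> a' w"
proof (cases "w \<in> V")
  case True
  define b where "b = (\<lambda>w. max (a w) (a' w))"
  have "b w \<le> inflow h' b w" if w: "w \<in> V" for w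
  proof (cases "w = h e1 \<or> w = h e2")
    case True
    then have "b w = inflow h' a' w"
      using le cl(2) w by (auto simp: b_def clearing_def)
    also have "\<dots> \<le> inflow h' b w" by (rule inflow_mono) (simp add: b_def)
    finally show ?thesis .
  next
    case False
    have eq: "inflow h c w = inflow h' c w" for c
      unfolding inflow_def h' using False by (auto intro!: sum.cong)
    have "a w \<le> inflow h' b w"
      using inflow_mono[of a b h w] cl(1) w by (simp add: b_def clearing_def eq)
    moreover have "a' w \<le> inflow h' b w"
      using inflow_mono[of a' b h' w] cl(2) w by (simp add: b_def clearing_def)
    ultimately show ?thesis by (simp add: b_def)
  qed
  then have "b w \<le> a' w" using cl(2) True by (auto simp: clearing_def)
  then show ?thesis by (simp add: b_def)
qed (use cl in \<open>simp add: clearing_def\<close>)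

section \<open>A potential that every swap in question decreases\<close>

definition below :: "('e \<Rightarrow> 'v) \<Rightarrow> ('v \<Rightarrow> real) \<Rightarrow> 'v \<Rightarrow> 'v set" where
  "below h a v = {w. (v, w) \<in> (live_graph h a)\<^sup>+}"

text \<open>
  The live debts on the path from \<open>v\<close> are excluded, since their payments may grow in a swap.
\<close>

definition inversions :: "('e \<Rightarrow> 'v) \<Rightarrow> ('v \<Rightarrow> real) \<Rightarrow> 'v \<Rightarrow> ('e \<times> 'e) set" where
  "inversions h a v = {(c, t) \<in> E \<times> E. h c \<in> below h a v \<and>
     \<not> (c \<in> live a \<and> tail c \<in> insert v (below h a v)) \<and> h t \<notin> below h a v \<and> pay a t < pay a c}"

text \<open>The lexicographic order as a single number: the factor exceeds every possible number of
  inversions, so one more debt paid in full outweighs any change of the second summand.\<close>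

definition potential :: "('e \<Rightarrow> 'v) \<Rightarrow> ('v \<Rightarrow> real) \<Rightarrow> 'v \<Rightarrow> nat" where
  "potential h a v = card (unpaid a) * Suc (card E * card E) + card (inversions h a v)"

lemma finite_inversions: "finite (inversions h a v)"
  using finE by (auto simp: inversions_def intro: finite_subset[of _ "E \<times> E"])

lemma card_inversions_le: "card (inversions h a v) \<le> card E * card E"
proof -
  have "card (inversions h a v) \<le> card (E \<times> E)"
    using finE by (intro card_mono) (auto simp: inversions_def)
  then show ?thesis by (simp add: card_cartesian_product)
qed

lemma potential_less_of_unpaid:
  assumes "unpaid a' \<subset> unpaid a"
  shows "potential h' a' v < potential h a v"
proof -
  have "finite (unpaid a)" using finE by (simp add: unpaid_def)
  then have "Suc (card (unpaid a')) \<le> card (unpaid a)"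
    using assms by (simp add: Suc_leI psubset_card_mono)
  then have "Suc (card (unpaid a')) * Suc (card E * card E) \<le> card (unpaid a) * Suc (card E * card E)"
    by (rule mult_le_mono1)
  then show ?thesis using card_inversions_le[of h' a' v] unfolding potential_def by simp
qed

text \<open>The slices of a bank leave no gap. Assets that have not reached the slice of
  \<open>e\<close> lie within an earlier one, and have to complete it first.\<close>

lemma live_below_lo:
  assumes "e \<in> E" "0 \<le> x" "x < lo e"
  shows "\<exists>e0\<in>E. tail e0 = tail e \<and> lo e0 \<le> x \<and> x < hi e0 \<and> hi e0 \<le> lo e"
proof -
  obtain e0 where e0: "e0 \<in> E" "tail e0 = tail e" "lo e0 \<le> x" "x < hi e0"
    using cover[of e x] assms lo_hi[of e] by auto
  then have "hi e0 \<le> lo e" using disj[of e0 e] assms lo_hi[of e] by force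
  then show ?thesis using e0 by blast
qed

text \<open>If no debt becomes paid in full, the assets of a bank cannot leave the slice they are
  in, so the live debt absorbs the whole increase.\<close>

lemma pay_increase:
  assumes "0 \<le> a (tail e)" "a (tail e) \<le> a' (tail e)" and un: "unpaid a \<subseteq> unpaid a'" and e: "e \<in> E"
  shows "pay a' e = pay a e + (if e \<in> live a then a' (tail e) - a (tail e) else 0)"
    and "e \<in> live a' \<longleftrightarrow> e \<in> live a"
proof -
  have hi: "a' (tail e) < hi e'" if "e' \<in> E" "tail e' = tail e" "a (tail e) < hi e'" for e'
    using un that by (auto simp: unpaid_def)
  have lo: "a' (tail e) < lo e" if "a (tail e) < lo e"
    using live_below_lo[OF e assms(1) that] hi by force
  show "pay a' e = pay a e + (if e \<in> live a then a' (tail e) - a (tail e) else 0)"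
    using lo hi[of e] assms(2) e lo_hi[OF e] by (auto simp: live_def slice_def)
  show "e \<in> live a' \<longleftrightarrow> e \<in> live a"
    using lo hi[of e] assms(2) e lo_hi[OF e] unfolding live_def by force
qed

text \<open>Suppose no debt becomes paid in full. The creditor \<open>h e1\<close> is the only
  source of change, as every other gaining bank gains through a live debt of a gaining bank.
  Successors along live debts are unique, so the gaining banks form one path; it starts at
  \<open>h e1\<close>, passes \<open>v\<close> and ends in front of \<open>h e2\<close>, where the
  additional money makes up for the smaller payment received after the swap.\<close>

lemma swap_potential:
  assumes hV: "\<And>e. e \<in> E \<Longrightarrow> h e \<in> V" and e: "e1 \<in> E" "e2 \<in> E" and ne: "h e1 \<noteq> h e2"
    and h': "h' = h(e1 := h e2, e2 := h e1)"
    and cl: "clearing h a" "clearing h' a'"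
    and gain: "a (h e1) < a' (h e1)" "a' (h e2) = a (h e2)" "a v < a' v"
  shows "potential h' a' v < potential h a v"
proof -
  have mono: "a w \<le> a' w" for w
    using swap_assets_mono[OF h' cl] gain by simp
  have nonneg: "0 \<le> a w" for w using cl(1) by (rule clearing_nonneg)
  have sub: "unpaid a' \<subseteq> unpaid a"
    using mono by (auto simp: unpaid_def intro: le_less_trans)
  show ?thesis
  proof (cases "unpaid a \<subseteq> unpaid a'")
    case False
    then show ?thesis using sub by (intro potential_less_of_unpaid) auto
  next
    case un: True
    have h'V: "\<And>e. e \<in> E \<Longrightarrow> h' e \<in> V" using hV e by (simp add: h')
    have e12: "e1 \<noteq> e2" using ne by auto
    define \<Delta> where "\<Delta> = (\<lambda>w. a' w - a w)"
    have \<Delta>0: "0 \<le> \<Delta> w" for w using mono by (simp add: \<Delta>_def)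
    have pay': "pay a' e = pay a e + (if e \<in> live a then \<Delta> (tail e) else 0)" if "e \<in> E" for e
      using pay_increase(1)[OF nonneg mono un that] by (simp add: \<Delta>_def)
    have live': "live a' = live a"
      using pay_increase(2)[OF nonneg mono un] by (auto simp: live_def)
    define R R' where "R = live_graph h a" and "R' = live_graph h' a'"
    have acyc: "acyclic R" "acyclic R'"
      using acyclic_live_graph hV h'V cl by (simp_all add: R_def R'_def)
    have sv: "single_valued R" by (simp add: R_def single_valued_live_graph)
    have RI: "(tail e, h e) \<in> R" "(tail e, h' e) \<in> R'" if "e \<in> live a" for e
      using that by (auto simp: R_def R'_def live_graph_def live')
    have RE: "\<exists>e\<in>live a. u = tail e \<and> w = h e" if "(u, w) \<in> R" for u w
      using that by (auto simp: R_def live_graph_def)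
    have R'E: "\<exists>e\<in>live a. u = tail e \<and> w = h' e" if "(u, w) \<in> R'" for u w
      using that by (auto simp: R'_def live_graph_def live')
    have liveE: "e \<in> E" if "e \<in> live a" for e using that by (simp add: live_def)
    define S where "S = {w. 0 < \<Delta> w}"
    let ?v1 = "h e1" and ?v2 = "h e2"
    have S: "?v1 \<in> S" "?v2 \<notin> S" "v \<in> S" using gain by (auto simp: S_def \<Delta>_def)
    have SV: "w \<in> V" if "w \<in> S" for w
      using that cl by (auto simp: S_def \<Delta>_def clearing_def intro: ccontr)
    let ?d = "\<lambda>w e. (if h' e = w then pay a' e else 0) - (if h e = w then pay a e else 0)"
    have \<Delta>_sum: "\<Delta> w = (\<Sum>e\<in>E. ?d w e)"
      if "w \<in> V" for w
      using cl that by (simp add: \<Delta>_def clearing_def inflow_def sum_subtractf)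
    \<comment> \<open>Away from the two swapped creditors the incoming debts are unchanged, so a
      gain requires a larger payment, and only a live debt of a gaining bank pays more.\<close>
    have pred: "\<exists>e\<in>live a. tail e \<in> S \<and> h e = w \<and> h' e = w" if w: "w \<in> S" "w \<noteq> ?v1" for w
    proof -
      have w2: "w \<noteq> ?v2" using w S by auto
      have "0 < (\<Sum>e\<in>E. ?d w e)"
        using w \<Delta>_sum[OF SV[OF w(1)]] by (simp add: S_def)
      then obtain e where e: "e \<in> E"
        "0 < ?d w e"
        by (meson ex_pos_of_sum_pos)
      have hh: "h e = w \<longleftrightarrow> h' e = w" "h e = w \<Longrightarrow> h' e = h e" using w w2 by (auto simp: h')
      then have "h' e = w" "pay a e < pay a' e" using e(2) by (auto split: if_splits)
      then show ?thesis using pay'[OF e(1)] hh by (auto simp: S_def split: if_splits)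
    qed
    have finR: "finite R" unfolding R_def by (rule finite_live_graph)
    have wfR: "wf R" using finR acyc(1) by (rule finite_acyclic_wf)
    \<comment> \<open>These edges are live both before and after the swap, so that they can be
      completed to a cycle in either graph.\<close>
    define RS where "RS = R \<inter> R' \<inter> S \<times> S"
    \<comment> \<open>A gain is traced back from debtor to debtor; this ends because the live debts
      before the swap are acyclic.\<close>
    have reach: "(?v1, w) \<in> RS\<^sup>*" if "w \<in> S" for w
      using wfR that
    proof (induction w rule: wf_induct_rule)
      case (less w)
      show ?case
      proof (cases "w = ?v1")
        case False
        then obtain e where "e \<in> live a" "tail e \<in> S" "h e = w" "h' e = w"
          using pred less by blast
        then show ?thesis
          using less RI[of e] by (auto simp: RS_def intro: rtrancl_into_rtrancl)
      qed simp
    qed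
    have svS: "single_valued RS" using sv by (auto simp: RS_def single_valued_def)
    have RS_R: "RS\<^sup>* \<subseteq> R\<^sup>*" and RS_R': "RS\<^sup>* \<subseteq> R'\<^sup>*" by (auto simp: RS_def intro!: rtrancl_mono)
    \<comment> \<open>A gaining debtor of \<open>e1\<close> would close a cycle before the swap. For
      \<open>e2\<close> below, the cycle arises after the swap, when \<open>e2\<close> is owed to
      \<open>h e1\<close>.\<close>
    have no1: "tail e1 \<notin> S" if "e1 \<in> live a"
    proof
      assume "tail e1 \<in> S"
      then have "(?v1, tail e1) \<in> R\<^sup>*" using reach RS_R by blast
      then show False using RI(1)[OF that] acyc(1)
        by (meson acyclic_def rtrancl_into_trancl1)
    qed
    have no2: "tail e2 \<notin> S" if "e2 \<in> live a"
    proof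
      assume "tail e2 \<in> S"
      then have "(?v1, tail e2) \<in> R'\<^sup>*" using reach RS_R' by blast
      moreover have "(tail e2, ?v1) \<in> R'" using RI(2)[OF that] by (simp add: h')
      ultimately show False using acyc(2) by (meson acyclic_def rtrancl_into_trancl1)
    qed
    have \<Delta>_S: "\<Delta> w = 0" if "w \<notin> S" for w
      using \<Delta>0[of w] that by (simp add: S_def)
    have pay12: "pay a' e1 = pay a e1" "pay a' e2 = pay a e2"
      using no1 no2 by (simp_all add: pay' e \<Delta>_S)
    have into1: "pay a' e = pay a e" if "e \<in> E" "h e = ?v1" for e
    proof -
      have "tail e \<notin> S" if "e \<in> live a"
      proof
        assume "tail e \<in> S"
        then have "(?v1, tail e) \<in> R\<^sup>*" using reach RS_R by blast
        then show False using RI(1)[OF that] \<open>h e = ?v1\<close> acyc(1)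
          by (metis acyclic_def rtrancl_into_trancl1)
      qed
      then show ?thesis using that by (simp add: pay' \<Delta>_S)
    qed
    have E2: "E = insert e1 (insert e2 (E - {e1, e2}))" using e by auto
    have split: "(\<Sum>x\<in>E. g x) = g e1 + g e2 + (\<Sum>x\<in>E - {e1, e2}. g x)" for g :: "'e \<Rightarrow> real"
      by (subst E2) (use finE e12 in simp)
    \<comment> \<open>Nothing else that the gaining creditor receives has changed, so its gain is
      precisely the difference of the two swapped payments.\<close>
    have "\<Delta> ?v1 = pay a e2 - pay a e1 + (\<Sum>e\<in>E - {e1, e2}. ?d ?v1 e)"
      using \<Delta>_sum[OF hV[OF e(1)]] e12 ne by (simp add: split h' pay12)
    also have "(\<Sum>e\<in>E - {e1, e2}. ?d ?v1 e) = 0"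
      by (intro sum.neutral) (auto simp: h' into1)
    finally have less: "pay a e1 < pay a e2" using S(1) by (simp add: S_def)
    \<comment> \<open>The other creditor loses this difference but keeps its assets, hence some
      further debt \<open>f\<close> brings it additional money.\<close>
    have "\<Delta> ?v2 = pay a e1 - pay a e2 + (\<Sum>e\<in>E - {e1, e2}. ?d ?v2 e)"
      using \<Delta>_sum[OF hV[OF e(2)]] e12 ne by (simp add: split h' pay12)
    then have "0 < (\<Sum>e\<in>E - {e1, e2}. ?d ?v2 e)"
      using less \<Delta>_S[OF S(2)] by simp
    then obtain f where f: "f \<in> E" "f \<noteq> e1" "f \<noteq> e2"
      "0 < ?d ?v2 f"
      using ex_pos_of_sum_pos by blast
    then have "h f = ?v2" "pay a f < pay a' f" by (auto simp: h' split: if_splits)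
    then have f': "f \<in> live a" "tail f \<in> S" "h f = ?v2"
      using pay'[OF f(1)] by (auto simp: S_def split: if_splits)
    \<comment> \<open>Unique successors make any two banks reached from \<open>h e1\<close>
      comparable. No gaining bank comes after \<open>tail f\<close>, whose successor is
      \<open>h e2\<close>.\<close>
    have chain: "(w, tail f) \<in> RS\<^sup>*" if "w \<in> S" for w
    proof -
      have "(w, tail f) \<in> RS\<^sup>* \<or> (tail f, w) \<in> RS\<^sup>*"
        using single_valued_confluent[OF svS reach[OF that] reach[OF f'(2)]] .
      moreover have "w = tail f" if "(tail f, w) \<in> RS\<^sup>*"
        using that
      proof (cases rule: converse_rtranclE)
        case (step y)
        then have "(tail f, y) \<in> R" "y \<in> S" by (auto simp: RS_def)
        then have "y = ?v2" using RI(1)[OF f'(1)] f'(3) sv by (auto simp: single_valued_def)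
        then show ?thesis using \<open>y \<in> S\<close> S(2) by simp
      qed simp
      ultimately show ?thesis by auto
    qed
    have f_R: "(tail f, ?v2) \<in> R" using RI(1)[OF f'(1)] f'(3) by simp
    define D where "D = below h a v"
    have D: "w \<in> D \<longleftrightarrow> (v, w) \<in> R\<^sup>+" for w by (simp add: D_def below_def R_def)
    have vD: "w \<in> insert v D \<longleftrightarrow> (v, w) \<in> R\<^sup>*" for w
      by (auto simp: D rtrancl_eq_or_trancl)
    have v2D: "?v2 \<in> D"
      using chain[OF S(3)] RS_R f_R by (auto simp: D intro: rtrancl_into_trancl1)
    have v1D: "?v1 \<notin> D"
    proof
      assume "?v1 \<in> D"
      then have "(v, v) \<in> R\<^sup>+" using reach[OF S(3)] RS_R by (auto simp: D)
      then show False using acyc(1) by (auto simp: acyclic_def)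
    qed
    \<comment> \<open>From \<open>v\<close> the path stays among the gaining banks until
      \<open>tail f\<close> and then enters \<open>h e2\<close>.\<close>
    have orbit: "u \<in> S \<or> (?v2, u) \<in> R\<^sup>*" if "(v, u) \<in> R\<^sup>*" for u
      using that
    proof (induction rule: rtrancl_induct)
      case (step x y)
      from step.IH show ?case
      proof
        assume x: "x \<in> S"
        from chain[OF x] show ?thesis
        proof (cases rule: converse_rtranclE)
          case base
          then have "y = ?v2" using f_R step sv by (auto simp: single_valued_def)
          then show ?thesis by simp
        next
          case (step z)
          then have "z \<in> S" "(x, z) \<in> R" by (auto simp: RS_def)
          then show ?thesis using \<open>(x, y) \<in> R\<close> sv by (auto simp: single_valued_def)
        qed
      next
        assume "(?v2, x) \<in> R\<^sup>*"
        then show ?thesis using \<open>(x, y) \<in> R\<close> by (auto intro: rtrancl_into_rtrancl)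
      qed
    qed (use S in simp)
    have off1: "tail e1 \<notin> insert v D" if "e1 \<in> live a"
      using RI(1)[OF that] v1D by (metis D rtrancl_into_trancl1 vD)
    \<comment> \<open>The debtor of a live \<open>e2\<close> does not gain, so at or below
      \<open>v\<close> it would be reached from \<open>h e2\<close>, and \<open>e2\<close> would
      close a cycle.\<close>
    have off2: "tail e2 \<notin> insert v D" if "e2 \<in> live a"
    proof
      assume "tail e2 \<in> insert v D"
      then have "(?v2, tail e2) \<in> R\<^sup>*" using orbit no2[OF that] unfolding vD by blast
      then show False using RI(1)[OF that] acyc(1)
        by (meson acyclic_def rtrancl_into_trancl1)
    qed
    \<comment> \<open>Neither swapped debt is live at \<open>v\<close> or below it, so both graphs
      agree there and the set \<open>D\<close> survives the swap.\<close>
    have same: "(x, y) \<in> R \<longleftrightarrow> (x, y) \<in> R'" if "x \<in> insert v D" for x y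
    proof
      assume "(x, y) \<in> R"
      then obtain e where "e \<in> live a" "x = tail e" "y = h e" using RE by blast
      moreover from this have "h' e = h e" using off1 off2 that by (auto simp: h')
      ultimately show "(x, y) \<in> R'" using RI(2)[of e] by simp
    next
      assume "(x, y) \<in> R'"
      then obtain e where "e \<in> live a" "x = tail e" "y = h' e" using R'E by blast
      moreover from this have "h' e = h e" using off1 off2 that by (auto simp: h')
      ultimately show "(x, y) \<in> R" using RI(1)[of e] by simp
    qed
    have "w \<in> D" if "(v, w) \<in> R'\<^sup>+" for w
      using that
    proof (induction rule: trancl_induct)
      case (base y)
      then show ?case using same[of v y] by (auto simp: D)
    next
      case (step y z)
      then have "(y, z) \<in> R" using same[of y z] by auto
      then show ?case using step by (auto simp: D)
    qed
    moreover have "(v, w) \<in> R'\<^sup>+" if "(v, w) \<in> R\<^sup>+" for w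
      using that
    proof (induction rule: trancl_induct)
      case (base y)
      then show ?case using same[of v y] by auto
    next
      case (step y z)
      then have "(y, z) \<in> R'" using same[of y z] by (auto simp: D)
      then show ?case using step by auto
    qed
    ultimately have D': "below h' a' v = D" by (auto simp: below_def R'_def[symmetric] D)
    \<comment> \<open>After the swap \<open>e\<close> has the creditor that \<open>?t e\<close> had before, so \<open>?t\<close> preserves membership in \<open>D\<close>.\<close>
    let ?t = "id(e1 := e2, e2 := e1)"
    have inj: "inj ?t" using e12 by (auto simp: inj_def)
    have tE: "?t x \<in> E" if "x \<in> E" for x using that e by auto
    have ht: "h (?t x) = h' x" for x using e12 by (simp add: h')
    \<comment> \<open>Apart from the excluded live debts, payments into \<open>D\<close> do not
      exceed those of their counterparts before the swap: a gaining debtor above \<open>v\<close>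
      with a live debt into \<open>D\<close> would close a cycle through \<open>v\<close>.\<close>
    have payC: "pay a' c \<le> pay a (?t c)"
      if c: "c \<in> E" "h' c \<in> D" "\<not> (c \<in> live a \<and> tail c \<in> insert v D)" for c
    proof -
      have "c \<noteq> e2" using c(2) v1D by (auto simp: h')
      moreover have "pay a' c = pay a c" if "c \<noteq> e1" "c \<noteq> e2"
      proof -
        have "tail c \<notin> S" if cl: "c \<in> live a"
        proof
          assume cS: "tail c \<in> S"
          have "(tail c, v) \<in> R\<^sup>* \<or> (v, tail c) \<in> R\<^sup>*"
            using single_valued_confluent[OF sv] reach[OF cS] reach[OF S(3)] RS_R by blast
          then have "(tail c, v) \<in> R\<^sup>*" "tail c \<noteq> v" using c(3) cl vD by auto
          then obtain z where "(tail c, z) \<in> R" "(z, v) \<in> R\<^sup>*" by (meson converse_rtranclE)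
          moreover have "(tail c, h c) \<in> R" using RI(1)[OF cl] .
          ultimately have "(h c, v) \<in> R\<^sup>*" using sv by (auto simp: single_valued_def)
          moreover have "(v, h c) \<in> R\<^sup>+" using c(2) that \<open>c \<noteq> e1\<close> \<open>c \<noteq> e2\<close> by (simp add: h' D)
          ultimately show False using acyc(1)
            by (meson acyclic_def trancl_rtrancl_trancl)
        qed
        then show ?thesis using c(1) by (simp add: pay' \<Delta>_S)
      qed
      ultimately show ?thesis using pay12 less by auto
    qed
    \<comment> \<open>Payments to banks outside \<open>D\<close> only grow, and there
      \<open>e2\<close> replaces the smaller payment of \<open>e1\<close>.\<close>
    have payT: "pay a (?t t) \<le> pay a' t" if t: "t \<in> E" "h' t \<notin> D" for t
    proof -
      have "t \<noteq> e1" using t(2) v2D e12 by (auto simp: h')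
      then show ?thesis using pay12 less mono by (auto intro: slice_mono)
    qed
    let ?I = "inversions h a v" and ?I' = "inversions h' a' v"
    \<comment> \<open>Exchanging \<open>e1\<close> and \<open>e2\<close> in both components embeds
      the new inversions into the old ones. It misses \<open>(e2, e1)\<close>, which is an inversion
      before the swap but whose preimage is none afterwards.\<close>
    have "map_prod ?t ?t ` ?I' \<subseteq> ?I - {(e2, e1)}"
    proof
      fix p assume "p \<in> map_prod ?t ?t ` ?I'"
      then obtain c t where p: "p = (?t c, ?t t)" and ct: "c \<in> E" "t \<in> E" "h' c \<in> D"
        "\<not> (c \<in> live a \<and> tail c \<in> insert v D)" "h' t \<notin> D" "pay a' t < pay a' c"
        unfolding inversions_def D' live' by auto
      have "c \<noteq> e2" using ct(3) v1D by (auto simp: h')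
      then have "\<not> (?t c \<in> live a \<and> tail (?t c) \<in> insert v D)" using ct(4) off2 by auto
      moreover have "pay a (?t t) < pay a (?t c)"
        using payC[of c] payT[of t] ct by force
      ultimately have "p \<in> ?I"
        unfolding p inversions_def D_def[symmetric] using ct by (auto simp: tE ht simp del: fun_upd_apply)
      moreover have "p \<noteq> (e2, e1)"
      proof
        assume "p = (e2, e1)"
        then have "c = e1" "t = e2" using p e12 by (auto split: if_splits)
        then show False using ct(6) pay12 less by simp
      qed
      ultimately show "p \<in> ?I - {(e2, e1)}" by simp
    qed
    moreover have "inj_on (map_prod ?t ?t) ?I'"
      using prod.inj_map[OF inj inj] by (rule inj_on_subset) simp
    ultimately have "card ?I' \<le> card (?I - {(e2, e1)})"
      using finite_Diff[OF finite_inversions] by (meson card_inj_on_le)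
    moreover have "(e2, e1) \<in> ?I"
      unfolding inversions_def D_def[symmetric] using e v2D v1D off2 less by auto
    ultimately have "card ?I' < card ?I"
      using card_Diff1_less[OF finite_inversions] by (meson le_less_trans)
    moreover have "unpaid a' = unpaid a" using sub un by auto
    ultimately show ?thesis by (simp add: potential_def)
  qed
qed

text \<open>Let \<open>S\<close> be the banks that have less than in the clearing state. The
  difference can only come from additional payments within \<open>S\<close>, yet without a live
  cycle some member of \<open>S\<close> lets part of its own difference leave \<open>S\<close> or
  keeps it, so the balance fails.\<close>

lemma clearing_of_acyclic:
  assumes inflow: "\<And>w. w \<in> V \<Longrightarrow> a w = inflow h a w"
    and acyc: "acyclic (live_graph h a)" and cl: "clearing h c" and w: "w \<in> V"
  shows "a w = c w"
proof (rule ccontr)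
  assume ne: "a w \<noteq> c w"
  have le: "a w \<le> c w" if "w \<in> V" for w
    using cl inflow that unfolding clearing_def by (metis order_refl)
  define S where "S = {w \<in> V. a w < c w}"
  have "w \<in> S" using ne le[OF w] w by (simp add: S_def)
  moreover have "wf ((live_graph h a)\<inverse>)"
    using finite_live_graph acyc by (rule finite_acyclic_wf_converse)
  \<comment> \<open>A last member of \<open>S\<close> along the live debts: here money gets lost for
    \<open>S\<close>.\<close>
  ultimately obtain u where u: "u \<in> S" "\<And>y. (u, y) \<in> live_graph h a \<Longrightarrow> y \<notin> S"
    unfolding wf_eq_minimal by (metis converse_iff)
  define d where "d = (\<lambda>e. pay c e - pay a e)"
  have d0: "0 \<le> d e" if "e \<in> E" for e
    unfolding d_def using that by (simp add: le slice_mono tailV)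
  have dS: "d e = 0" if "e \<in> E" "tail e \<notin> S" for e
    using that le[of "tail e"] tailV[of e] by (auto simp: d_def S_def)
  have finS: "finite S" using finV by (simp add: S_def)
  have nonexp: "(\<Sum>e | e \<in> E \<and> tail e = x. d e) \<le> c x - a x" if "x \<in> V" for x
    using nonexpansive[OF that le[OF that]] by (rule order.trans[rotated]) (auto simp: d_def intro!: sum_mono)
  let ?out = "\<lambda>x. \<Sum>e | e \<in> E \<and> tail e = x. if h e \<in> S then d e else 0"
  have out: "?out x \<le> (\<Sum>e | e \<in> E \<and> tail e = x. d e)"
    for x by (rule sum_mono) (use d0 in auto)
  have "?out u < c u - a u"
  proof (cases "\<exists>e\<in>live a. tail e = u")
    case True
    then obtain e where e: "e \<in> live a" "tail e = u" by blast
    then have eE: "e \<in> E" by (simp add: live_def)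
    have "h e \<notin> S" using u(2) e by (auto simp: live_graph_def)
    moreover have "0 < d e" using e u(1) by (auto simp: d_def slice_def live_def S_def)
    ultimately have "?out u
        < (\<Sum>e | e \<in> E \<and> tail e = u. d e)"
      using finE eE e d0 by (intro sum_strict_mono_ex1) auto
    then show ?thesis using nonexp[of u] u(1) by (simp add: S_def)
  next
    \<comment> \<open>Without a live debt \<open>u\<close> has paid all its debts and passes on
      nothing of its difference.\<close>
    case False
    have "d e = 0" if e: "e \<in> E" "tail e = u" for e
    proof -
      have "0 \<le> a u" using inflow[of u] inflow_nonneg[of u h a] u(1) by (simp add: S_def)
      moreover have "e0 \<in> live a" if "e0 \<in> E" "tail e0 = tail e" "lo e0 \<le> a u" "a u < hi e0" for e0
        using that e(2) by (simp add: live_def)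
      ultimately have "\<not> a u < lo e" using live_below_lo[OF e(1), of "a u"] e(2) False by blast
      then have "hi e \<le> a u" using False e by (force simp: live_def)
      then show ?thesis using u(1) e lo_hi[OF e(1)] by (auto simp: d_def slice_def S_def)
    qed
    then have "?out u = 0"
      by (intro sum.neutral) auto
    then show ?thesis using u(1) by (simp add: S_def)
  qed
  then have "(\<Sum>x\<in>S. ?out x) < (\<Sum>x\<in>S. c x - a x)"
  proof (intro sum_strict_mono_ex1 finS ballI)
    fix x assume "x \<in> S"
    then have "x \<in> V" by (simp add: S_def)
    then show "?out x \<le> c x - a x"
      using out nonexp order.trans by blast
  qed (use u(1) in blast)
  \<comment> \<open>The additional payments into \<open>S\<close> are counted by debtor here and by
    creditor below. Debtors outside \<open>S\<close> pay nothing additional.\<close>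
  moreover have "(\<Sum>x\<in>S. ?out x)
      = (\<Sum>e | e \<in> E \<and> tail e \<in> S. if h e \<in> S then d e else 0)"
    by (subst sum.group[where S = "{e \<in> E. tail e \<in> S}" and g = tail and T = S, symmetric])
      (use finE finS in \<open>auto intro!: sum.cong\<close>)
  moreover have "\<dots> = (\<Sum>e\<in>E. if h e \<in> S then d e else 0)"
    by (rule sum.mono_neutral_left) (use finE dS in auto)
  moreover have "(\<Sum>x\<in>S. c x - a x) = (\<Sum>x\<in>S. \<Sum>e\<in>E. if h e = x then d e else 0)"
  proof (rule sum.cong)
    fix x assume "x \<in> S"
    then have "x \<in> V" by (simp add: S_def)
    then have "c x - a x = inflow h c x - inflow h a x" using inflow cl by (simp add: clearing_def)
    then show "c x - a x = (\<Sum>e\<in>E. if h e = x then d e else 0)"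
      by (simp add: inflow_def sum_subtractf[symmetric] d_def if_distrib cong: if_cong)
  qed simp
  moreover have "\<dots> = (\<Sum>e\<in>E. if h e \<in> S then d e else 0)"
    by (subst sum.swap) (use finS in simp)
  ultimately show False by simp
qed

text \<open>
  The set \<open>Z\<close> has to consist of cycles: each of its members is fed by a live debt from \<open>Z\<close>, and
  each bank has only one live debt.
\<close>

definition advance :: "('e \<Rightarrow> 'v) \<Rightarrow> ('v \<Rightarrow> real) \<Rightarrow> ('v \<Rightarrow> real) \<Rightarrow> bool" where
  "advance h a a' \<longleftrightarrow> (\<exists>Z \<epsilon>. (\<forall>w\<in>Z. \<exists>e\<in>live a. tail e \<in> Z \<and> h e = w) \<and>
     (Z = {} \<longrightarrow> acyclic (live_graph h a)) \<and> 0 \<le> \<epsilon> \<and>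
     (\<forall>e\<in>live a. tail e \<in> Z \<longrightarrow> a (tail e) + \<epsilon> \<le> hi e) \<and>
     (Z \<noteq> {} \<longrightarrow> (\<exists>e\<in>live a. tail e \<in> Z \<and> a (tail e) + \<epsilon> = hi e)) \<and>
     (\<forall>w\<in>V. a' w = inflow h (\<lambda>w. if w \<in> Z then a w + \<epsilon> else a w) w))"

text \<open>If a nonempty \<open>Z\<close> is raised, the debt that attains equality in the choice
  of \<open>\<epsilon>\<close> becomes paid in full. Otherwise there is no live cycle, and the round
  merely passes on payments.\<close>

lemma advance_mono:
  assumes le: "\<forall>w\<in>V. a w \<le> inflow h a w" and adv: "advance h a a'"
  shows "w \<in> V \<Longrightarrow> a w \<le> a' w" and "w \<in> V \<Longrightarrow> a' w \<le> inflow h a' w"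
    and "unpaid a' \<subset> unpaid a \<or>
      acyclic (live_graph h a) \<and> (\<forall>w\<in>V. a' w = inflow h a w)"
proof -
  obtain Z \<epsilon> where *: "\<forall>w\<in>Z. \<exists>e\<in>live a. tail e \<in> Z \<and> h e = w"
      "Z = {} \<longrightarrow> acyclic (live_graph h a)" "0 \<le> \<epsilon>"
      "\<forall>e\<in>live a. tail e \<in> Z \<longrightarrow> a (tail e) + \<epsilon> \<le> hi e"
      "Z \<noteq> {} \<longrightarrow> (\<exists>e\<in>live a. tail e \<in> Z \<and> a (tail e) + \<epsilon> = hi e)"
      "\<forall>w\<in>V. a' w = inflow h (\<lambda>w. if w \<in> Z then a w + \<epsilon> else a w) w"
    using adv unfolding advance_def by (elim exE conjE)
  note Z = bspec[OF *(1)] mp[OF *(2)] and eps = *(3) mp[OF bspec[OF *(4)]] mp[OF *(5)]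
    and a' = bspec[OF *(6)]
  let ?b = "\<lambda>w. if w \<in> Z then a w + \<epsilon> else a w"
  have b: "?b w \<le> a' w" if "w \<in> V" for w
    unfolding a'[OF that] by (rule raise_le_inflow) (use le Z(1) eps(1,2) that in auto)
  have mono: "a w \<le> a' w" if "w \<in> V" for w
    using b[OF that] eps(1) by (simp split: if_splits)
  then show "w \<in> V \<Longrightarrow> a w \<le> a' w" .
  show "a' w \<le> inflow h a' w" if "w \<in> V"
    unfolding a'[OF that] using b by (rule inflow_mono)
  have sub: "unpaid a' \<subseteq> unpaid a" using mono tailV by (force simp: unpaid_def)
  show "unpaid a' \<subset> unpaid a \<or>
      acyclic (live_graph h a) \<and> (\<forall>w\<in>V. a' w = inflow h a w)"
  proof (cases "Z = {}")
    case True
    then show ?thesis using Z(2) a' by simp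
  next
    case False
    then obtain e where e: "e \<in> live a" "tail e \<in> Z" "a (tail e) + \<epsilon> = hi e" using eps by blast
    then have "hi e \<le> a' (tail e)" using b[of "tail e"] tailV by (auto simp: live_def)
    then have "e \<notin> unpaid a'" "e \<in> unpaid a" using e by (auto simp: unpaid_def live_def)
    then show ?thesis using sub by blast
  qed
qed

text \<open>While no debt becomes paid in full, the live debts stay fixed, and a change in round
  \<open>k\<close> stems from a path of \<open>k\<close> live debts. In an acyclic graph there is
  none of length \<open>card V\<close>, so by then a solution is reached. Round
  \<open>Suc (card V)\<close> serves to show that the state no longer changes.\<close>

lemma advance_block:
  assumes hV: "\<forall>e\<in>E. h e \<in> V" and cl: "clearing h c"
    and x0: "\<And>w. w \<in> V \<Longrightarrow> 0 \<le> x 0 w \<and> x 0 w \<le> inflow h (x 0) w"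
    and adv: "\<And>k. advance h (x k) (x (Suc k))"
    and un: "unpaid (x (Suc (card V))) = unpaid (x 0)" and w: "w \<in> V"
  shows "x (card V) w = c w"
proof -
  have le: "\<forall>w\<in>V. x k w \<le> inflow h (x k) w" for k
  proof (induction k)
    case (Suc k)
    show ?case using advance_mono(2)[OF Suc.IH adv] by blast
  qed (use x0 in simp)
  note advance = advance_mono[OF le adv]
  have mono: "x k w \<le> x (Suc k) w" if "w \<in> V" for k w
    using that by (rule advance(1))
  have mono': "x k w \<le> x m w" if "w \<in> V" "k \<le> m" for k m w
    using lift_Suc_mono_le[of "\<lambda>k. x k w", OF mono] that by blast
  have nonneg: "0 \<le> x k w" if "w \<in> V" for k w
    using x0[OF that] mono'[OF that, of 0 k] by simp
  have anti: "unpaid (x m) \<subseteq> unpaid (x k)" if "k \<le> m" for k m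
    using mono'[OF tailV that] by (force simp: unpaid_def)
  have same: "unpaid (x k) = unpaid (x 0)" if "k \<le> Suc (card V)" for k
    using anti[OF that] anti[of 0 k] un by auto
  have step: "acyclic (live_graph h (x k))" "\<And>w. w \<in> V \<Longrightarrow> x (Suc k) w = inflow h (x k) w"
    if "k \<le> card V" for k
    using advance(3)[of k] same[of k] same[of "Suc k"] that by auto
  have incr: "pay (x (Suc k)) e = pay (x k) e + (if e \<in> live (x k) then x (Suc k) (tail e) - x k (tail e) else 0)"
      and live: "e \<in> live (x (Suc k)) \<longleftrightarrow> e \<in> live (x k)"
    if "e \<in> E" "k \<le> card V" for e k
    using pay_increase[of "x k" e "x (Suc k)"] nonneg mono same[of k] same[of "Suc k"] that tailV
    by auto
  have live0: "live (x k) = live (x 0)" if "k \<le> card V" for k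
    using that
  proof (induction k)
    case (Suc k)
    then show ?case using live[of _ k] by (auto simp: live_def)
  qed simp
  \<comment> \<open>A change at \<open>w\<close> is a change of some incoming payment, hence of the
    assets of a debtor with a live debt to \<open>w\<close> one round earlier.\<close>
  have path: "\<exists>u. (u, w) \<in> live_graph h (x 0) ^^ k"
    if "k \<le> card V" "w \<in> V" "x k w < x (Suc k) w" for k w
    using that
  proof (induction k arbitrary: w)
    case (Suc k)
    have "0 < (\<Sum>e\<in>E. (if h e = w then pay (x (Suc k)) e else 0) - (if h e = w then pay (x k) e else 0))"
      using Suc step(2)[of k w] step(2)[of "Suc k" w] by (simp add: inflow_def sum_subtractf)
    then obtain e where e: "e \<in> E"
      "0 < (if h e = w then pay (x (Suc k)) e else 0) - (if h e = w then pay (x k) e else 0)"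
      by (meson ex_pos_of_sum_pos)
    then have "h e = w" "e \<in> live (x k)" "x k (tail e) < x (Suc k) (tail e)"
      using incr[OF e(1), of k] Suc.prems(1) by (auto split: if_splits)
    then have "(tail e, w) \<in> live_graph h (x 0)" "\<exists>u. (u, tail e) \<in> live_graph h (x 0) ^^ k"
      using Suc live0[of k] tailV[OF e(1)] by (auto simp: live_graph_def)
    then show ?case by auto
  qed simp
  have sub: "live_graph h (x 0) \<subseteq> V \<times> V" using hV tailV by (auto simp: live_graph_def live_def)
  have "x (Suc (card V)) w = x (card V) w" if wV: "w \<in> V" for w
  proof (rule ccontr)
    assume "x (Suc (card V)) w \<noteq> x (card V) w"
    then have "x (card V) w < x (Suc (card V)) w" using mono[OF wV, of "card V"] by simp
    then obtain u where u: "(u, w) \<in> live_graph h (x 0) ^^ card V" using path[OF order_refl wV] by blast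
    show False using acyclic_relpow_less_card[OF step(1)[of 0] finV sub u wV] by simp
  qed
  then show ?thesis
    using clearing_of_acyclic[OF _ step(1)[of "card V"] cl w] step(2)[of "card V"] by simp
qed

text \<open>A block of \<open>Suc (card V)\<close> rounds either reaches the clearing state or pays
  some debt in full. The latter happens in at most \<open>card E\<close> blocks, so
  \<open>Suc (card E)\<close> blocks suffice.\<close>

lemma advance_converges:
  assumes hV: "\<forall>e\<in>E. h e \<in> V" and cl: "clearing h c"
    and x0: "\<And>w. w \<in> V \<Longrightarrow> 0 \<le> x 0 w \<and> x 0 w \<le> inflow h (x 0) w"
    and adv: "\<And>k. advance h (x k) (x (Suc k))"
    and m: "Suc (card E) * Suc (card V) \<le> m" and w: "w \<in> V"
  shows "x m w = c w"
proof -
  let ?n = "Suc (card V)"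
  have le: "\<forall>w\<in>V. x k w \<le> inflow h (x k) w" for k
  proof (induction k)
    case (Suc k)
    show ?case using advance_mono(2)[OF Suc.IH adv] by blast
  qed (use x0 in simp)
  have mono: "x k w \<le> x m w" if "w \<in> V" "k \<le> m" for k m w
    by (rule lift_Suc_mono_le[of "\<lambda>k. x k w", OF advance_mono(1)[OF le adv that(1)] that(2)])
  have nonneg: "0 \<le> x k w" if "w \<in> V" for k w
    using x0[OF that] mono[OF that, of 0 k] by simp
  have upper: "x k w \<le> c w" if "w \<in> V" for k w
    using cl le[of k] that unfolding clearing_def by blast
  have block: "(\<forall>w\<in>V. x (k + card V) w = c w) \<or> card (unpaid (x (k + ?n))) < card (unpaid (x k))" for k
  proof (cases "unpaid (x (k + ?n)) = unpaid (x k)")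
    case True
    then show ?thesis
      using advance_block[OF hV cl, of "\<lambda>j. x (k + j)"] le[of k] nonneg[of _ k] adv by simp
  next
    case False
    have "unpaid (x (k + ?n)) \<subseteq> unpaid (x k)"
      using mono[OF tailV, of _ k "k + ?n"] by (force simp: unpaid_def)
    then show ?thesis using False finE by (auto intro!: psubset_card_mono simp: unpaid_def)
  qed
  have "(\<forall>w\<in>V. x (j * ?n) w = c w) \<or> card (unpaid (x (j * ?n))) + j \<le> card E" for j
  proof (induction j)
    case 0
    show ?case using finE by (auto intro!: card_mono simp: unpaid_def)
  next
    case (Suc j)
    \<comment> \<open>Once reached, the clearing state is kept: later rounds cannot decrease the
      assets, and \<open>c\<close> bounds them.\<close>
    have fin: "\<forall>w\<in>V. x m w = c w" if "\<forall>w\<in>V. x k w = c w" "k \<le> m" for k m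
      using mono[OF _ that(2)] upper that(1) by (metis order.antisym)
    have eq: "Suc j * ?n = j * ?n + ?n" by simp
    from Suc show ?case
    proof
      assume "\<forall>w\<in>V. x (j * ?n) w = c w"
      then show ?thesis using fin[of "j * ?n" "Suc j * ?n"] by simp
    next
      assume "card (unpaid (x (j * ?n))) + j \<le> card E"
      then show ?thesis
        using block[of "j * ?n"] fin[of "j * ?n + card V" "Suc j * ?n"] unfolding eq by force
    qed
  qed
  from this[of "Suc (card E)"] have "x (Suc (card E) * ?n) w = c w" using w by auto
  then show ?thesis using mono[OF w m] upper[OF w, of m] by simp
qed

end

text \<open>
  Debts are indexed by their positions in the rankings, since these, unlike the debts
  themselves, survive a swap.
\<close>

definition positions :: "'v network \<Rightarrow> ('v \<times> nat) set" where
  "positions N = Sigma (banks N) (\<lambda>u. {..<length (ranking N u)})"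

definition debt_at :: "'v network \<Rightarrow> 'v \<times> nat \<Rightarrow> 'v \<times> 'v" where
  "debt_at N p = ranking N (fst p) ! snd p"

text \<open>The value off the positions is one that no swap affects, so that a swap becomes an
  equation between total functions.\<close>

definition creditor :: "'v network \<Rightarrow> 'v \<times> nat \<Rightarrow> 'v" where
  "creditor N p = (if p \<in> positions N then snd (debt_at N p) else fst p)"

text \<open>The total owed on the first \<open>i\<close> debts in payment order. It is 0 off the
  banks, since the rankings there are arbitrary and a swap might change their sums.\<close>

definition due :: "'v network \<Rightarrow> 'v \<Rightarrow> nat \<Rightarrow> nat" where
  "due N u i = (if u \<in> banks N then sum_list (take i (map (liab N) (ranking N u))) else 0)"

definition lower :: "'v network \<Rightarrow> 'v \<times> nat \<Rightarrow> real" where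
  "lower N p = real (due N (fst p) (snd p))"

definition upper :: "'v network \<Rightarrow> 'v \<times> nat \<Rightarrow> real" where
  "upper N p = real (due N (fst p) (Suc (snd p)))"

abbreviation ext_real :: "'v network \<Rightarrow> 'v \<Rightarrow> real" where
  "ext_real N \<equiv> (\<lambda>w. real (ext_assets N w))"

section \<open>Financial networks as debt systems\<close>

lemma networkD:
  assumes "edge_ranking_network N"
  shows "finite (banks N)" "finite (debts N)" "e \<in> debts N \<Longrightarrow> fst e \<in> banks N"
    "e \<in> debts N \<Longrightarrow> snd e \<in> banks N" "e \<in> debts N \<Longrightarrow> fst e \<noteq> snd e" "e \<in> debts N \<Longrightarrow> 0 < liab N e"
    "u \<in> banks N \<Longrightarrow> distinct (ranking N u)"
    "u \<in> banks N \<Longrightarrow> set (ranking N u) = {e \<in> debts N. fst e = u}"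
proof -
  interpret G: pair_digraph "graph N" using assms by (simp add: edge_ranking_network_def)
  show "finite (banks N)" "finite (debts N)" "e \<in> debts N \<Longrightarrow> fst e \<in> banks N"
    "e \<in> debts N \<Longrightarrow> snd e \<in> banks N" "e \<in> debts N \<Longrightarrow> fst e \<noteq> snd e"
    using G.arc_fst_in_verts G.arc_snd_in_verts G.pair_no_loops G.pair_finite_verts G.pair_finite_arcs
    by auto
  show "e \<in> debts N \<Longrightarrow> 0 < liab N e" "u \<in> banks N \<Longrightarrow> distinct (ranking N u)"
    "u \<in> banks N \<Longrightarrow> set (ranking N u) = {e \<in> debts N. fst e = u}"
    using assms by (auto simp: edge_ranking_network_def)
qed

lemma due_Suc:
  "u \<in> banks N \<Longrightarrow> i < length (ranking N u) \<Longrightarrow>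
    due N u (Suc i) = due N u i + liab N (ranking N u ! i)"
  by (simp add: due_def take_Suc_conv_app_nth)

lemma due_mono: "i \<le> j \<Longrightarrow> due N u i \<le> due N u j"
proof -
  assume "i \<le> j"
  then obtain k where k: "j = i + k" using le_Suc_ex by blast
  show ?thesis by (simp add: due_def k take_add)
qed

lemma finite_positions: "edge_ranking_network N \<Longrightarrow> finite (positions N)"
  by (simp add: positions_def networkD)

lemma bij_betw_debt_at:
  assumes N: "edge_ranking_network N"
  shows "bij_betw (debt_at N) (positions N) (debts N)"
  unfolding bij_betw_def
proof
  have at: "debt_at N (u, i) \<in> {e \<in> debts N. fst e = u}" if "(u, i) \<in> positions N" for u i
    using that networkD(8)[OF N, of u] nth_mem[of i "ranking N u"]
    by (auto simp: positions_def debt_at_def)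
  show "inj_on (debt_at N) (positions N)"
  proof (rule inj_onI, clarify)
    fix u i u' j
    assume p: "(u, i) \<in> positions N" "(u', j) \<in> positions N" and eq: "debt_at N (u, i) = debt_at N (u', j)"
    have "u = u'" using at[OF p(1)] at[OF p(2)] eq by simp
    then show "u = u' \<and> i = j"
      using p eq networkD(7)[OF N, of u]
      by (auto simp: positions_def debt_at_def nth_eq_iff_index_eq)
  qed
  show "debt_at N ` positions N = debts N"
  proof
    show "debt_at N ` positions N \<subseteq> debts N" using at by force
    show "debts N \<subseteq> debt_at N ` positions N"
    proof
      fix e assume e: "e \<in> debts N"
      then have u: "fst e \<in> banks N" using networkD[OF N] by blast
      then have "e \<in> set (ranking N (fst e))" using e networkD(8)[OF N u] by simp
      then obtain i where "i < length (ranking N (fst e))" "ranking N (fst e) ! i = e"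
        by (auto simp: in_set_conv_nth)
      then show "e \<in> debt_at N ` positions N"
        using u by (intro image_eqI[of _ _ "(fst e, i)"]) (auto simp: positions_def debt_at_def)
    qed
  qed
qed

lemma debt_at_in_debts:
  assumes "edge_ranking_network N" "p \<in> positions N"
  shows "debt_at N p \<in> debts N" "fst (debt_at N p) = fst p"
proof -
  have "fst p \<in> banks N" "debt_at N p \<in> set (ranking N (fst p))"
    using assms(2) by (auto simp: positions_def debt_at_def)
  then show "debt_at N p \<in> debts N" "fst (debt_at N p) = fst p"
    using networkD(8)[OF assms(1)] by auto
qed

lemma creditor_in_banks:
  assumes "edge_ranking_network N" "p \<in> positions N"
  shows "creditor N p \<in> banks N"
  using networkD(4)[OF assms(1) debt_at_in_debts(1)[OF assms]] assms(2)
  by (simp add: creditor_def)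

lemma card_positions: "edge_ranking_network N \<Longrightarrow> card (positions N) = card (debts N)"
  using bij_betw_debt_at by (rule bij_betw_same_card)

text \<open>\<open>slice l h x\<close> measures the part of the interval from \<open>l\<close> to
  \<open>h\<close> that lies below \<open>x\<close>, and consecutive slices tile the interval from 0
  to \<open>s n\<close>.\<close>

lemma slice_sum:
  assumes "mono s" "s 0 = 0"
  shows "(\<Sum>i<n. slice (s i) (s (Suc i)) x) = min (s n) (max 0 x)"
proof (induction n)
  case (Suc n)
  have "0 \<le> s n" "s n \<le> s (Suc n)" using assms by (metis le0 monoD, simp add: monoD)
  then show ?case using Suc by (auto simp: slice_def)
qed (use assms in simp)

lemma network_debt_system:
  assumes N: "edge_ranking_network N"
  shows "debt_system (banks N) (positions N) fst (lower N) (upper N) (ext_real N)"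
proof
  show "finite (banks N)" "finite (positions N)"
    by (simp_all add: networkD(1)[OF N] finite_positions[OF N])
  have in_pos: "(u, i) \<in> positions N \<longleftrightarrow> u \<in> banks N \<and> i < length (ranking N u)" for u i
    by (auto simp: positions_def)
  fix p assume p: "p \<in> positions N"
  then obtain u i where ui: "p = (u, i)" "u \<in> banks N" "i < length (ranking N u)"
    by (auto simp: positions_def)
  show "fst p \<in> banks N" using ui by simp
  have "0 < liab N (ranking N u ! i)"
    using networkD(6)[OF N debt_at_in_debts(1)[OF N p]] by (simp add: debt_at_def ui(1))
  then show "lower N p < upper N p" using ui by (simp add: lower_def upper_def due_Suc)
  show "upper N p \<le> lower N p' \<or> upper N p' \<le> lower N p"
    if p': "p' \<in> positions N" "fst p = fst p'" "p \<noteq> p'" for p'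
  proof -
    have "Suc (snd p) \<le> snd p' \<or> Suc (snd p') \<le> snd p"
      using p' by (cases p, cases p') auto
    then show ?thesis using p' due_mono[of _ _ N] by (auto simp: lower_def upper_def)
  qed
  show "\<exists>p0\<in>positions N. fst p0 = fst p \<and> lower N p0 \<le> x \<and> x < upper N p0"
    if x: "0 \<le> x" "x < upper N p" for x
  proof -
    \<comment> \<open>The first debt whose slice ends above \<open>x\<close>; by minimality its
      slice begins at or below \<open>x\<close>.\<close>
    define j where "j = (LEAST j. x < real (due N u (Suc j)))"
    have ex: "x < real (due N u (Suc i))" using x ui by (simp add: upper_def)
    have j: "x < real (due N u (Suc j))" unfolding j_def using ex by (rule LeastI)
    have "j \<le> i" unfolding j_def using ex by (rule Least_le)
    have "real (due N u j) \<le> x"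
    proof (cases j)
      case (Suc k)
      then have "k < (LEAST j. x < real (due N u (Suc j)))" by (simp add: j_def)
      then have "\<not> x < real (due N u (Suc k))" by (rule not_less_Least)
      then show ?thesis using Suc by simp
    qed (use x in \<open>simp add: due_def\<close>)
    then show ?thesis
      using j \<open>j \<le> i\<close> ui by (intro bexI[of _ "(u, j)"]) (auto simp: lower_def upper_def in_pos)
  qed
next
  fix w assume "w \<in> banks N"
  show "0 \<le> ext_real N w" by simp
next
  fix u and x y :: real assume u: "u \<in> banks N" and xy: "x \<le> y"
  have eq: "{p \<in> positions N. fst p = u} = Pair u ` {..<length (ranking N u)}"
    using u by (auto simp: positions_def)
  let ?s = "\<lambda>i. real (due N u i)"
  have m: "mono ?s" "?s 0 = 0" using due_mono[of _ _ N u] by (auto simp: mono_def due_def)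
  have "(\<Sum>p | p \<in> positions N \<and> fst p = u. slice (lower N p) (upper N p) y - slice (lower N p) (upper N p) x)
      = (\<Sum>i<length (ranking N u). slice (?s i) (?s (Suc i)) y - slice (?s i) (?s (Suc i)) x)"
    unfolding eq by (subst sum.reindex) (auto simp: inj_on_def lower_def upper_def)
  \<comment> \<open>A bank pays out the smaller of its assets and its total debt, which is a
    nonexpansive function of the assets.\<close>
  also have "\<dots> = min (?s (length (ranking N u))) (max 0 y) - min (?s (length (ranking N u))) (max 0 x)"
    by (simp add: sum_subtractf slice_sum[OF m])
  also have "\<dots> \<le> y - x" using xy by auto
  finally show "(\<Sum>p | p \<in> positions N \<and> fst p = u.
      slice (lower N p) (upper N p) y - slice (lower N p) (upper N p) x) \<le> y - x" .
qed

lemma of_nat_sum_list: "of_nat (sum_list xs) = sum_list (map of_nat xs)"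
  by (induction xs) simp_all

locale network_system = debt_system "banks N" "positions N" fst "lower N" "upper N" "ext_real N"
  for N :: "'v network"

lemma network_systemI: "edge_ranking_network N \<Longrightarrow> network_system N"
  unfolding network_system_def by (rule network_debt_system)

lemma payment_debt_at:
  assumes N: "edge_ranking_network N" and p: "p \<in> positions N"
  shows "payment N (debt_at N p) x = slice (lower N p) (upper N p) x"
proof -
  obtain u i where ui: "p = (u, i)" "u \<in> banks N" "i < length (ranking N u)"
    using p by (auto simp: positions_def)
  have "takeWhile (\<lambda>e'. e' \<noteq> ranking N u ! i) (ranking N u) = take i (ranking N u)"
    using ui networkD(7)[OF N ui(2)]
    by (intro takeWhile_eq_take_P_nth) (auto simp: nth_eq_iff_index_eq)
  then have "(\<Sum>e'\<leftarrow>takeWhile (\<lambda>e'. e' \<noteq> debt_at N p) (ranking N (fst (debt_at N p))). real (liab N e'))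
      = lower N p"
    using debt_at_in_debts(2)[OF N p] ui
    by (simp add: debt_at_def lower_def due_def take_map of_nat_sum_list o_def)
  moreover have "upper N p - lower N p = real (liab N (debt_at N p))"
    using ui by (simp add: lower_def upper_def due_Suc debt_at_def)
  ultimately show ?thesis by (simp add: payment_def slice_def)
qed

lemma inflow_network:
  assumes N: "edge_ranking_network N"
  shows "debt_system.inflow (positions N) fst (lower N) (upper N) (ext_real N) (creditor N) a w =
    real (ext_assets N w) + (\<Sum>e\<in>in_arcs (with_proj (graph N)) w. payment N e (a (fst e)))"
proof -
  interpret network_system N using N by (rule network_systemI)
  have "(\<Sum>e\<in>in_arcs (with_proj (graph N)) w. payment N e (a (fst e)))
      = (\<Sum>e\<in>debts N. if snd e = w then payment N e (a (fst e)) else 0)"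
    using networkD(2)[OF N] by (simp add: in_arcs_def sum.inter_filter)
  also have "\<dots> = (\<Sum>p\<in>positions N. if snd (debt_at N p) = w
      then payment N (debt_at N p) (a (fst (debt_at N p))) else 0)"
    by (rule sum.reindex_bij_betw[OF bij_betw_debt_at[OF N], symmetric])
  also have "\<dots> = (\<Sum>p\<in>positions N. if creditor N p = w
      then slice (lower N p) (upper N p) (a (fst p)) else 0)"
    by (intro sum.cong refl) (simp add: payment_debt_at[OF N] debt_at_in_debts(2)[OF N] creditor_def)
  finally show ?thesis by (simp add: inflow_def)
qed

text \<open>\<open>total_assets\<close> is the greatest solution, \<open>clearing\<close> compares
  with all vectors below their inflow. Each state satisfies the competitor condition of the other,
  so they coincide.\<close>

lemma clearing_total_assets:
  assumes N: "edge_ranking_network N"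
  shows "debt_system.clearing (banks N) (positions N) fst (lower N) (upper N) (ext_real N)
    (creditor N) (total_assets N)"
proof -
  interpret network_system N using N by (rule network_systemI)
  obtain c where c: "clearing (creditor N) c" using ex_clearing by blast
  have feas: "feasible_assets N a \<longleftrightarrow>
      (\<forall>w\<in>banks N. a w = inflow (creditor N) a w) \<and> (\<forall>w. w \<notin> banks N \<longrightarrow> a w = 0)" for a
    by (simp add: feasible_assets_def inflow_network[OF N])
  have "feasible_assets N c" using c by (auto simp: feas clearing_def)
  then have "c \<le> total_assets N" by (rule greatest_feasible_assets(2))
  moreover have "total_assets N w \<le> c w" for w
  proof (cases "w \<in> banks N")
    case True
    moreover have "\<forall>w\<in>banks N. total_assets N w \<le> inflow (creditor N) (total_assets N) w"
      using greatest_feasible_assets(1)[of N] unfolding feas by simp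
    ultimately show ?thesis using c unfolding clearing_def by blast
  qed (use c greatest_feasible_assets(1)[of N] in \<open>auto simp: feas clearing_def\<close>)
  ultimately have "total_assets N = c" by (auto simp: le_fun_def intro!: ext antisym)
  then show ?thesis using c by simp
qed

text \<open>A swapped debt keeps its rank and its liability, so in terms of positions both networks
  form the same debt system and merely two creditors are exchanged.\<close>

lemma swap_network:
  assumes N: "edge_ranking_network N" and s: "is_debt_swap N ((u1, v1), (u2, v2))"
  defines "N' \<equiv> apply_swap ((u1, v1), (u2, v2)) N"
  shows "banks N' = banks N" "ext_assets N' = ext_assets N" "positions N' = positions N"
    "lower N' = lower N" "upper N' = upper N"
    "\<exists>p1\<in>positions N. \<exists>p2\<in>positions N. creditor N p1 = v1 \<and> creditor N p2 = v2 \<and>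
      creditor N' = (creditor N)(p1 := v2, p2 := v1)"
proof -
  let ?f = "id((u1, v1) := (u1, v2), (u2, v2) := (u2, v1))"
  have rk: "ranking N' u = map ?f (ranking N u)" for u by (simp add: N'_def)
  show banks: "banks N' = banks N" and "ext_assets N' = ext_assets N" by (simp_all add: N'_def)
  show pos: "positions N' = positions N" by (simp add: positions_def banks rk)
  \<comment> \<open>The new edges are absent before the swap, so setting their liabilities
    overwrites none of a remaining debt.\<close>
  have "liab N' (?f e) = liab N e" if "e \<in> debts N" for e
    using s that by (auto simp: N'_def)
  then have "map (liab N') (ranking N' u) = map (liab N) (ranking N u)" if "u \<in> banks N" for u
    using networkD(8)[OF N that] by (auto simp: rk)
  then have "due N' = due N" by (auto simp: due_def banks fun_eq_iff)
  then show "lower N' = lower N" "upper N' = upper N" by (simp_all add: lower_def upper_def fun_eq_iff)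
  have "(u1, v1) \<in> debt_at N ` positions N" "(u2, v2) \<in> debt_at N ` positions N"
    using s bij_betw_debt_at[OF N] by (auto simp: bij_betw_def)
  then obtain p1 p2 where p: "p1 \<in> positions N" "debt_at N p1 = (u1, v1)"
      "p2 \<in> positions N" "debt_at N p2 = (u2, v2)" by (auto simp del: is_debt_swap.simps)
  have inj: "p = q" if "p \<in> positions N" "q \<in> positions N" "debt_at N p = debt_at N q" for p q
    using bij_betw_debt_at[OF N] that by (auto simp: bij_betw_def inj_on_def)
  have at: "debt_at N' p = ?f (debt_at N p)" if "p \<in> positions N" for p
    using that by (auto simp: debt_at_def rk positions_def simp del: fun_upd_apply)
  have "p1 \<noteq> p2" using s p by auto
  have "creditor N' = (creditor N)(p1 := v2, p2 := v1)"
  proof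
    fix q
    show "creditor N' q = ((creditor N)(p1 := v2, p2 := v1)) q"
    proof (cases "q \<in> positions N")
      case True
      consider "q = p1" | "q = p2" | "q \<noteq> p1" "q \<noteq> p2" by blast
      then show ?thesis
      proof cases
        case 3
        then have "debt_at N q \<noteq> (u1, v1)" "debt_at N q \<noteq> (u2, v2)"
          using inj[OF True] p by metis+
        then show ?thesis using 3 True by (simp add: creditor_def pos at)
      qed (use p \<open>p1 \<noteq> p2\<close> s in \<open>simp_all add: creditor_def pos at\<close>)
    next
      case False
      then show ?thesis using p by (auto simp: creditor_def pos)
    qed
  qed
  then show "\<exists>p1\<in>positions N. \<exists>p2\<in>positions N. creditor N p1 = v1 \<and> creditor N p2 = v2 \<and>
      creditor N' = (creditor N)(p1 := v2, p2 := v1)"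
    using p by (intro bexI[of _ p1] bexI[of _ p2]) (auto simp: creditor_def)
qed

definition swap_potential :: "'v \<Rightarrow> 'v network \<Rightarrow> nat" where
  "swap_potential v N = debt_system.potential (positions N) fst (lower N) (upper N)
     (creditor N) (total_assets N) v"

lemma swap_potential_le:
  assumes N: "edge_ranking_network N"
  shows "swap_potential v N \<le> Suc (card (debts N)) ^ 3"
proof -
  interpret network_system N using N by (rule network_systemI)
  let ?m = "card (positions N)"
  have "card (unpaid (total_assets N)) \<le> ?m"
    by (intro card_mono finite_positions[OF N]) (auto simp: unpaid_def)
  then have "swap_potential v N \<le> ?m * Suc (?m * ?m) + ?m * ?m"
    unfolding swap_potential_def potential_def
    by (intro add_mono mult_le_mono1 card_inversions_le)
  also have "\<dots> \<le> Suc ?m ^ 3" by (simp add: power3_eq_cube algebra_simps)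
  finally show ?thesis by (simp add: card_positions[OF N])
qed

lemma swap_potential_less:
  assumes N: "edge_ranking_network N" and step: "semi_swap_step v N \<sigma>"
  shows "swap_potential v (apply_swap \<sigma> N) < swap_potential v N"
proof -
  obtain u1 v1 u2 v2 where \<sigma>: "\<sigma> = ((u1, v1), (u2, v2))" by (metis surj_pair)
  have s: "is_debt_swap N ((u1, v1), (u2, v2))" using step by (simp add: semi_swap_step_def \<sigma>)
  interpret network_system N using N by (rule network_systemI)
  let ?N' = "apply_swap \<sigma> N"
  have N': "edge_ranking_network ?N'"
    using N step by (simp add: edge_ranking_network_apply_swap semi_swap_step_def)
  obtain p1 p2 where p: "p1 \<in> positions N" "p2 \<in> positions N" "creditor N p1 = v1" "creditor N p2 = v2"
    "creditor ?N' = (creditor N)(p1 := v2, p2 := v1)"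
    using swap_network(6)[OF N s, folded \<sigma>] by (elim bexE conjE)
  note eqs = swap_network(1-5)[OF N s, folded \<sigma>]
  let ?a = "total_assets N" and ?a' = "total_assets ?N'"
  have cl: "clearing (creditor N) ?a" "clearing (creditor ?N') ?a'"
    using clearing_total_assets[OF N] clearing_total_assets[OF N'] by (simp_all add: eqs)
  have hV: "creditor N q \<in> banks N" if "q \<in> positions N" for q
    using that by (rule creditor_in_banks[OF N])
  have v: "?a v < ?a' v" using step by (simp add: semi_swap_step_def improving_def)
  have ne: "v1 \<noteq> v2" "p1 \<noteq> p2" using s p by auto
  have "?a v1 < ?a' v1 \<and> ?a' v2 = ?a v2 \<or> ?a v2 < ?a' v2 \<and> ?a' v1 = ?a v1"
    using step by (auto simp: semi_swap_step_def \<sigma> Let_def)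
  then have "potential (creditor ?N') ?a' v < potential (creditor N) ?a v"
  proof
    assume "?a v1 < ?a' v1 \<and> ?a' v2 = ?a v2"
    then show ?thesis using p ne cl v hV
      by (intro swap_potential[of "creditor N" p1 p2]) auto
  next
    \<comment> \<open>With the other creditor gaining, the two positions exchange their
      roles.\<close>
    assume "?a v2 < ?a' v2 \<and> ?a' v1 = ?a v1"
    then show ?thesis using p ne cl v hV
      by (intro swap_potential[of "creditor N" p2 p1]) (auto simp: fun_upd_twist)
  qed
  then show ?thesis by (simp add: swap_potential_def eqs)
qed

lemma length_semi_swap_sequence:
  assumes "edge_ranking_network N" "semi_swap_sequence v N \<sigma>s"
  shows "length \<sigma>s \<le> swap_potential v N"
  using assms
proof (induction \<sigma>s arbitrary: N)
  case (Cons \<sigma> \<sigma>s)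
  have step: "semi_swap_step v N \<sigma>" using Cons.prems(2) by simp
  then have "edge_ranking_network (apply_swap \<sigma> N)"
    using edge_ranking_network_apply_swap[OF Cons.prems(1)] by (simp add: semi_swap_step_def)
  then have "length \<sigma>s \<le> swap_potential v (apply_swap \<sigma> N)" using Cons.IH Cons.prems(2) by simp
  then show ?case using swap_potential_less[OF Cons.prems(1) step] by simp
qed simp

lemma semi_swap_sequence_bound:
  "\<exists>q :: nat poly. \<forall>(N :: 'v network) v \<sigma>s.
     edge_ranking_network N \<longrightarrow> v \<in> banks N \<longrightarrow> semi_swap_sequence v N \<sigma>s \<longrightarrow>
     length \<sigma>s \<le> poly q (network_size N)"
proof (intro exI[of _ "[:1, 1:] ^ 3"] allI impI)
  fix N :: "'v network" and v \<sigma>s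
  assume N: "edge_ranking_network N" and s: "semi_swap_sequence v N \<sigma>s"
  have "length \<sigma>s \<le> Suc (card (debts N)) ^ 3"
    using length_semi_swap_sequence[OF N s] swap_potential_le[OF N, of v] by simp
  also have "\<dots> \<le> Suc (network_size N) ^ 3" by (intro power_mono) (simp_all add: network_size_def)
  also have "\<dots> = poly ([:1, 1:] ^ 3) (network_size N)" unfolding poly_power by simp
  finally show "length \<sigma>s \<le> poly ([:1, 1:] ^ 3) (network_size N)" .
qed

section \<open>Polynomial-time functions\<close>

text \<open>Relocation: if \<open>k\<close> functions are put in front of a program, the indices in
  its calls have to grow by \<open>k\<close>.\<close>

fun shift :: "nat \<Rightarrow> expr \<Rightarrow> expr" where
  "shift k (EVar i) = EVar i"
| "shift k ENil = ENil"
| "shift k (ECons e e') = ECons (shift k e) (shift k e')"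
| "shift k (EHd e) = EHd (shift k e)"
| "shift k (ETl e) = ETl (shift k e)"
| "shift k (EIf e e1 e2) = EIf (shift k e) (shift k e1) (shift k e2)"
| "shift k (ELet e e') = ELet (shift k e) (shift k e')"
| "shift k (ECall f es) = ECall (f + k) (map (shift k) es)"

lemma eval_shift:
  "eval P env e x t \<Longrightarrow> eval (A @ map (shift (length A)) P) env (shift (length A) e) x t"
  "evals P env es xs t \<Longrightarrow> evals (A @ map (shift (length A)) P) env (map (shift (length A)) es) xs t"
  by (induction rule: eval_evals.inducts) (auto intro: eval_evals.intros simp: nth_append simp del: One_nat_def)

lemma eval_append:
  "eval P env e x t \<Longrightarrow> eval (P @ B) env e x t"
  "evals P env es xs t \<Longrightarrow> evals (P @ B) env es xs t"
proof (induction rule: eval_evals.inducts)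
  case (Call env es xs m f y n)
  then have "eval (P @ B) xs ((P @ B) ! f) y n" by (simp add: nth_append)
  then show ?case using Call by (auto intro: eval_evals.Call)
qed (auto intro: eval_evals.intros simp del: One_nat_def)

lemma eval_call:
  assumes "eval P env e x m" "i < length P" "eval P [x] (P ! i) y n"
  shows "eval P env (ECall i [e]) y (m + n + 3)"
proof -
  have "evals P env [e] [x] (Suc (m + 1))"
    using assms(1) by (intro Args_Cons Args_Nil)
  from Call[OF this assms(2,3)] show ?thesis by (simp add: numeral_3_eq_3)
qed

lemma eval_arg: "eval P [x] (EVar 0) x 1"
  using Var[of 0 "[x]" P] by simp

lemma eval_call_arg:
  assumes "i < length P" "eval P [x] (P ! i) y n"
  shows "eval P [x] (ECall i [EVar 0]) y (n + 4)"
  using eval_call[OF eval_arg assms] by (simp add: add.commute)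

abbreviation runs :: "program \<Rightarrow> tree \<Rightarrow> expr \<Rightarrow> tree \<Rightarrow> nat \<Rightarrow> bool" where
  "runs P x e y k \<equiv> \<exists>t. eval P [x] e y t \<and> t \<le> k \<and> cells y \<le> k"

text \<open>The function may stand at any index \<open>i\<close>, so that several of them can be
  linked into one program. Nothing is demanded on inputs outside \<open>D\<close>.\<close>

definition implements ::
  "program \<Rightarrow> nat \<Rightarrow> nat poly \<Rightarrow> ('a \<Rightarrow> tree) \<Rightarrow> ('b \<Rightarrow> tree) \<Rightarrow> 'a set \<Rightarrow> ('a \<Rightarrow> 'b) \<Rightarrow> bool" where
  "implements P i q ea eb D f \<longleftrightarrow> i < length P \<and>
     (\<forall>x\<in>D. runs P (ea x) (P ! i) (eb (f x)) (poly q (cells (ea x))))"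

text \<open>
  The size of the output has to be bounded separately, since values are trees with sharing,
  which may be exponentially larger than the running time.
\<close>

definition ptime :: "('a \<Rightarrow> tree) \<Rightarrow> ('b \<Rightarrow> tree) \<Rightarrow> 'a set \<Rightarrow> ('a \<Rightarrow> 'b) \<Rightarrow> bool" where
  "ptime ea eb D f \<longleftrightarrow> (\<exists>P i q. implements P i q ea eb D f)"

lemma implementsD:
  assumes "implements P i q ea eb D f" "x \<in> D"
  obtains t where "i < length P" "eval P [ea x] (P ! i) (eb (f x)) t" "t \<le> poly q (cells (ea x))"
    "cells (eb (f x)) \<le> poly q (cells (ea x))"
  using assms unfolding implements_def by blast

lemma implements_append: "implements P i q ea eb D f \<Longrightarrow> implements (P @ B) i q ea eb D f"
  unfolding implements_def by (auto simp: nth_append intro!: eval_append(1))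

text \<open>The linking step: an implementation can be placed behind any given program
  \<open>A\<close>, in which all indices stay valid.\<close>

lemma ptime_extend:
  assumes "ptime ea eb D f"
  obtains B i q where "implements (A @ B) i q ea eb D f"
proof -
  obtain P i q where "implements P i q ea eb D f" using assms by (auto simp: ptime_def)
  then have "implements (A @ map (shift (length A)) P) (length A + i) q ea eb D f"
    unfolding implements_def by (auto simp: nth_append) (meson eval_shift(1))
  then show ?thesis by (rule that)
qed

lemma poly_nat_mono: "(m :: nat) \<le> n \<Longrightarrow> poly q m \<le> poly q n"
  by (induction q) (auto intro!: add_mono mult_le_mono)

lemma ptimeI:
  assumes "\<And>x. x \<in> D \<Longrightarrow> runs P (ea x) e (eb (f x)) (poly q (cells (ea x)))"
  shows "ptime ea eb D f"
proof -
  have "implements (P @ [e]) (length P) q ea eb D f"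
    unfolding implements_def using assms by (fastforce intro: eval_append)
  then show ?thesis by (auto simp: ptime_def)
qed

text \<open>Programs only see trees, so one program serves several types. A nonempty list is the
  pair of its head and its tail, and a number is the list of its bits.\<close>

lemma ptime_cong:
  assumes f: "ptime ea eb D f"
    and cong: "\<And>x. x \<in> D' \<Longrightarrow> \<exists>z\<in>D. ea z = ea' x \<and> eb (f z) = eb' (f' x)"
  shows "ptime ea' eb' D' f'"
proof -
  obtain P i q where P: "implements P i q ea eb D f" using f by (auto simp: ptime_def)
  have "runs P (ea' x) (P ! i) (eb' (f' x)) (poly q (cells (ea' x)))" if "x \<in> D'" for x
    using cong[OF that] P unfolding implements_def by metis
  then show ?thesis using P unfolding ptime_def implements_def by blast
qed

lemma ptime_subset: "ptime ea eb D f \<Longrightarrow> D' \<subseteq> D \<Longrightarrow> ptime ea eb D' f"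
  by (rule ptime_cong) auto

lemma ptime_UNIV: "ptime ea eb UNIV f \<Longrightarrow> ptime ea eb D f"
  by (erule ptime_subset) simp

lemma ptime_fun_cong: "ptime ea eb D f \<Longrightarrow> (\<And>x. x \<in> D \<Longrightarrow> f x = g x) \<Longrightarrow> ptime ea eb D g"
  by (rule ptime_cong) auto

lemma ptime_comp:
  assumes g: "ptime ea eb D g" and f: "ptime eb ec D' f" and sub: "g ` D \<subseteq> D'"
  shows "ptime ea ec D (\<lambda>x. f (g x))"
proof -
  obtain P i q where P: "implements P i q ea eb D g" using g by (auto simp: ptime_def)
  obtain B j r where Q: "implements (P @ B) j r eb ec D' f" using f by (rule ptime_extend)
  show ?thesis
  \<comment> \<open>The two calls cost \<open>4 + 3\<close> additional steps. \<open>r\<close> is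
    composed with \<open>q\<close> because the second function runs on the output of the
    first.\<close>
  proof (rule ptimeI[where e = "ECall j [ECall i [EVar 0]]" and q = "q + pcompose r q + [:7:]"])
    fix x assume x: "x \<in> D"
    let ?n = "cells (ea x)"
    obtain t where t: "i < length (P @ B)" "eval (P @ B) [ea x] ((P @ B) ! i) (eb (g x)) t"
        "t \<le> poly q ?n" "cells (eb (g x)) \<le> poly q ?n"
      using implementsD[OF implements_append[OF P] x] .
    obtain t' where t': "j < length (P @ B)" "eval (P @ B) [eb (g x)] ((P @ B) ! j) (ec (f (g x))) t'"
        "t' \<le> poly r (cells (eb (g x)))" "cells (ec (f (g x))) \<le> poly r (cells (eb (g x)))"
      using implementsD[OF Q] x sub by blast
    have le: "poly r (cells (eb (g x))) \<le> poly (pcompose r q) ?n"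
      using poly_nat_mono[OF t(4)] by (simp add: poly_pcompose)
    show "runs (P @ B) (ea x) (ECall j [ECall i [EVar 0]]) (ec (f (g x))) (poly (q + pcompose r q + [:7:]) ?n)"
      using eval_call[OF eval_call_arg[OF t(1,2)] t'(1,2)] t(3) t'(3,4) le
      by (intro exI[of _ "t + 4 + t' + 3"]) auto
  qed
qed

lemma ptime_Pair:
  assumes f: "ptime ea eb D f" and g: "ptime ea ec D g"
  shows "ptime ea (enc_pair eb ec) D (\<lambda>x. (f x, g x))"
proof -
  obtain P i q where P: "implements P i q ea eb D f" using f by (auto simp: ptime_def)
  obtain B j r where Q: "implements (P @ B) j r ea ec D g" using g by (rule ptime_extend)
  show ?thesis
  proof (rule ptimeI[where e = "ECons (ECall i [EVar 0]) (ECall j [EVar 0])" and q = "q + r + [:9:]"])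
    fix x assume x: "x \<in> D"
    let ?n = "cells (ea x)"
    obtain t where t: "i < length (P @ B)" "eval (P @ B) [ea x] ((P @ B) ! i) (eb (f x)) t"
        "t \<le> poly q ?n" "cells (eb (f x)) \<le> poly q ?n"
      using implementsD[OF implements_append[OF P] x] .
    obtain t' where t': "j < length (P @ B)" "eval (P @ B) [ea x] ((P @ B) ! j) (ec (g x)) t'"
        "t' \<le> poly r ?n" "cells (ec (g x)) \<le> poly r ?n"
      using implementsD[OF Q x] .
    show "runs (P @ B) (ea x) (ECons (ECall i [EVar 0]) (ECall j [EVar 0]))
        (enc_pair eb ec (f x, g x)) (poly (q + r + [:9:]) ?n)"
      using Cons[OF eval_call_arg[OF t(1,2)] eval_call_arg[OF t'(1,2)]] t(3,4) t'(3,4)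
      by (intro exI[of _ "Suc (t + 4 + (t' + 4))"]) (auto simp: enc_pair_def)
  qed
qed

text \<open>Each branch has to work only where it is taken, which admits branches that presuppose
  the outcome of the test, such as a head of a nonempty list.\<close>

lemma ptime_If:
  assumes b: "ptime ea enc_bool D b" and f: "ptime ea eb {x \<in> D. b x} f"
    and g: "ptime ea eb {x \<in> D. \<not> b x} g"
  shows "ptime ea eb D (\<lambda>x. if b x then f x else g x)"
proof -
  obtain P i q where P: "implements P i q ea enc_bool D b" using b by (auto simp: ptime_def)
  obtain A j r where Q: "implements (P @ A) j r ea eb {x \<in> D. b x} f" using f by (rule ptime_extend)
  obtain B k s where R: "implements ((P @ A) @ B) k s ea eb {x \<in> D. \<not> b x} g"
    using g by (rule ptime_extend)
  let ?P = "(P @ A) @ B"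
  show ?thesis
  proof (rule ptimeI[where e = "EIf (ECall i [EVar 0]) (ECall j [EVar 0]) (ECall k [EVar 0])"
        and q = "q + r + s + [:9:]"])
    fix x assume x: "x \<in> D"
    let ?n = "cells (ea x)"
    obtain t where t: "i < length ?P" "eval ?P [ea x] (?P ! i) (enc_bool (b x)) t" "t \<le> poly q ?n"
      using implementsD[OF implements_append[OF implements_append[OF P]] x] .
    show "runs ?P (ea x) (EIf (ECall i [EVar 0]) (ECall j [EVar 0]) (ECall k [EVar 0]))
        (eb (if b x then f x else g x)) (poly (q + r + s + [:9:]) ?n)"
    proof (cases "b x")
      case True
      then obtain t' where t': "j < length ?P" "eval ?P [ea x] (?P ! j) (eb (f x)) t'"
          "t' \<le> poly r ?n" "cells (eb (f x)) \<le> poly r ?n"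
        using implementsD[OF implements_append[OF Q], of x] x by blast
      from t(2) True have "eval ?P [ea x] (?P ! i) (Cell Leaf Leaf) t" by (simp add: enc_bool_def)
      from If_Cell[OF eval_call_arg[OF t(1) this] eval_call_arg[OF t'(1,2)]]
      show ?thesis using t(3) t'(3,4) True by (intro exI[of _ "Suc (t + 4 + (t' + 4))"]) auto
    next
      case False
      then obtain t' where t': "k < length ?P" "eval ?P [ea x] (?P ! k) (eb (g x)) t'"
          "t' \<le> poly s ?n" "cells (eb (g x)) \<le> poly s ?n"
        using implementsD[OF R, of x] x by blast
      from t(2) False have "eval ?P [ea x] (?P ! i) Leaf t" by (simp add: enc_bool_def)
      from If_Leaf[OF eval_call_arg[OF t(1) this] eval_call_arg[OF t'(1,2)]]
      show ?thesis using t(3) t'(3,4) False by (intro exI[of _ "Suc (t + 4 + (t' + 4))"]) auto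
    qed
  qed
qed

section \<open>Basic functions on pairs, lists and truth values\<close>

lemma ptime_id: "ptime ea ea D (\<lambda>x. x)"
  by (rule ptimeI[where e = "EVar 0" and P = "[]" and q = "[:1, 1:]"])
    (auto intro!: exI[of _ 1] eval_evals.Var[of 0 "[_]" "[]", simplified])

lemma eval_const: "\<exists>e n. \<forall>env. eval P env e x n"
proof (induction x)
  case Leaf
  then show ?case by (meson eval_evals.Nil)
next
  case (Cell x y)
  then show ?case by (meson eval_evals.Cons)
qed

lemma ptime_const: "ptime ea eb D (\<lambda>x. c)"
proof -
  obtain e n where "\<forall>env. eval [] env e (eb c) n" using eval_const by blast
  then show ?thesis
    by (intro ptimeI[where e = e and P = "[]" and q = "[:n + cells (eb c):]"]) auto
qed

lemma ptime_prim:
  assumes "\<And>x. x \<in> D \<Longrightarrow> \<exists>t\<le>k. eval [] [ea x] e (eb (f x)) t"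
    and "\<And>x. x \<in> D \<Longrightarrow> cells (eb (f x)) \<le> cells (ea x) + k"
  shows "ptime ea eb D f"
proof (rule ptimeI[where e = e and P = "[]" and q = "[:k, 1:]"])
  fix x assume x: "x \<in> D"
  obtain t where "t \<le> k" "eval [] [ea x] e (eb (f x)) t" using assms(1)[OF x] by blast
  then show "runs [] (ea x) e (eb (f x)) (poly [:k, 1:] (cells (ea x)))"
    using assms(2)[OF x] by (intro exI[of _ t]) (simp add: add.commute)
qed

lemma ptime_fst:
  assumes "ptime ea (enc_pair eb ec) D p"
  shows "ptime ea eb D (\<lambda>x. fst (p x))"
proof (rule ptime_comp[where D' = UNIV, OF assms])
  show "ptime (enc_pair eb ec) eb UNIV fst"
  proof (rule ptime_prim[where e = "EHd (EVar 0)" and k = 2])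
    fix p :: "'b \<times> 'c"
    have "eval [] [enc_pair eb ec p] (EHd (EVar 0)) (eb (fst p)) (Suc 1)"
      unfolding enc_pair_def by (rule Hd_Cell[OF eval_arg])
    then show "\<exists>t\<le>2. eval [] [enc_pair eb ec p] (EHd (EVar 0)) (eb (fst p)) t"
      by (intro exI[of _ "Suc 1"]) simp
  qed (simp add: enc_pair_def)
qed simp

lemma ptime_snd:
  assumes "ptime ea (enc_pair eb ec) D p"
  shows "ptime ea ec D (\<lambda>x. snd (p x))"
proof (rule ptime_comp[where D' = UNIV, OF assms])
  show "ptime (enc_pair eb ec) ec UNIV snd"
  proof (rule ptime_prim[where e = "ETl (EVar 0)" and k = 2])
    fix p :: "'b \<times> 'c"
    have "eval [] [enc_pair eb ec p] (ETl (EVar 0)) (ec (snd p)) (Suc 1)"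
      unfolding enc_pair_def by (rule Tl_Cell[OF eval_arg])
    then show "\<exists>t\<le>2. eval [] [enc_pair eb ec p] (ETl (EVar 0)) (ec (snd p)) t"
      by (intro exI[of _ "Suc 1"]) simp
  qed (simp add: enc_pair_def)
qed simp

lemma ptime_hd:
  assumes "ptime ea (enc_list eb) D l" "\<And>x. x \<in> D \<Longrightarrow> l x \<noteq> []"
  shows "ptime ea eb D (\<lambda>x. hd (l x))"
proof (rule ptime_comp[where D' = "{xs. xs \<noteq> []}", OF assms(1)])
  show "ptime (enc_list eb) eb {xs. xs \<noteq> []} hd"
  proof (rule ptime_cong)
    show "ptime (enc_pair eb (enc_list eb)) eb UNIV (\<lambda>p. fst p)" by (rule ptime_fst ptime_id)+
    show "\<exists>z\<in>UNIV. enc_pair eb (enc_list eb) z = enc_list eb xs \<and> eb (fst z) = eb (hd xs)"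
      if "xs \<in> {xs. xs \<noteq> []}" for xs
      using that by (intro bexI[of _ "(hd xs, tl xs)"]) (auto simp: enc_pair_def neq_Nil_conv)
  qed
qed (use assms in auto)

lemma ptime_tl:
  assumes "ptime ea (enc_list eb) D l"
  shows "ptime ea (enc_list eb) D (\<lambda>x. tl (l x))"
proof (rule ptime_comp[where D' = UNIV, OF assms])
  show "ptime (enc_list eb) (enc_list eb) UNIV tl"
  proof (rule ptime_prim[where e = "ETl (EVar 0)" and k = 2])
    fix xs :: "'b list"
    have "eval [] [enc_list eb xs] (ETl (EVar 0)) (enc_list eb (tl xs)) (Suc 1)"
      by (cases xs; simp only: enc_list.simps list.sel)
        (rule Tl_Leaf[OF eval_arg] Tl_Cell[OF eval_arg])+
    then show "\<exists>t\<le>2. eval [] [enc_list eb xs] (ETl (EVar 0)) (enc_list eb (tl xs)) t"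
      by (intro exI[of _ "Suc 1"]) simp
    show "cells (enc_list eb (tl xs)) \<le> cells (enc_list eb xs) + 2" by (cases xs) auto
  qed
qed simp

lemma ptime_null:
  assumes "ptime ea (enc_list eb) D l"
  shows "ptime ea enc_bool D (\<lambda>x. l x = [])"
proof (rule ptime_comp[where D' = UNIV, OF assms])
  show "ptime (enc_list eb) enc_bool UNIV (\<lambda>xs. xs = [])"
  proof (rule ptime_prim[where e = "EIf (EVar 0) ENil (ECons ENil ENil)" and k = 5])
    fix xs :: "'b list"
    show "\<exists>t\<le>5. eval [] [enc_list eb xs] (EIf (EVar 0) ENil (ECons ENil ENil)) (enc_bool (xs = [])) t"
    proof (cases xs)
      case Nil
      have "eval [] [Leaf] (EIf (EVar 0) ENil (ECons ENil ENil)) (Cell Leaf Leaf) (Suc (1 + Suc (1 + 1)))"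
        by (intro eval_evals.intros eval_arg)
      then show ?thesis using Nil by (intro exI[of _ 5]) (simp add: enc_bool_def eval_nat_numeral)
    next
      case (Cons x ys)
      have "eval [] [enc_list eb xs] (EIf (EVar 0) ENil (ECons ENil ENil)) Leaf (Suc (1 + 1))"
        unfolding Cons enc_list.simps by (rule If_Cell[OF eval_arg eval_evals.Nil])
      then show ?thesis using Cons by (intro exI[of _ 3]) (simp add: enc_bool_def eval_nat_numeral)
    qed
    show "cells (enc_bool (xs = [])) \<le> cells (enc_list eb xs) + 5" by (simp add: enc_bool_def)
  qed
qed simp

lemma ptime_Cons:
  assumes "ptime ea eb D h" "ptime ea (enc_list eb) D t"
  shows "ptime ea (enc_list eb) D (\<lambda>x. h x # t x)"
  by (rule ptime_cong[OF ptime_Pair[OF assms]]) (auto simp: enc_pair_def)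

lemma ptime_not:
  assumes "ptime ea enc_bool D b"
  shows "ptime ea enc_bool D (\<lambda>x. \<not> b x)"
  using ptime_If[OF assms ptime_const[of _ _ _ False] ptime_const[of _ _ _ True]]
  by (rule ptime_fun_cong) simp

lemma ptime_conj:
  assumes "ptime ea enc_bool D b" "ptime ea enc_bool D c"
  shows "ptime ea enc_bool D (\<lambda>x. b x \<and> c x)"
proof -
  have "ptime ea enc_bool {x \<in> D. b x} c" using assms(2) by (rule ptime_subset) auto
  from ptime_If[OF assms(1) this ptime_const[of _ _ _ False]] show ?thesis
    by (rule ptime_fun_cong) simp
qed

lemma ptime_disj:
  assumes "ptime ea enc_bool D b" "ptime ea enc_bool D c"
  shows "ptime ea enc_bool D (\<lambda>x. b x \<or> c x)"
proof -
  have "ptime ea enc_bool {x \<in> D. \<not> b x} c" using assms(2) by (rule ptime_subset) auto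
  from ptime_If[OF assms(1) ptime_const[of _ _ _ True] this] show ?thesis
    by (rule ptime_fun_cong) simp
qed

lemma ptime_if:
  assumes "ptime ea enc_bool D b" "ptime ea eb D f" "ptime ea eb D g"
  shows "ptime ea eb D (\<lambda>x. if b x then f x else g x)"
  by (rule ptime_If[OF assms(1)]) (rule ptime_subset[OF assms(2)] ptime_subset[OF assms(3)]; auto)+

lemma ptime_apply2:
  assumes f: "ptime (enc_pair eb ec) ed UNIV (\<lambda>z. f (fst z) (snd z))"
    and a: "ptime ea eb D a" and b: "ptime ea ec D b"
  shows "ptime ea ed D (\<lambda>x. f (a x) (b x))"
  using ptime_comp[OF ptime_Pair[OF a b] f] by simp

lemma ptime_apply3:
  assumes f: "ptime (enc_pair eb (enc_pair ec ed)) ee UNIV (\<lambda>z. f (fst z) (fst (snd z)) (snd (snd z)))"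
    and a: "ptime ea eb D a" and b: "ptime ea ec D b" and c: "ptime ea ed D c"
  shows "ptime ea ee D (\<lambda>x. f (a x) (b x) (c x))"
  using ptime_comp[OF ptime_Pair[OF a ptime_Pair[OF b c]] f] by simp

text \<open>Polynomial bounds for quantities that are not computed, such as recursion depths and
  sizes of intermediate values.\<close>

definition psize :: "('a \<Rightarrow> tree) \<Rightarrow> 'a set \<Rightarrow> ('a \<Rightarrow> nat) \<Rightarrow> bool" where
  "psize ea D k \<longleftrightarrow> (\<exists>q :: nat poly. \<forall>x\<in>D. k x \<le> poly q (cells (ea x)))"

lemma psize_const: "psize ea D (\<lambda>x. n)"
  unfolding psize_def by (intro exI[of _ "[:n:]"]) simp

lemma psize_cells: "psize ea D (\<lambda>x. cells (ea x))"
  unfolding psize_def by (intro exI[of _ "[:0, 1:]"]) simp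

lemma psize_add: "psize ea D k \<Longrightarrow> psize ea D l \<Longrightarrow> psize ea D (\<lambda>x. k x + l x)"
  unfolding psize_def
proof (elim exE)
  fix q r :: "nat poly"
  assume "\<forall>x\<in>D. k x \<le> poly q (cells (ea x))" "\<forall>x\<in>D. l x \<le> poly r (cells (ea x))"
  then show "\<exists>q. \<forall>x\<in>D. k x + l x \<le> poly q (cells (ea x))"
    by (intro exI[of _ "q + r"]) (auto intro: add_mono)
qed

lemma psize_mult: "psize ea D k \<Longrightarrow> psize ea D l \<Longrightarrow> psize ea D (\<lambda>x. k x * l x)"
  unfolding psize_def
proof (elim exE)
  fix q r :: "nat poly"
  assume "\<forall>x\<in>D. k x \<le> poly q (cells (ea x))" "\<forall>x\<in>D. l x \<le> poly r (cells (ea x))"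
  then show "\<exists>q. \<forall>x\<in>D. k x * l x \<le> poly q (cells (ea x))"
    by (intro exI[of _ "q * r"]) (auto intro: mult_le_mono)
qed

lemma psize_poly: "psize ea D k \<Longrightarrow> psize ea D (\<lambda>x. poly r (k x))"
  unfolding psize_def
proof (elim exE)
  fix q :: "nat poly"
  assume "\<forall>x\<in>D. k x \<le> poly q (cells (ea x))"
  then show "\<exists>q. \<forall>x\<in>D. poly r (k x) \<le> poly q (cells (ea x))"
    by (intro exI[of _ "pcompose r q"]) (auto simp: poly_pcompose intro: poly_nat_mono)
qed

lemma psize_Suc: "psize ea D k \<Longrightarrow> psize ea D (\<lambda>x. Suc (k x))"
  using psize_add[OF psize_const[of _ _ 1]] by simp

lemma psize_mono: "psize ea D l \<Longrightarrow> (\<And>x. x \<in> D \<Longrightarrow> k x \<le> l x) \<Longrightarrow> psize ea D k"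
  unfolding psize_def by (meson order.trans)

lemma psize_out: "ptime ea eb D f \<Longrightarrow> psize ea D (\<lambda>x. cells (eb (f x)))"
  unfolding ptime_def psize_def implements_def by blast

lemma psize_subset: "psize ea D k \<Longrightarrow> D' \<subseteq> D \<Longrightarrow> psize ea D' k"
  unfolding psize_def by blast

lemma psize_fst:
  assumes "psize ea (fst ` D) k"
  shows "psize (enc_pair ea eb) D (\<lambda>z. k (fst z))"
proof -
  obtain q where q: "\<forall>x\<in>fst ` D. k x \<le> poly q (cells (ea x))" using assms by (auto simp: psize_def)
  have "k (fst z) \<le> poly q (cells (enc_pair ea eb z))" if "z \<in> D" for z
  proof -
    have "k (fst z) \<le> poly q (cells (ea (fst z)))" using q that by blast
    also have "\<dots> \<le> poly q (cells (enc_pair ea eb z))"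
      by (rule poly_nat_mono) (simp add: enc_pair_def)
    finally show ?thesis .
  qed
  then show ?thesis unfolding psize_def by blast
qed

text \<open>Linear recursion. \<open>m\<close> bounds the depth. \<open>s\<close> bounds the sizes
  of arguments and results and does not grow along \<open>d\<close>, so that all levels share one
  cost bound; without it, sizes could multiply from level to level.\<close>

lemma ptime_rec:
  assumes b: "ptime ea enc_bool D b" and g: "ptime ea eb {x \<in> D. b x} g"
    and d: "ptime ea ea {x \<in> D. \<not> b x} d"
    and h: "ptime (enc_pair ea eb) eb H h" "\<And>x. x \<in> D \<Longrightarrow> \<not> b x \<Longrightarrow> (x, f (d x)) \<in> H"
    and f: "\<And>x. x \<in> D \<Longrightarrow> f x = (if b x then g x else h (x, f (d x)))"
    and dD: "\<And>x. x \<in> D \<Longrightarrow> \<not> b x \<Longrightarrow> d x \<in> D"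
    and m: "\<And>x. x \<in> D \<Longrightarrow> \<not> b x \<Longrightarrow> m (d x) < m x" "psize ea D m"
    and s: "\<And>x. x \<in> D \<Longrightarrow> \<not> b x \<Longrightarrow> s (d x) \<le> s x" "psize ea D s"
      "\<And>x. x \<in> D \<Longrightarrow> cells (ea x) \<le> s x" "\<And>x. x \<in> D \<Longrightarrow> cells (eb (f x)) \<le> s x"
  shows "ptime ea eb D f"
proof -
  obtain P0 ib qb where P0: "implements P0 ib qb ea enc_bool D b" using b by (auto simp: ptime_def)
  obtain P1 ig qg where P1: "implements (P0 @ P1) ig qg ea eb {x \<in> D. b x} g"
    using g by (rule ptime_extend)
  obtain P2 id qd where P2: "implements ((P0 @ P1) @ P2) id qd ea ea {x \<in> D. \<not> b x} d"
    using d by (rule ptime_extend)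
  obtain P3 ih qh where P3: "implements (((P0 @ P1) @ P2) @ P3) ih qh (enc_pair ea eb) eb H h"
    using h(1) by (rule ptime_extend)
  let ?P = "((P0 @ P1) @ P2) @ P3"
  \<comment> \<open>The recursive function comes last in the program, so its index is known before
    its body is written.\<close>
  define i where "i = length ?P"
  define e where "e = EIf (ECall ib [EVar 0]) (ECall ig [EVar 0])
    (ECall ih [ECons (EVar 0) (ECall i [ECall id [EVar 0]])])"
  define R where "R = ?P @ [e]"
  have R: "R ! i = e" "i < length R" by (simp_all add: R_def i_def)
  have ib: "implements R ib qb ea enc_bool D b"
    unfolding R_def by (intro implements_append P0)
  have ig: "implements R ig qg ea eb {x \<in> D. b x} g"
    unfolding R_def by (intro implements_append P1)
  have id: "implements R id qd ea ea {x \<in> D. \<not> b x} d"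
    unfolding R_def by (intro implements_append P2)
  have ih: "implements R ih qh (enc_pair ea eb) eb H h"
    unfolding R_def by (intro implements_append P3)
  \<comment> \<open>The cost of one level. The input of \<open>h\<close> is a cell with two
    components of size at most \<open>n\<close>, hence \<open>2 * n + 1\<close>; the 20 covers the
    steps spent on calls and on the test.\<close>
  define \<kappa> where "\<kappa> = qb + qg + qd + pcompose qh [:1, 2:] + [:20:]"
  have \<kappa>: "poly \<kappa> n = poly qb n + poly qg n + poly qd n + poly qh (Suc (2 * n)) + 20" for n
    by (simp add: \<kappa>_def poly_pcompose mult.commute mult_2)
  have run: "\<exists>t. eval R [ea x] (R ! i) (eb (f x)) t \<and> t \<le> Suc (m x) * poly \<kappa> (s x)" if "x \<in> D" for x
    using that
  proof (induction "m x" arbitrary: x rule: less_induct)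
    case less
    note x = less.prems
    have up: "poly q (cells (ea x)) \<le> poly q (s x)" for q
      using s(3)[OF x] by (rule poly_nat_mono)
    obtain tb where tb: "ib < length R" "eval R [ea x] (R ! ib) (enc_bool (b x)) tb"
        "tb \<le> poly qb (cells (ea x))" using implementsD[OF ib x] .
    show ?case
    proof (cases "b x")
      case True
      then obtain tg where tg: "ig < length R" "eval R [ea x] (R ! ig) (eb (g x)) tg"
          "tg \<le> poly qg (cells (ea x))" using implementsD[OF ig, of x] x by blast
      from tb(2) True have "eval R [ea x] (R ! ib) (Cell Leaf Leaf) tb" by (simp add: enc_bool_def)
      from If_Cell[OF eval_call_arg[OF tb(1) this] eval_call_arg[OF tg(1,2)]]
      have "eval R [ea x] (R ! i) (eb (f x)) (Suc (tb + 4 + (tg + 4)))"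
        using f[OF x] True by (simp add: R(1) e_def)
      moreover have "Suc (tb + 4 + (tg + 4)) \<le> poly \<kappa> (s x)"
        using tb(3) tg(3) up[of qb] up[of qg] unfolding \<kappa> by linarith
      ultimately show ?thesis by (intro exI conjI) (auto intro: trans_le_add1)
    next
      case False
      obtain td where td: "id < length R" "eval R [ea x] (R ! id) (ea (d x)) td"
          "td \<le> poly qd (cells (ea x))" using implementsD[OF id, of x] x False by blast
      obtain t where t: "eval R [ea (d x)] (R ! i) (eb (f (d x))) t"
          "t \<le> Suc (m (d x)) * poly \<kappa> (s (d x))"
        using less.hyps[OF m(1)[OF x False] dD[OF x False]] by blast
      have th0: "(x, f (d x)) \<in> H" using h(2)[OF x False] .
      obtain th where th: "ih < length R" "eval R [Cell (ea x) (eb (f (d x)))] (R ! ih) (eb (f x)) th"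
          "th \<le> poly qh (Suc (cells (ea x) + cells (eb (f (d x)))))"
        using implementsD[OF ih th0] f[OF x] False by (auto simp: enc_pair_def)
      have "cells (eb (f (d x))) \<le> s x"
        using s(4)[OF dD[OF x False]] s(1)[OF x False] by simp
      then have th': "th \<le> poly qh (Suc (2 * s x))"
        using th(3) s(3)[OF x] by (elim order.trans) (rule poly_nat_mono, simp)
      from tb(2) False have "eval R [ea x] (R ! ib) Leaf tb" by (simp add: enc_bool_def)
      from If_Leaf[OF eval_call_arg[OF tb(1) this] eval_call[OF Cons[OF eval_arg
        eval_call[OF eval_call_arg[OF td(1,2)] R(2) t(1)]] th(1,2)]]
      have ev: "eval R [ea x] (R ! i) (eb (f x)) (Suc (tb + 4 + (Suc (1 + (td + 4 + t + 3)) + th + 3)))"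
        by (simp add: R(1) e_def)
      have "Suc (m (d x)) * poly \<kappa> (s (d x)) \<le> m x * poly \<kappa> (s x)"
        using m(1)[OF x False] s(1)[OF x False] by (intro mult_le_mono poly_nat_mono) auto
      then have "Suc (tb + 4 + (Suc (1 + (td + 4 + t + 3)) + th + 3)) \<le> m x * poly \<kappa> (s x) + poly \<kappa> (s x)"
        using tb(3) td(3) t(2) th' up[of qb] up[of qd] unfolding \<kappa>[of "s x"] by linarith
      then show ?thesis using ev by (intro exI conjI) auto
    qed
  qed
  obtain rm rs where rm: "\<forall>x\<in>D. m x \<le> poly rm (cells (ea x))" and rs: "\<forall>x\<in>D. s x \<le> poly rs (cells (ea x))"
    using m(2) s(2) unfolding psize_def by blast
  have "implements R i ((rm + [:1:]) * pcompose \<kappa> rs + rs) ea eb D f"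
    unfolding implements_def
  proof (intro conjI ballI R(2))
    fix x assume x: "x \<in> D"
    let ?n = "cells (ea x)"
    obtain t where t: "eval R [ea x] (R ! i) (eb (f x)) t" "t \<le> Suc (m x) * poly \<kappa> (s x)"
      using run[OF x] by blast
    have "Suc (m x) * poly \<kappa> (s x) \<le> (poly rm ?n + 1) * poly \<kappa> (poly rs ?n)"
      using rm rs x by (intro mult_le_mono poly_nat_mono) auto
    then have "t \<le> poly ((rm + [:1:]) * pcompose \<kappa> rs + rs) ?n"
      using t(2) by (simp add: poly_pcompose)
    moreover have "cells (eb (f x)) \<le> poly ((rm + [:1:]) * pcompose \<kappa> rs + rs) ?n"
      using s(4)[OF x] rs x by (simp add: trans_le_add2 order.trans)
    ultimately show "runs R (ea x) (R ! i) (eb (f x)) (poly ((rm + [:1:]) * pcompose \<kappa> rs + rs) ?n)"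
      using t(1) by blast
  qed
  then show ?thesis unfolding ptime_def by blast
qed

section \<open>Folds and other list functions\<close>

lemma cells_enc_list: "cells (enc_list f xs) = length xs + (\<Sum>x\<leftarrow>xs. cells (f x))"
  by (induction xs) auto

lemma cells_enc_list_append: "cells (enc_list f (xs @ ys)) = cells (enc_list f xs) + cells (enc_list f ys)"
  by (induction xs) auto

lemma cells_enc_list_elem: "x \<in> set xs \<Longrightarrow> cells (f x) < cells (enc_list f xs)"
  by (induction xs) auto

lemma length_le_cells: "length xs \<le> cells (enc_list f xs)"
  by (simp add: cells_enc_list)

text \<open>A right fold is a linear recursion on the remaining list. The intermediate results are
  the folds over the suffixes of \<open>l x\<close>, and \<open>k\<close> has to bound each of
  them.\<close>

lemma ptime_foldr:
  assumes l: "ptime ea (enc_list eb) D l" and i: "ptime ea ec D i"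
    and s: "ptime (enc_pair ea (enc_pair eb ec)) ec UNIV (\<lambda>z. s (fst z) (fst (snd z)) (snd (snd z)))"
    and k: "psize ea D k" "\<And>x p t. x \<in> D \<Longrightarrow> l x = p @ t \<Longrightarrow> cells (ec (foldr (s x) t (i x))) \<le> k x"
  shows "ptime ea ec D (\<lambda>x. foldr (s x) (l x) (i x))"
proof -
  let ?e = "enc_pair ea (enc_list eb)"
  \<comment> \<open>Only suffixes of \<open>l x\<close> occur in the recursion, and only for them is
    a size bound available.\<close>
  define D' where "D' = {(x, t). x \<in> D \<and> (\<exists>p. l x = p @ t)}"
  define f where "f = (\<lambda>z. foldr (s (fst z)) (snd z) (i (fst z)))"
  define S where "S = (\<lambda>x. k x + Suc (cells (ea x) + cells (enc_list eb (l x))))"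
  have fstD: "fst ` D' \<subseteq> D" by (auto simp: D'_def)
  have rec: "ptime ?e ec D' f"
  proof (rule ptime_rec[where b = "\<lambda>z. snd z = []" and g = "\<lambda>z. i (fst z)" and d = "\<lambda>z. (fst z, tl (snd z))"
      and h = "\<lambda>y. s (fst (fst y)) (hd (snd (fst y))) (snd y)" and m = "\<lambda>z. length (snd z)"
      and s = "\<lambda>z. S (fst z)"
      and H = "{y. snd (fst y) \<noteq> []}"])
    show "ptime ?e enc_bool D' (\<lambda>z. snd z = [])" by (rule ptime_null ptime_snd ptime_id)+
    show "ptime ?e ec {z \<in> D'. snd z = []} (\<lambda>z. i (fst z))"
      by (rule ptime_comp[OF _ i], (rule ptime_fst ptime_id)+) (auto simp: D'_def)
    show "ptime ?e ?e {z \<in> D'. snd z \<noteq> []} (\<lambda>z. (fst z, tl (snd z)))"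
      by (rule ptime_Pair ptime_tl ptime_fst ptime_snd ptime_id)+
    let ?H = "{y. snd (fst y) \<noteq> []}"
    have "ptime (enc_pair ?e ec) (enc_pair ea (enc_pair eb ec)) ?H
        (\<lambda>y. (fst (fst y), hd (snd (fst y)), snd y))"
      by (rule ptime_Pair ptime_hd ptime_fst ptime_snd ptime_id | simp)+
    from ptime_comp[OF this s]
    show "ptime (enc_pair ?e ec) ec ?H (\<lambda>y. s (fst (fst y)) (hd (snd (fst y))) (snd y))" by simp
    show "psize ?e D' (\<lambda>z. length (snd z))"
      by (rule psize_mono[OF psize_cells])
        (use length_le_cells[of _ eb] in \<open>auto simp: enc_pair_def intro: le_SucI trans_le_add2\<close>)
    show "psize ?e D' (\<lambda>z. S (fst z))"
      unfolding S_def
      by (rule psize_fst[of _ _ "\<lambda>x. k x + Suc (cells (ea x) + cells (enc_list eb (l x)))"])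
        (rule psize_subset[OF _ fstD], intro psize_add psize_Suc psize_cells k psize_out l)
  next
    fix z assume z: "z \<in> D'"
    then show "f z = (if snd z = [] then i (fst z) else
        s (fst (fst (z, f (fst z, tl (snd z))))) (hd (snd (fst (z, f (fst z, tl (snd z))))))
          (snd (z, f (fst z, tl (snd z)))))"
      by (cases "snd z") (auto simp: f_def)
    show "cells (?e z) \<le> S (fst z)"
      using z by (auto simp: D'_def S_def enc_pair_def cells_enc_list_append)
    show "cells (ec (f z)) \<le> S (fst z)"
    proof -
      obtain p where "fst z \<in> D" "l (fst z) = p @ snd z" using z by (auto simp: D'_def)
      then show ?thesis using k(2)[of "fst z" p "snd z"] by (simp add: S_def f_def)
    qed
    assume ne: "snd z \<noteq> []"
    obtain p where "fst z \<in> D" "l (fst z) = p @ snd z" using z by (auto simp: D'_def)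
    then show "(fst z, tl (snd z)) \<in> D'"
      using ne by (auto simp: D'_def intro!: exI[of _ "p @ [hd (snd z)]"])
    show "(z, f (fst z, tl (snd z))) \<in> {y. snd (fst y) \<noteq> []}" using ne by simp
    show "length (snd (fst z, tl (snd z))) < length (snd z)" using ne by simp
    show "S (fst (fst z, tl (snd z))) \<le> S (fst z)" by simp
  qed
  have "ptime ea ?e D (\<lambda>x. (x, l x))" by (rule ptime_Pair ptime_id l)+
  from ptime_comp[OF this rec] have "ptime ea ec D (\<lambda>x. f (x, l x))" by (simp add: D'_def image_subset_iff)
  then show ?thesis by (simp add: f_def)
qed

lemma cells_enc_list_le:
  "(\<And>x. x \<in> set xs \<Longrightarrow> cells (f x) \<le> b) \<Longrightarrow> length xs \<le> n \<Longrightarrow> cells (enc_list f xs) \<le> n * Suc b"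
proof -
  assume b: "\<And>x. x \<in> set xs \<Longrightarrow> cells (f x) \<le> b" and n: "length xs \<le> n"
  have "cells (enc_list f xs) \<le> length xs * Suc b"
    using b
  proof (induction xs)
    case (Cons x xs)
    then have "cells (f x) \<le> b" "cells (enc_list f xs) \<le> length xs * Suc b" by auto
    then show ?case by simp
  qed simp
  also have "\<dots> \<le> n * Suc b" using n by (rule mult_le_mono1)
  finally show ?thesis .
qed

lemma cells_enc_list_filter_le: "cells (enc_list f (filter P xs)) \<le> cells (enc_list f xs)"
  by (induction xs) auto

lemma cells_enc_list_concat_le: "cells (enc_list f (concat xss)) \<le> cells (enc_list (enc_list f) xss)"
  by (induction xss) (auto simp: cells_enc_list_append)

lemma ptime_map:
  assumes l: "ptime ea (enc_list eb) D l"
    and g: "ptime (enc_pair ea eb) ec UNIV (\<lambda>z. g (fst z) (snd z))"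
  shows "ptime ea (enc_list ec) D (\<lambda>x. map (g x) (l x))"
proof -
  obtain q where q: "cells (ec (g (fst z) (snd z))) \<le> poly q (cells (enc_pair ea eb z))" for z
    using psize_out[OF g] unfolding psize_def by blast
  let ?b = "\<lambda>x. poly q (Suc (cells (ea x) + cells (enc_list eb (l x))))"
  have "ptime ea (enc_list ec) D (\<lambda>x. foldr (\<lambda>h acc. g x h # acc) (l x) [])"
  proof (rule ptime_foldr[where k = "\<lambda>x. length (l x) * Suc (?b x)", OF l ptime_const])
    show "ptime (enc_pair ea (enc_pair eb (enc_list ec))) (enc_list ec) UNIV
        (\<lambda>z. g (fst z) (fst (snd z)) # snd (snd z))"
      by (rule ptime_Cons ptime_apply2[OF g] ptime_fst ptime_snd ptime_id)+
    show "psize ea D (\<lambda>x. length (l x) * Suc (?b x))"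
      by (intro psize_mult psize_Suc psize_poly psize_add psize_cells psize_out[OF l]
          psize_mono[OF psize_out[OF l] length_le_cells])
    fix x p t assume x: "x \<in> D" "l x = p @ t"
    have "foldr (\<lambda>h acc. g x h # acc) t [] = map (g x) t" by (induction t) auto
    moreover have "cells (enc_list ec (map (g x) t)) \<le> length (l x) * Suc (?b x)"
    proof (rule cells_enc_list_le)
      fix y assume "y \<in> set (map (g x) t)"
      then obtain h where h: "h \<in> set (l x)" "y = g x h" using x by auto
      have "cells (ec y) \<le> poly q (cells (enc_pair ea eb (x, h)))" using q[of "(x, h)"] h by simp
      also have "\<dots> \<le> ?b x"
        using cells_enc_list_elem[OF h(1), of eb] by (intro poly_nat_mono) (simp add: enc_pair_def)
      finally show "cells (ec y) \<le> ?b x" .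
    qed (use x in simp)
    ultimately show "cells (enc_list ec (foldr (\<lambda>h acc. g x h # acc) t [])) \<le> length (l x) * Suc (?b x)"
      by simp
  qed
  moreover have "foldr (\<lambda>h acc. g x h # acc) xs [] = map (g x) xs" for x xs by (induction xs) auto
  ultimately show ?thesis by simp
qed

lemma ptime_filter:
  assumes l: "ptime ea (enc_list eb) D l"
    and P: "ptime (enc_pair ea eb) enc_bool UNIV (\<lambda>z. P (fst z) (snd z))"
  shows "ptime ea (enc_list eb) D (\<lambda>x. filter (P x) (l x))"
proof -
  have eq: "foldr (\<lambda>h acc. if P x h then h # acc else acc) xs [] = filter (P x) xs" for x xs
    by (induction xs) auto
  have "ptime ea (enc_list eb) D (\<lambda>x. foldr (\<lambda>h acc. if P x h then h # acc else acc) (l x) [])"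
  proof (rule ptime_foldr[where k = "\<lambda>x. cells (enc_list eb (l x))", OF l ptime_const])
    show "ptime (enc_pair ea (enc_pair eb (enc_list eb))) (enc_list eb) UNIV
        (\<lambda>z. if P (fst z) (fst (snd z)) then fst (snd z) # snd (snd z) else snd (snd z))"
      by (rule ptime_if ptime_Cons ptime_apply2[OF P] ptime_fst ptime_snd ptime_id)+
    show "psize ea D (\<lambda>x. cells (enc_list eb (l x)))" by (rule psize_out[OF l])
    show "cells (enc_list eb (foldr (\<lambda>h acc. if P x h then h # acc else acc) t [])) \<le> cells (enc_list eb (l x))"
      if "l x = p @ t" for x p t
      using cells_enc_list_filter_le[of eb "P x" t] that by (simp add: eq cells_enc_list_append)
  qed
  then show ?thesis by (simp add: eq)
qed

lemma ptime_list_ex: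
  assumes l: "ptime ea (enc_list eb) D l"
    and P: "ptime (enc_pair ea eb) enc_bool UNIV (\<lambda>z. P (fst z) (snd z))"
  shows "ptime ea enc_bool D (\<lambda>x. list_ex (P x) (l x))"
proof -
  have eq: "foldr (\<lambda>h acc. P x h \<or> acc) xs False = list_ex (P x) xs" for x xs
    by (induction xs) auto
  have "ptime ea enc_bool D (\<lambda>x. foldr (\<lambda>h acc. P x h \<or> acc) (l x) False)"
  proof (rule ptime_foldr[where k = "\<lambda>x. 1", OF l ptime_const])
    show "ptime (enc_pair ea (enc_pair eb enc_bool)) enc_bool UNIV
        (\<lambda>z. P (fst z) (fst (snd z)) \<or> snd (snd z))"
      by (rule ptime_disj ptime_apply2[OF P] ptime_fst ptime_snd ptime_id)+
  qed (auto intro: psize_const simp: enc_bool_def)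
  then show ?thesis by (simp add: eq)
qed

lemma ptime_append:
  assumes l: "ptime ea (enc_list eb) D l" and m: "ptime ea (enc_list eb) D m"
  shows "ptime ea (enc_list eb) D (\<lambda>x. l x @ m x)"
proof -
  have eq: "foldr (\<lambda>h acc. h # acc) xs ys = xs @ ys" for xs ys :: "'b list"
    by (induction xs) auto
  have "ptime ea (enc_list eb) D (\<lambda>x. foldr (\<lambda>h acc. h # acc) (l x) (m x))"
  proof (rule ptime_foldr[where k = "\<lambda>x. cells (enc_list eb (l x)) + cells (enc_list eb (m x))", OF l m])
    show "ptime (enc_pair ea (enc_pair eb (enc_list eb))) (enc_list eb) UNIV
        (\<lambda>z. fst (snd z) # snd (snd z))"
      by (rule ptime_Cons ptime_fst ptime_snd ptime_id)+
    show "psize ea D (\<lambda>x. cells (enc_list eb (l x)) + cells (enc_list eb (m x)))"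
      by (rule psize_add[OF psize_out[OF l] psize_out[OF m]])
  qed (simp_all add: eq cells_enc_list_append)
  then show ?thesis by (simp add: eq)
qed

lemma ptime_concat:
  assumes l: "ptime ea (enc_list (enc_list eb)) D l"
  shows "ptime ea (enc_list eb) D (\<lambda>x. concat (l x))"
proof -
  have eq: "foldr (\<lambda>h acc. h @ acc) xss [] = concat xss" for xss :: "'b list list"
    by (induction xss) auto
  have "ptime ea (enc_list eb) D (\<lambda>x. foldr (\<lambda>h acc. h @ acc) (l x) [])"
  proof (rule ptime_foldr[where k = "\<lambda>x. cells (enc_list (enc_list eb) (l x))", OF l ptime_const])
    show "ptime (enc_pair ea (enc_pair (enc_list eb) (enc_list eb))) (enc_list eb) UNIV
        (\<lambda>z. fst (snd z) @ snd (snd z))"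
      by (rule ptime_append ptime_fst ptime_snd ptime_id)+
    show "cells (enc_list eb (foldr (\<lambda>h acc. h @ acc) t [])) \<le> cells (enc_list (enc_list eb) (l x))"
      if "l x = p @ t" for x p t
      using cells_enc_list_concat_le[of eb t] that by (simp add: eq cells_enc_list_append)
  qed (auto intro: psize_out l)
  then show ?thesis by (simp add: eq)
qed

lemma ptime_rev:
  assumes l: "ptime ea (enc_list eb) D l"
  shows "ptime ea (enc_list eb) D (\<lambda>x. rev (l x))"
proof -
  have eq: "foldr (\<lambda>h acc. acc @ [h]) xs [] = rev xs" for xs :: "'b list"
    by (induction xs) auto
  have cells_rev: "cells (enc_list eb (rev xs)) = cells (enc_list eb xs)" for xs
    by (simp add: cells_enc_list rev_map[symmetric])
  have "ptime ea (enc_list eb) D (\<lambda>x. foldr (\<lambda>h acc. acc @ [h]) (l x) [])"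
  proof (rule ptime_foldr[where k = "\<lambda>x. cells (enc_list eb (l x))", OF l ptime_const])
    show "ptime (enc_pair ea (enc_pair eb (enc_list eb))) (enc_list eb) UNIV
        (\<lambda>z. snd (snd z) @ [fst (snd z)])"
      by (rule ptime_append ptime_Cons ptime_fst ptime_snd ptime_id ptime_const)+
  qed (auto intro: psize_out l simp: eq cells_rev cells_enc_list_append)
  then show ?thesis by (simp add: eq)
qed

lemma ptime_case_list:
  assumes l: "ptime ea (enc_list eb) D l" and f: "ptime ea ec D f"
    and g: "ptime (enc_pair ea (enc_pair eb (enc_list eb))) ec UNIV (\<lambda>z. g (fst z) (fst (snd z)) (snd (snd z)))"
  shows "ptime ea ec D (\<lambda>x. case l x of [] \<Rightarrow> f x | h # t \<Rightarrow> g x h t)"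
proof -
  let ?D = "{x \<in> D. l x \<noteq> []}"
  have l': "ptime ea (enc_list eb) ?D l" using l by (rule ptime_subset) auto
  have "ptime ea (enc_pair ea (enc_pair eb (enc_list eb))) ?D (\<lambda>x. (x, hd (l x), tl (l x)))"
    by (rule ptime_Pair ptime_hd ptime_tl ptime_id l' | simp)+
  from ptime_comp[OF this g] have "ptime ea ec ?D (\<lambda>x. g x (hd (l x)) (tl (l x)))" by simp
  moreover have "ptime ea ec {x \<in> D. l x = []} f" using f by (rule ptime_subset) auto
  ultimately have "ptime ea ec D (\<lambda>x. if l x = [] then f x else g x (hd (l x)) (tl (l x)))"
    using ptime_If[OF ptime_null[OF l]] by blast
  then show ?thesis by (rule ptime_fun_cong) (auto split: list.split)
qed

subsection \<open>Binary arithmetic\<close>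

abbreviation blen :: "nat \<Rightarrow> nat" where
  "blen n \<equiv> length (bits n)"

lemma blen_0 [simp]: "blen 0 = 0"
  by (simp add: bits.simps)

lemma blen_pos: "n \<noteq> 0 \<Longrightarrow> blen n = Suc (blen (n div 2))"
  by (subst bits.simps) simp

lemma blen_le_iff: "blen n \<le> k \<longleftrightarrow> n < 2 ^ k"
proof (induction k arbitrary: n)
  case 0
  show ?case using blen_pos[of n] by (cases "n = 0") auto
next
  case (Suc k)
  show ?case
  proof (cases "n = 0")
    case False
    then have "blen n \<le> Suc k \<longleftrightarrow> n div 2 < 2 ^ k" using Suc[of "n div 2"] by (simp add: blen_pos)
    then show ?thesis by (simp add: div_less_iff_less_mult mult.commute)
  qed simp
qed

lemma blen_mono: "m \<le> n \<Longrightarrow> blen m \<le> blen n"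
  using blen_le_iff[of n "blen n"] by (simp add: blen_le_iff)

text \<open>The crude bound by the sum of the lengths adds up along a list: the length of a sum is
  at most the size of the encoded list.\<close>

lemma blen_add_le: "blen (m + n) \<le> blen m + blen n"
proof (cases "m = 0 \<or> n = 0")
  case False
  have m: "m < 2 ^ blen m" and n: "n < 2 ^ blen n" using blen_le_iff by blast+
  obtain a b where ab: "blen m = Suc a" "blen n = Suc b" using False blen_pos by blast
  have "m + n < 2 ^ blen m + 2 ^ blen n" using m n by simp
  also have "\<dots> \<le> 2 ^ blen m * (2 :: nat) ^ blen n"
  proof -
    have "2 * x + 2 * y \<le> 2 * x * (2 * y)" if "1 \<le> x" "1 \<le> y" for x y :: nat
    proof -
      have "x \<le> x * y" "y \<le> x * y" using that by simp_all
      then show ?thesis by linarith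
    qed
    from this[of "2 ^ a" "2 ^ b"] show ?thesis by (simp add: ab)
  qed
  finally show ?thesis by (simp add: blen_le_iff power_add)
qed auto

lemma blen_le_cells: "blen n \<le> cells (enc_nat n)"
  by (simp add: enc_nat_def length_le_cells)

lemma cells_enc_nat_le: "cells (enc_nat n) \<le> 2 * blen n"
proof -
  have "cells (enc_bool b) \<le> 1" for b by (simp add: enc_bool_def)
  from cells_enc_list_le[of "bits n" enc_bool 1, OF this order_refl]
  show ?thesis by (simp add: enc_nat_def)
qed

lemma cells_enc_nat_leI: "blen n \<le> l \<Longrightarrow> 2 * l \<le> k \<Longrightarrow> cells (enc_nat n) \<le> k"
  using cells_enc_nat_le[of n] by linarith

lemma blen_of_bool: "blen (of_bool b) \<le> 1"
  by (cases b) (simp_all add: blen_le_iff)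

lemma cells_enc_nat_mono: "m \<le> n \<Longrightarrow> cells (enc_nat m) \<le> 2 * cells (enc_nat n)"
  using cells_enc_nat_le[of m] blen_mono[of m n] blen_le_cells[of n] by linarith

lemma enc_nat_0: "enc_nat 0 = Leaf"
  by (simp add: enc_nat_def bits.simps)

text \<open>On encodings this is the identity, which gives access to the bits of a number by list
  operations.\<close>

lemma ptime_bits: "ptime enc_nat (enc_list enc_bool) UNIV bits"
  by (rule ptime_cong[OF ptime_id[of "enc_list enc_bool" UNIV]]) (auto simp: enc_nat_def)

lemma ptime_odd:
  assumes "ptime ea enc_nat D a"
  shows "ptime ea enc_bool D (\<lambda>x. odd (a x))"
proof (rule ptime_comp[where D' = UNIV, OF assms])
  have "ptime enc_nat enc_bool UNIV (\<lambda>n. case bits n of [] \<Rightarrow> False | b # bs \<Rightarrow> b)"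
    by (rule ptime_case_list ptime_bits ptime_const ptime_fst ptime_snd ptime_id)+
  then show "ptime enc_nat enc_bool UNIV odd"
    by (rule ptime_fun_cong) (subst bits.simps, auto)
qed simp

lemma ptime_is_0:
  assumes "ptime ea enc_nat D a"
  shows "ptime ea enc_bool D (\<lambda>x. a x = 0)"
proof (rule ptime_comp[where D' = UNIV, OF assms])
  have "ptime enc_nat enc_bool UNIV (\<lambda>n. bits n = [])"
    by (rule ptime_null ptime_bits)+
  then show "ptime enc_nat enc_bool UNIV (\<lambda>n. n = 0)"
    by (rule ptime_fun_cong) (subst bits.simps, auto)
qed simp

lemma ptime_div2:
  assumes "ptime ea enc_nat D a"
  shows "ptime ea enc_nat D (\<lambda>x. a x div 2)"
proof (rule ptime_comp[where D' = UNIV, OF assms])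
  have "ptime enc_nat (enc_list enc_bool) UNIV (\<lambda>n. tl (bits n))"
    by (rule ptime_tl ptime_bits)+
  then show "ptime enc_nat enc_nat UNIV (\<lambda>n. n div 2)"
  proof (rule ptime_cong)
    show "\<exists>z\<in>UNIV. enc_nat z = enc_nat n \<and> enc_list enc_bool (tl (bits z)) = enc_nat (n div 2)" for n
      by (cases "n = 0") (auto simp: enc_nat_def bits.simps[of n] bits.simps[of 0] intro!: exI[of _ n])
  qed
qed simp

lemma ptime_bit_cons:
  assumes b: "ptime ea enc_bool D b" and a: "ptime ea enc_nat D a"
  shows "ptime ea enc_nat D (\<lambda>x. of_bool (b x) + 2 * a x)"
proof -
  \<comment> \<open>Putting a zero bit in front of 0 would give a list that encodes no number, so
    this case is answered separately.\<close>
  let ?D = "{x \<in> D. \<not> (\<not> b x \<and> a x = 0)}"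
  have "ptime ea (enc_list enc_bool) D (\<lambda>x. b x # bits (a x))"
    by (rule ptime_Cons b ptime_comp[OF a ptime_bits] subset_UNIV)+
  then have "ptime ea enc_nat ?D (\<lambda>x. of_bool (b x) + 2 * a x)"
  proof (rule ptime_cong)
    fix x assume "x \<in> ?D"
    then have "bits (of_bool (b x) + 2 * a x) = b x # bits (a x)"
      by (subst bits.simps) auto
    then show "\<exists>z\<in>D. ea z = ea x \<and> enc_list enc_bool (b z # bits (a z)) = enc_nat (of_bool (b x) + 2 * a x)"
      using \<open>x \<in> ?D\<close> by (intro bexI[of _ x]) (auto simp: enc_nat_def)
  qed
  then have "ptime ea enc_nat D (\<lambda>x. if \<not> b x \<and> a x = 0 then 0 else of_bool (b x) + 2 * a x)"
    by (intro ptime_If ptime_conj ptime_not ptime_is_0 b a ptime_const)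
  then show ?thesis by (rule ptime_fun_cong) auto
qed

text \<open>The common pattern of comparison, addition and subtraction: both numbers lose their
  lowest bit, and a carry is handed down to the recursive call. The 4 leaves room for the cells of
  the pairs and the carry, and for a result that is one bit longer.\<close>

lemma ptime_carry_rec:
  fixes f :: "nat \<Rightarrow> nat \<Rightarrow> bool \<Rightarrow> 'b"
  defines "e \<equiv> enc_pair enc_nat (enc_pair enc_nat enc_bool)"
  assumes g: "ptime enc_bool eb UNIV g"
    and c: "ptime e enc_bool UNIV (\<lambda>(m, n, b). c m n b)"
    and h: "ptime (enc_pair e eb) eb UNIV (\<lambda>((m, n, b), r). h m n b r)"
    and f: "\<And>m n b. (m, n, b) \<in> D \<Longrightarrow>
      f m n b = (if m = 0 \<and> n = 0 then g b else h m n b (f (m div 2) (n div 2) (c m n b)))"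
    and D: "\<And>m n b. (m, n, b) \<in> D \<Longrightarrow> (m div 2, n div 2, c m n b) \<in> D"
    and s: "\<And>m n b. (m, n, b) \<in> D \<Longrightarrow>
      cells (eb (f m n b)) \<le> 2 * (blen m + blen n) + 4"
  shows "ptime e eb D (\<lambda>(m, n, b). f m n b)"
proof -
  define L where "L = (\<lambda>z :: nat \<times> nat \<times> bool. blen (fst z) + blen (fst (snd z)))"
  have L_cells: "L z \<le> cells (e z)" for z
    using blen_le_cells[of "fst z"] blen_le_cells[of "fst (snd z)"]
    by (auto simp: L_def e_def enc_pair_def)
  have L_size: "psize e D L" by (rule psize_mono[OF psize_cells L_cells])
  have less: "L (fst z div 2, fst (snd z) div 2, b) < L z" if "\<not> (fst z = 0 \<and> fst (snd z) = 0)" for z b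
  proof -
    have le: "blen (n div 2) \<le> blen n" for n by (rule blen_mono) simp
    have "blen (fst z div 2) < blen (fst z) \<or> blen (fst (snd z) div 2) < blen (fst (snd z))"
      using that blen_pos by fastforce
    then show ?thesis using le[of "fst z"] le[of "fst (snd z)"] by (auto simp: L_def)
  qed
  let ?d = "\<lambda>z. (fst z div 2, fst (snd z) div 2, case z of (m, n, b) \<Rightarrow> c m n b)"
  show ?thesis
  proof (rule ptime_rec[where b = "\<lambda>z. fst z = 0 \<and> fst (snd z) = 0" and g = "\<lambda>z. g (snd (snd z))"
        and d = ?d
        and h = "\<lambda>((m, n, b), r). h m n b r" and H = UNIV and m = L and s = "\<lambda>z. 2 * L z + 4"])
    show "ptime e enc_bool D (\<lambda>z. fst z = 0 \<and> fst (snd z) = 0)"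
      unfolding e_def by (rule ptime_conj ptime_is_0 ptime_fst ptime_snd ptime_id)+
    show "ptime e eb {z \<in> D. fst z = 0 \<and> fst (snd z) = 0} (\<lambda>z. g (snd (snd z)))"
      unfolding e_def by (rule ptime_comp[OF _ g] ptime_snd ptime_id subset_UNIV)+
    show "ptime e e {z \<in> D. \<not> (fst z = 0 \<and> fst (snd z) = 0)} ?d"
      unfolding e_def
      by (rule ptime_Pair ptime_div2 ptime_UNIV[OF c[unfolded e_def]] ptime_fst ptime_snd ptime_id)+
    show "psize e D (\<lambda>z. 2 * L z + 4)" by (intro psize_add psize_mult psize_const L_size)
    fix z assume "z \<in> D"
    then obtain m n b where z: "z = (m, n, b)" "(m, n, b) \<in> D" by (cases z) auto
    show "cells (e z) \<le> 2 * L z + 4"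
      using cells_enc_nat_le[of "fst z"] cells_enc_nat_le[of "fst (snd z)"]
      by (auto simp: L_def e_def enc_pair_def enc_bool_def)
    show "cells (eb (case z of (m, n, b) \<Rightarrow> f m n b)) \<le> 2 * L z + 4"
      using s[OF z(2)] by (simp add: L_def z(1))
    show "(case z of (m, n, b) \<Rightarrow> f m n b) = (if fst z = 0 \<and> fst (snd z) = 0 then g (snd (snd z))
        else (\<lambda>((m, n, b), r). h m n b r)
          (z, case ?d z of (m, n, b) \<Rightarrow> f m n b))"
      unfolding z(1) fst_conv snd_conv prod.case by (rule f[OF z(2)])
    show "?d z \<in> D"
      unfolding z(1) fst_conv snd_conv prod.case by (rule D[OF z(2)])
    assume ne: "\<not> (fst z = 0 \<and> fst (snd z) = 0)"
    show "L (?d z) < L z" using ne by (rule less)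
    then show "2 * L (?d z) + 4 \<le> 2 * L z + 4" by simp
  qed (use h L_size in auto)
qed

lemma halvesE:
  fixes m :: nat
  obtains p x where "m = 2 * p + of_bool x"
  by (metis add.commute mod2_eq_if mod_mult_div_eq of_bool_def)

text \<open>The majority of the two lowest bits and the carry.\<close>

definition add_carry :: "nat \<Rightarrow> nat \<Rightarrow> bool \<Rightarrow> bool" where
  "add_carry m n b = (if odd m then odd n \<or> b else odd n \<and> b)"

text \<open>The borrow: the majority of the negated lowest bit of \<open>m\<close>, the lowest bit
  of \<open>n\<close> and the incoming borrow.\<close>

definition diff_carry :: "nat \<Rightarrow> nat \<Rightarrow> bool \<Rightarrow> bool" where
  "diff_carry m n b = (if odd m then odd n \<and> b else odd n \<or> b)"

definition parity :: "nat \<Rightarrow> nat \<Rightarrow> bool \<Rightarrow> bool" where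
  "parity m n b = (if odd m then if odd n then b else \<not> b else if odd n then \<not> b else b)"

text \<open>The bit \<open>b\<close> turns \<open><\<close> into \<open>\<le>\<close>. A strict
  comparison of the halves suffices or not depending on the lowest bits, so the test becomes one of
  the same kind.\<close>

lemma less_halves: "m < n + of_bool b \<longleftrightarrow> m div 2 < n div 2 + of_bool (diff_carry m n b)"
proof -
  obtain p x q y where "m = 2 * p + of_bool x" "n = 2 * q + of_bool y" by (metis halvesE)
  then show ?thesis unfolding diff_carry_def by (cases x; cases y; cases b) (simp_all, arith+)
qed

lemma add_halves:
  "m + n + of_bool b = of_bool (parity m n b) + 2 * (m div 2 + n div 2 + of_bool (add_carry m n b))"
proof -
  obtain p x q y where "m = 2 * p + of_bool x" "n = 2 * q + of_bool y" by (metis halvesE)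
  then show ?thesis unfolding add_carry_def parity_def by (cases x; cases y; cases b) simp_all
qed

lemma diff_halves:
  assumes "n + of_bool b \<le> m"
  shows "m - n - of_bool b = of_bool (parity m n b) + 2 * (m div 2 - n div 2 - of_bool (diff_carry m n b))"
    and "n div 2 + of_bool (diff_carry m n b) \<le> m div 2"
proof -
  obtain p x q y where "m = 2 * p + of_bool x" "n = 2 * q + of_bool y" by (metis halvesE)
  with assms show "m - n - of_bool b = of_bool (parity m n b) + 2 * (m div 2 - n div 2 - of_bool (diff_carry m n b))"
    "n div 2 + of_bool (diff_carry m n b) \<le> m div 2"
    unfolding diff_carry_def parity_def by (cases x; cases y; cases b; force)+
qed

abbreviation (input) enc_carry :: "nat \<times> nat \<times> bool \<Rightarrow> tree" where
  "enc_carry \<equiv> enc_pair enc_nat (enc_pair enc_nat enc_bool)"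

lemma ptime_add_carry: "ptime enc_carry enc_bool UNIV (\<lambda>(m, n, b). add_carry m n b)"
  and ptime_diff_carry: "ptime enc_carry enc_bool UNIV (\<lambda>(m, n, b). diff_carry m n b)"
  and ptime_parity: "ptime enc_carry enc_bool UNIV (\<lambda>(m, n, b). parity m n b)"
  unfolding add_carry_def diff_carry_def parity_def case_prod_unfold
  by (rule ptime_if ptime_conj ptime_disj ptime_not ptime_odd ptime_fst ptime_snd ptime_id)+

lemma ptime_parity_cons:
  "ptime (enc_pair enc_carry enc_nat) enc_nat UNIV (\<lambda>((m, n, b), r). of_bool (parity m n b) + 2 * r)"
proof -
  have "ptime (enc_pair enc_carry enc_nat) enc_nat UNIV
      (\<lambda>y. of_bool (case fst y of (m, n, b) \<Rightarrow> parity m n b) + 2 * snd y)"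
    by (rule ptime_bit_cons ptime_comp[OF _ ptime_parity] ptime_fst ptime_snd ptime_id subset_UNIV)+
  then show ?thesis by (rule ptime_fun_cong) (auto split: prod.split)
qed

lemma ptime_less_carry: "ptime enc_carry enc_bool UNIV (\<lambda>(m, n, b). m < n + of_bool b)"
proof (rule ptime_carry_rec[OF ptime_id ptime_diff_carry])
  have "ptime (enc_pair enc_carry enc_bool) enc_bool UNIV (\<lambda>y. snd y)"
    by (rule ptime_snd ptime_id)+
  then show "ptime (enc_pair enc_carry enc_bool) enc_bool UNIV (\<lambda>((m, n, b), r). r)"
    by (rule ptime_fun_cong) auto
  show "(m < n + of_bool b) = (if m = 0 \<and> n = 0 then b else
      m div 2 < n div 2 + of_bool (diff_carry m n b))" for m n :: nat and b
  proof (cases "m = 0 \<and> n = 0")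
    case False
    show ?thesis unfolding if_not_P[OF False] by (rule less_halves)
  qed simp
qed (simp_all add: enc_bool_def)

lemma ptime_plus_carry: "ptime enc_carry enc_nat UNIV (\<lambda>(m, n, b). m + n + of_bool b)"
proof (rule ptime_carry_rec[where g = "\<lambda>b. of_bool b + 2 * 0", OF _ ptime_add_carry ptime_parity_cons])
  show "ptime enc_bool enc_nat UNIV (\<lambda>b. of_bool b + 2 * 0)"
    by (rule ptime_bit_cons ptime_id ptime_const)+
  fix m n :: nat and b
  show "m + n + of_bool b = (if m = 0 \<and> n = 0 then of_bool b + 2 * 0 else
      of_bool (parity m n b) + 2 * (m div 2 + n div 2 + of_bool (add_carry m n b)))"
  proof (cases "m = 0 \<and> n = 0")
    case False
    show ?thesis unfolding if_not_P[OF False] by (rule add_halves)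
  qed simp
  have "blen (m + n + of_bool b) \<le> blen m + blen n + 1"
    by (rule order.trans[OF blen_add_le add_mono[OF blen_add_le blen_of_bool]])
  then show "cells (enc_nat (m + n + of_bool b)) \<le> 2 * (blen m + blen n) + 4"
    by (rule cells_enc_nat_leI) simp
qed simp

text \<open>On this domain no subtraction is truncated, and halving with the borrow does not leave
  the domain.\<close>

lemma ptime_minus_carry:
  "ptime enc_carry enc_nat {(m, n, b). n + of_bool b \<le> m} (\<lambda>(m, n, b). m - n - of_bool b)"
proof (rule ptime_carry_rec[OF ptime_const[of _ _ _ 0] ptime_diff_carry ptime_parity_cons])
  fix m n :: nat and b assume "(m, n, b) \<in> {(m, n, b). n + of_bool b \<le> m}"
  then have le: "n + of_bool b \<le> m" by simp
  show "m - n - of_bool b = (if m = 0 \<and> n = 0 then 0 else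
      of_bool (parity m n b) + 2 * (m div 2 - n div 2 - of_bool (diff_carry m n b)))"
  proof (cases "m = 0 \<and> n = 0")
    case False
    show ?thesis unfolding if_not_P[OF False] by (rule diff_halves(1)[OF le])
  qed simp
  show "(m div 2, n div 2, diff_carry m n b) \<in> {(m, n, b). n + of_bool b \<le> m}"
    using diff_halves(2)[OF le] by simp
  have "blen (m - n - of_bool b) \<le> blen m" by (rule blen_mono) simp
  then show "cells (enc_nat (m - n - of_bool b)) \<le> 2 * (blen m + blen n) + 4"
    by (rule cells_enc_nat_leI) simp
qed

lemma ptime_less:
  assumes a: "ptime ea enc_nat D a" and b: "ptime ea enc_nat D b"
  shows "ptime ea enc_bool D (\<lambda>x. a x < b x)"
  using ptime_comp[OF ptime_Pair[OF a ptime_Pair[OF b ptime_const[of ea enc_bool D False]]]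
      ptime_less_carry subset_UNIV] by simp

lemma ptime_add:
  assumes a: "ptime ea enc_nat D a" and b: "ptime ea enc_nat D b"
  shows "ptime ea enc_nat D (\<lambda>x. a x + b x)"
  using ptime_comp[OF ptime_Pair[OF a ptime_Pair[OF b ptime_const[of ea enc_bool D False]]]
      ptime_plus_carry subset_UNIV] by simp

lemma ptime_diff:
  assumes a: "ptime ea enc_nat D a" and b: "ptime ea enc_nat D b"
  shows "ptime ea enc_nat D (\<lambda>x. a x - b x)"
proof -
  let ?D = "{x \<in> D. \<not> a x < b x}"
  have a': "ptime ea enc_nat ?D a" and b': "ptime ea enc_nat ?D b"
    using a b by (auto elim: ptime_subset)
  have "ptime ea enc_nat ?D (\<lambda>x. case (a x, b x, False) of (m, n, b) \<Rightarrow> m - n - of_bool b)"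
    by (rule ptime_comp[OF ptime_Pair[OF a' ptime_Pair[OF b' ptime_const]] ptime_minus_carry]) auto
  then have "ptime ea enc_nat ?D (\<lambda>x. a x - b x)" by simp
  from ptime_If[OF ptime_less[OF a b] ptime_const[where c = 0] this] show ?thesis
    by (rule ptime_fun_cong) simp
qed

lemma ptime_le:
  assumes "ptime ea enc_nat D a" "ptime ea enc_nat D b"
  shows "ptime ea enc_bool D (\<lambda>x. a x \<le> b x)"
  using ptime_not[OF ptime_less[OF assms(2,1)]] by (simp add: not_less)

lemma ptime_eq:
  assumes "ptime ea enc_nat D a" "ptime ea enc_nat D b"
  shows "ptime ea enc_bool D (\<lambda>x. a x = b x)"
  using ptime_conj[OF ptime_le[OF assms] ptime_le[OF assms(2,1)]] by (simp add: eq_iff)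

lemma ptime_min:
  assumes "ptime ea enc_nat D a" "ptime ea enc_nat D b"
  shows "ptime ea enc_nat D (\<lambda>x. min (a x) (b x))"
  unfolding min_def by (intro ptime_if ptime_le assms)

lemma blen_sum_list_le: "blen (sum_list xs) \<le> cells (enc_list enc_nat xs)"
proof (induction xs)
  case (Cons n xs)
  then show ?case using blen_add_le[of n "sum_list xs"] blen_le_cells[of n] by simp
qed simp

lemma ptime_sum_list:
  assumes l: "ptime ea (enc_list enc_nat) D l"
  shows "ptime ea enc_nat D (\<lambda>x. sum_list (l x))"
proof -
  have eq: "foldr (\<lambda>h acc. h + acc) xs 0 = sum_list xs" for xs :: "nat list"
    by (induction xs) auto
  have "ptime ea enc_nat D (\<lambda>x. foldr (\<lambda>h acc. h + acc) (l x) 0)"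
  proof (rule ptime_foldr[where k = "\<lambda>x. 2 * cells (enc_list enc_nat (l x))", OF l ptime_const])
    show "ptime (enc_pair ea (enc_pair enc_nat enc_nat)) enc_nat UNIV (\<lambda>z. fst (snd z) + snd (snd z))"
      by (rule ptime_add ptime_fst ptime_snd ptime_id)+
    show "psize ea D (\<lambda>x. 2 * cells (enc_list enc_nat (l x)))"
      by (intro psize_mult psize_const psize_out l)
    show "cells (enc_nat (foldr (\<lambda>h acc. h + acc) t 0)) \<le> 2 * cells (enc_list enc_nat (l x))"
      if "l x = p @ t" for x p t
      using blen_sum_list_le[of t] cells_enc_nat_le[of "sum_list t"] that
      by (simp add: eq cells_enc_list_append)
  qed
  then show ?thesis by (simp add: eq)
qed

lemmas ptime_rules =
  ptime_Pair ptime_fst ptime_snd ptime_id ptime_if ptime_conj ptime_disj ptime_not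
  ptime_Cons ptime_append ptime_concat ptime_rev ptime_map ptime_filter ptime_list_ex
  ptime_null ptime_case_list ptime_sum_list ptime_min
  ptime_le ptime_less ptime_eq ptime_add ptime_diff ptime_const

section \<open>Computing the clearing state\<close>

type_synonym bank_list = "(nat \<times> nat \<times> (nat \<times> nat) list) list"

abbreviation enc_banks :: "bank_list \<Rightarrow> tree" where
  "enc_banks \<equiv> enc_list (enc_pair enc_nat (enc_pair enc_nat (enc_list (enc_pair enc_nat enc_nat))))"

abbreviation enc_assets :: "(nat \<times> nat) list \<Rightarrow> tree" where
  "enc_assets \<equiv> enc_list (enc_pair enc_nat enc_nat)"

text \<open>
  A slot \<open>(u, c, l, h)\<close> is a debt from \<open>u\<close> to \<open>c\<close> that is paid by the part of the assets of
  \<open>u\<close> between \<open>l\<close> and \<open>h\<close>.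
\<close>

abbreviation enc_slots :: "(nat \<times> nat \<times> nat \<times> nat) list \<Rightarrow> tree" where
  "enc_slots \<equiv> enc_list (enc_pair enc_nat (enc_pair enc_nat (enc_pair enc_nat enc_nat)))"

abbreviation enc_triples :: "(nat \<times> nat \<times> nat) list \<Rightarrow> tree" where
  "enc_triples \<equiv> enc_list (enc_pair enc_nat (enc_pair enc_nat enc_nat))"

text \<open>A right fold meets a debt after all later ones, so the intervals of those are shifted up
  by its liability instead of keeping a running sum.\<close>

definition offsets :: "(nat \<times> nat) list \<Rightarrow> (nat \<times> nat \<times> nat) list" where
  "offsets es = foldr (\<lambda>h acc. (fst h, 0, snd h) #
     map (\<lambda>r. (fst r, fst (snd r) + snd h, snd (snd r) + snd h)) acc) es []"

definition slots :: "bank_list \<Rightarrow> (nat \<times> nat \<times> nat \<times> nat) list" where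
  "slots B = concat (map (\<lambda>b. map (\<lambda>r. (fst b, r)) (offsets (snd (snd b)))) B)"

definition asset :: "(nat \<times> nat) list \<Rightarrow> nat \<Rightarrow> nat" where
  "asset X u = foldr (\<lambda>h acc. if fst h = u then snd h else acc) X 0"

text \<open>For \<open>l \<le> h\<close>, truncated subtraction makes \<open>min a h - l\<close> the
  value of \<open>slice l h a\<close>.\<close>

definition receive :: "(nat \<times> nat \<times> nat \<times> nat) list \<Rightarrow> (nat \<times> nat) list \<Rightarrow> nat \<Rightarrow> nat" where
  "receive S X w = sum_list (map (\<lambda>r. if fst (snd r) = w
     then min (asset X (fst r)) (snd (snd (snd r))) - fst (snd (snd r)) else 0) S)"

definition inflows :: "bank_list \<Rightarrow> (nat \<times> nat) list \<Rightarrow> (nat \<times> nat) list" where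
  "inflows B X = map (\<lambda>b. (fst b, fst (snd b) + receive (slots B) X (fst b))) B"

definition live_slots :: "bank_list \<Rightarrow> (nat \<times> nat) list \<Rightarrow> (nat \<times> nat \<times> nat \<times> nat) list" where
  "live_slots B X = filter (\<lambda>r. fst (snd (snd r)) \<le> asset X (fst r) \<and>
     asset X (fst r) < snd (snd (snd r))) (slots B)"

definition mem :: "nat \<Rightarrow> nat list \<Rightarrow> bool" where
  "mem u Z = list_ex (\<lambda>z. z = u) Z"

definition fed :: "(nat \<times> nat \<times> nat \<times> nat) list \<Rightarrow> nat list \<Rightarrow> nat list" where
  "fed L Z = filter (\<lambda>w. list_ex (\<lambda>r. fst (snd r) = w \<and> mem (fst r) Z) L) Z"

text \<open>
  Repeatedly discarding the banks without a live debt from the others leaves the cycles.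
\<close>

definition core :: "bank_list \<Rightarrow> (nat \<times> nat) list \<Rightarrow> nat list" where
  "core B X = foldr (\<lambda>_ Z. fed (live_slots B X) Z) B (map fst B)"

definition minimum :: "nat list \<Rightarrow> nat" where
  "minimum ns = (case ns of [] \<Rightarrow> 0 | h # t \<Rightarrow> foldr (\<lambda>m acc. min m acc) t h)"

definition slack :: "bank_list \<Rightarrow> (nat \<times> nat) list \<Rightarrow> nat list \<Rightarrow> nat" where
  "slack B X Z = minimum (map (\<lambda>r. snd (snd (snd r)) - asset X (fst r))
     (filter (\<lambda>r. mem (fst r) Z) (live_slots B X)))"

definition lift :: "(nat \<times> nat) list \<Rightarrow> nat list \<Rightarrow> nat \<Rightarrow> (nat \<times> nat) list" where
  "lift X Z \<epsilon> = map (\<lambda>h. (fst h, if mem (fst h) Z then snd h + \<epsilon> else snd h)) X"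

definition clear_round :: "bank_list \<Rightarrow> (nat \<times> nat) list \<Rightarrow> (nat \<times> nat) list" where
  "clear_round B X = inflows B (lift X (core B X) (slack B X (core B X)))"

text \<open>A counter in unary: what matters is its length, one more than the number of banks and
  debts together. Folding over it is a bounded loop.\<close>

definition fuel :: "bank_list \<Rightarrow> nat list" where
  "fuel B = 0 # map fst B @ map fst (slots B)"

definition clear_rounds :: "bank_list \<Rightarrow> (nat \<times> nat) list \<Rightarrow> (nat \<times> nat) list" where
  "clear_rounds B X = foldr (\<lambda>_ X. clear_round B X) (fuel B) X"

text \<open>The two nested loops run for the square of the length of \<open>fuel\<close>, which is
  at least the \<open>(1 + card E) * (1 + card V)\<close> rounds after which the state is
  clearing.\<close>

definition clear :: "bank_list \<Rightarrow> (nat \<times> nat) list" where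
  "clear B = foldr (\<lambda>_ X. clear_rounds B X) (fuel B) (map (\<lambda>b. (fst b, 0)) B)"

section \<open>Running time of the clearing computation\<close>

lemma offsets_Cons: "offsets (h # es) = (fst h, 0, snd h) #
    map (\<lambda>r. (fst r, fst (snd r) + snd h, snd (snd r) + snd h)) (offsets es)"
  by (simp add: offsets_def)

lemma offsets_bounds:
  "length (offsets es) = length es"
  "r \<in> set (offsets es) \<Longrightarrow> fst r \<in> fst ` set es \<and> fst (snd r) \<le> snd (snd r) \<and>
    snd (snd r) \<le> sum_list (map snd es)"
proof -
  show "length (offsets es) = length es"
    by (induction es) (simp_all add: offsets_Cons, simp add: offsets_def)
  show "r \<in> set (offsets es) \<Longrightarrow> fst r \<in> fst ` set es \<and> fst (snd r) \<le> snd (snd r) \<and>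
    snd (snd r) \<le> sum_list (map snd es)"
  proof (induction es arbitrary: r)
    case Nil
    then show ?case by (simp add: offsets_def)
  next
    case (Cons h es)
    from Cons.prems consider "r = (fst h, 0, snd h)" |
      r' where "r' \<in> set (offsets es)" "r = (fst r', fst (snd r') + snd h, snd (snd r') + snd h)"
      by (auto simp: offsets_Cons)
    then show ?case using Cons.IH by cases auto
  qed
qed

lemma cells_pair: "cells (enc_pair f g p) = Suc (cells (f (fst p)) + cells (g (snd p)))"
  by (simp add: enc_pair_def)

lemma ptime_offsets:
  "ptime (enc_list (enc_pair enc_nat enc_nat))
    enc_triples UNIV offsets"
proof -
  let ?e = "enc_list (enc_pair enc_nat enc_nat)"
    and ?s = "\<lambda>es :: (nat \<times> nat) list. sum_list (map snd es)"
  \<comment> \<open>The number of entries times the size of a triple. Both ends of a slice are at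
    most the total liability, and a smaller number takes at most twice the cells of a larger
    one.\<close>
  let ?k = "\<lambda>es. cells (?e es) * Suc (2 + (cells (?e es) + (2 * cells (enc_nat (?s es)) + 2 * cells (enc_nat (?s es)))))"
  have s: "ptime ?e enc_nat UNIV ?s" by (rule ptime_rules)+
  have "ptime ?e enc_triples UNIV
    (\<lambda>es. foldr (\<lambda>h acc. (fst h, 0, snd h) #
     map (\<lambda>r. (fst r, fst (snd r) + snd h, snd (snd r) + snd h)) acc) es [])"
  proof (rule ptime_foldr[where k = ?k])
    show "ptime (enc_pair ?e (enc_pair (enc_pair enc_nat enc_nat)
        enc_triples))
      enc_triples UNIV
      (\<lambda>z. (fst (fst (snd z)), 0, snd (fst (snd z))) # map (\<lambda>r. (fst r,
        fst (snd r) + snd (fst (snd z)), snd (snd r) + snd (fst (snd z)))) (snd (snd z)))"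
      by (rule ptime_rules)+
    show "psize ?e UNIV ?k"
      by (rule psize_mult psize_add psize_Suc psize_const psize_cells psize_out[OF s])+
    fix es p t :: "(nat \<times> nat) list" assume es: "es = p @ t"
    have "cells (enc_triples (offsets t)) \<le> ?k es"
    proof (rule cells_enc_list_le)
      fix r assume r: "r \<in> set (offsets t)"
      have le: "sum_list (map snd t) \<le> ?s es" by (simp add: es)
      have "fst r \<in> fst ` set es" using offsets_bounds(2)[OF r] by (auto simp: es)
      then obtain c where c: "c \<in> set es" "fst c = fst r" by (metis imageE)
      have "cells (enc_nat (fst r)) \<le> cells (?e es)"
        using cells_enc_list_elem[OF c(1), of "enc_pair enc_nat enc_nat"] c(2) by (simp add: cells_pair)
      moreover have "fst (snd r) \<le> ?s es" "snd (snd r) \<le> ?s es"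
        using offsets_bounds(2)[OF r] le by linarith+
      then have "cells (enc_nat (fst (snd r))) \<le> 2 * cells (enc_nat (?s es))"
        "cells (enc_nat (snd (snd r))) \<le> 2 * cells (enc_nat (?s es))"
        by (simp_all add: cells_enc_nat_mono)
      ultimately show "cells (enc_pair enc_nat (enc_pair enc_nat enc_nat) r) \<le>
        2 + (cells (?e es) + (2 * cells (enc_nat (?s es)) + 2 * cells (enc_nat (?s es))))"
        by (simp add: cells_pair)
    next
      have "length t \<le> length es" by (simp add: es)
      then show "length (offsets t) \<le> cells (?e es)"
        using length_le_cells[of es "enc_pair enc_nat enc_nat"] by (simp add: offsets_bounds(1))
    qed
    then show "cells (enc_triples
      (foldr (\<lambda>h acc. (fst h, 0, snd h) #
        map (\<lambda>r. (fst r, fst (snd r) + snd h, snd (snd r) + snd h)) acc) t [])) \<le> ?k es"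
      by (simp add: offsets_def)
  qed (rule ptime_rules)+
  then show ?thesis unfolding offsets_def .
qed

lemma ptime_offsets': "ptime ea (enc_list (enc_pair enc_nat enc_nat)) D es \<Longrightarrow>
    ptime ea enc_triples D (\<lambda>x. offsets (es x))"
  by (rule ptime_comp[OF _ ptime_offsets subset_UNIV])

lemma ptime_slots: "ptime ea enc_banks D B \<Longrightarrow> ptime ea enc_slots D (\<lambda>x. slots (B x))"
  unfolding slots_def by (rule ptime_offsets' ptime_rules | assumption)+

lemma asset_Cons: "asset (h # X) u = (if fst h = u then snd h else asset X u)"
  by (simp add: asset_def)

lemma asset_le: "cells (enc_nat (asset X u)) \<le> cells (enc_assets X)"
  by (induction X) (auto simp: asset_Cons cells_pair, simp add: asset_def enc_nat_0)

lemma ptime_asset: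
  assumes "ptime ea enc_assets D X" "ptime ea enc_nat D u"
  shows "ptime ea enc_nat D (\<lambda>x. asset (X x) (u x))"
proof (rule ptime_apply2[OF _ assms])
  let ?e = "enc_pair enc_assets enc_nat"
  have "ptime ?e enc_nat UNIV
    (\<lambda>z. foldr (\<lambda>h acc. if fst h = snd z then snd h else acc) (fst z) 0)"
  proof (rule ptime_foldr[where k = "\<lambda>z. cells (enc_assets (fst z))"])
    show "ptime (enc_pair ?e (enc_pair (enc_pair enc_nat enc_nat) enc_nat)) enc_nat UNIV
      (\<lambda>z. if fst (fst (snd z)) = snd (fst z) then snd (fst (snd z)) else snd (snd z))"
      by (rule ptime_rules)+
    show "psize ?e UNIV (\<lambda>z. cells (enc_assets (fst z)))"
      by (rule psize_out ptime_rules)+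
    show "cells (enc_nat (foldr (\<lambda>h acc. if fst h = snd z then snd h else acc) t 0))
        \<le> cells (enc_assets (fst z))" if "fst z = p @ t" for z p t
      using asset_le[of t "snd z"] that by (simp add: asset_def cells_enc_list_append)
  qed (rule ptime_rules)+
  then show "ptime ?e enc_nat UNIV (\<lambda>z. asset (fst z) (snd z))" unfolding asset_def .
qed

lemma ptime_inflows:
  assumes "ptime ea enc_banks D B" "ptime ea enc_assets D X"
  shows "ptime ea enc_assets D (\<lambda>x. inflows (B x) (X x))"
  by (rule ptime_apply2[OF _ assms], unfold inflows_def receive_def)
    (rule ptime_slots ptime_asset ptime_rules)+

lemma ptime_live_slots:
  assumes "ptime ea enc_banks D B" "ptime ea enc_assets D X"
  shows "ptime ea enc_slots D (\<lambda>x. live_slots (B x) (X x))"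
  by (rule ptime_apply2[OF _ assms], unfold live_slots_def)
    (rule ptime_slots ptime_asset ptime_rules)+

lemma ptime_mem:
  assumes "ptime ea enc_nat D u" "ptime ea (enc_list enc_nat) D Z"
  shows "ptime ea enc_bool D (\<lambda>x. mem (u x) (Z x))"
  by (rule ptime_apply2[OF _ assms], unfold mem_def) (rule ptime_rules)+

lemma ptime_fed:
  assumes "ptime ea enc_slots D L" "ptime ea (enc_list enc_nat) D Z"
  shows "ptime ea (enc_list enc_nat) D (\<lambda>x. fed (L x) (Z x))"
  by (rule ptime_apply2[OF _ assms], unfold fed_def) (rule ptime_mem ptime_rules)+

lemma foldr_const: "foldr (\<lambda>_ y. f y) xs y = (f ^^ length xs) y"
  by (induction xs) auto

lemma cells_fed_funpow_le: "cells (enc_list enc_nat ((fed L ^^ n) Z)) \<le> cells (enc_list enc_nat Z)"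
proof (induction n)
  case (Suc n)
  have "cells (enc_list enc_nat ((fed L ^^ Suc n) Z)) \<le> cells (enc_list enc_nat ((fed L ^^ n) Z))"
    by (simp add: fed_def cells_enc_list_filter_le)
  then show ?case using Suc by (rule order.trans)
qed simp

lemma ptime_core:
  assumes "ptime ea enc_banks D B" "ptime ea enc_assets D X"
  shows "ptime ea (enc_list enc_nat) D (\<lambda>x. core (B x) (X x))"
proof (rule ptime_apply2[OF _ assms])
  let ?e = "enc_pair enc_banks enc_assets"
  have "ptime ?e (enc_list enc_nat) UNIV
    (\<lambda>z. foldr (\<lambda>_ Z. fed (live_slots (fst z) (snd z)) Z) (fst z) (map fst (fst z)))"
  proof (rule ptime_foldr[where k = "\<lambda>z. cells (enc_list enc_nat (map fst (fst z)))"])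
    show "ptime (enc_pair ?e (enc_pair (enc_pair enc_nat (enc_pair enc_nat (enc_list (enc_pair enc_nat enc_nat))))
        (enc_list enc_nat))) (enc_list enc_nat) UNIV
      (\<lambda>z. fed (live_slots (fst (fst z)) (snd (fst z))) (snd (snd z)))"
      by (rule ptime_fed ptime_live_slots ptime_rules)+
    show "psize ?e UNIV (\<lambda>z. cells (enc_list enc_nat (map fst (fst z))))"
      by (rule psize_out ptime_rules)+
    show "cells (enc_list enc_nat (foldr (\<lambda>_ Z. fed (live_slots (fst z) (snd z)) Z) t (map fst (fst z))))
        \<le> cells (enc_list enc_nat (map fst (fst z)))" for z :: "bank_list \<times> (nat \<times> nat) list" and t :: bank_list
      unfolding foldr_const by (rule cells_fed_funpow_le)
  qed (rule ptime_rules)+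
  then show "ptime ?e (enc_list enc_nat) UNIV (\<lambda>z. core (fst z) (snd z))" unfolding core_def .
qed

lemma foldr_min_le: "foldr (\<lambda>m acc. min m acc) t (h :: nat) \<le> h"
  by (induction t) (auto simp: min_le_iff_disj)

lemma ptime_minimum:
  assumes "ptime ea (enc_list enc_nat) D l"
  shows "ptime ea enc_nat D (\<lambda>x. minimum (l x))"
proof (rule ptime_comp[OF assms _ subset_UNIV])
  let ?e = "enc_pair (enc_list enc_nat) (enc_pair enc_nat (enc_list enc_nat))"
  have "ptime ?e enc_nat UNIV (\<lambda>z. foldr (\<lambda>m acc. min m acc) (snd (snd z)) (fst (snd z)))"
  proof (rule ptime_foldr[where k = "\<lambda>z. 2 * cells (enc_nat (fst (snd z)))"])
    show "ptime (enc_pair ?e (enc_pair enc_nat enc_nat)) enc_nat UNIV (\<lambda>z. min (fst (snd z)) (snd (snd z)))"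
      by (rule ptime_rules)+
    show "psize ?e UNIV (\<lambda>z. 2 * cells (enc_nat (fst (snd z))))"
      by (rule psize_mult psize_const psize_out ptime_rules)+
    show "cells (enc_nat (foldr (\<lambda>m acc. min m acc) t (fst (snd z)))) \<le> 2 * cells (enc_nat (fst (snd z)))"
      for z :: "nat list \<times> nat \<times> nat list" and t
      by (rule cells_enc_nat_mono) (rule foldr_min_le)
  qed (rule ptime_rules)+
  then have "ptime (enc_list enc_nat) enc_nat UNIV
      (\<lambda>ns. case ns of [] \<Rightarrow> 0 | h # t \<Rightarrow> foldr (\<lambda>m acc. min m acc) t h)"
    by (rule ptime_case_list[OF ptime_id ptime_const])
  then show "ptime (enc_list enc_nat) enc_nat UNIV minimum" unfolding minimum_def .
qed

lemma ptime_slack: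
  assumes "ptime ea enc_banks D B" "ptime ea enc_assets D X" "ptime ea (enc_list enc_nat) D Z"
  shows "ptime ea enc_nat D (\<lambda>x. slack (B x) (X x) (Z x))"
  by (rule ptime_apply3[OF _ assms], unfold slack_def)
    (rule ptime_minimum ptime_mem ptime_asset ptime_live_slots ptime_rules)+

lemma ptime_lift:
  assumes "ptime ea enc_assets D X" "ptime ea (enc_list enc_nat) D Z" "ptime ea enc_nat D n"
  shows "ptime ea enc_assets D (\<lambda>x. lift (X x) (Z x) (n x))"
  by (rule ptime_apply3[OF _ assms], unfold lift_def) (rule ptime_mem ptime_rules)+

lemma ptime_clear_round:
  assumes "ptime ea enc_banks D B" "ptime ea enc_assets D X"
  shows "ptime ea enc_assets D (\<lambda>x. clear_round (B x) (X x))"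
  by (rule ptime_apply2[OF _ assms], unfold clear_round_def)
    (rule ptime_inflows ptime_lift ptime_core ptime_slack ptime_rules)+

lemma ptime_fuel:
  assumes "ptime ea enc_banks D B"
  shows "ptime ea (enc_list enc_nat) D (\<lambda>x. fuel (B x))"
  unfolding fuel_def by (rule ptime_slots ptime_rules assms)+

text \<open>A generous bound for what any bank can have after a round, whatever the assets were
  before. It keeps the numbers from growing with the number of rounds.\<close>

definition total_money :: "bank_list \<Rightarrow> nat" where
  "total_money B = sum_list (map (\<lambda>b. fst (snd b)) B) + sum_list (map (\<lambda>r. snd (snd (snd r))) (slots B))"

lemma ptime_total_money:
  assumes "ptime ea enc_banks D B"
  shows "ptime ea enc_nat D (\<lambda>x. total_money (B x))"
  unfolding total_money_def by (rule ptime_slots ptime_rules assms)+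

lemma receive_le: "receive S X w \<le> sum_list (map (\<lambda>r. snd (snd (snd r))) S)"
  unfolding receive_def by (rule sum_list_mono) auto

definition round_size :: "bank_list \<Rightarrow> nat" where
  "round_size B = cells (enc_banks B) * Suc (Suc (cells (enc_banks B) + 2 * cells (enc_nat (total_money B))))"

lemma psize_round_size: "ptime ea enc_banks D B \<Longrightarrow> psize ea D (\<lambda>x. round_size (B x))"
  unfolding round_size_def
  by (rule psize_mult psize_add psize_Suc psize_const | erule psize_out | rule psize_out, erule ptime_total_money)+

text \<open>The bound does not mention \<open>X\<close>: a round recomputes all assets from external
  assets and payments, and the payments are limited by the liabilities.\<close>

lemma cells_clear_round_le: "cells (enc_assets (clear_round B X)) \<le> round_size B"
  unfolding clear_round_def inflows_def round_size_def
proof (rule cells_enc_list_le)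
  let ?Y = "lift X (core B X) (slack B X (core B X))"
  fix h assume "h \<in> set (map (\<lambda>b. (fst b, fst (snd b) + receive (slots B) ?Y (fst b))) B)"
  then obtain b where b: "b \<in> set B" "h = (fst b, fst (snd b) + receive (slots B) ?Y (fst b))" by auto
  have "fst (snd b) \<le> sum_list (map (\<lambda>b. fst (snd b)) B)"
    using b(1) by (intro member_le_sum_list) auto
  then have "snd h \<le> total_money B"
    using receive_le[of "slots B" ?Y "fst b"] b(2) by (simp add: total_money_def)
  then have "cells (enc_nat (snd h)) \<le> 2 * cells (enc_nat (total_money B))"
    by (rule cells_enc_nat_mono)
  moreover have "cells (enc_nat (fst h)) \<le> cells (enc_banks B)"
    using cells_enc_list_elem[OF b(1), of "enc_pair enc_nat (enc_pair enc_nat (enc_list (enc_pair enc_nat enc_nat)))"]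
      b(2) by (simp add: cells_pair)
  ultimately show "cells (enc_pair enc_nat enc_nat h)
      \<le> Suc (cells (enc_banks B) + 2 * cells (enc_nat (total_money B)))"
    by (simp add: cells_pair)
qed (simp add: length_le_cells)

lemma ptime_clear_rounds:
  assumes "ptime ea enc_banks D B" "ptime ea enc_assets D X"
  shows "ptime ea enc_assets D (\<lambda>x. clear_rounds (B x) (X x))"
proof (rule ptime_apply2[OF _ assms])
  let ?e = "enc_pair enc_banks enc_assets"
  have "ptime ?e enc_assets UNIV (\<lambda>z. foldr (\<lambda>_ X. clear_round (fst z) X) (fuel (fst z)) (snd z))"
  proof (rule ptime_foldr[where k = "\<lambda>z. cells (enc_assets (snd z)) + round_size (fst z)"])
    show "ptime (enc_pair ?e (enc_pair enc_nat enc_assets)) enc_assets UNIV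
      (\<lambda>z. clear_round (fst (fst z)) (snd (snd z)))"
      by (rule ptime_clear_round ptime_rules)+
    show "psize ?e UNIV (\<lambda>z. cells (enc_assets (snd z)) + round_size (fst z))"
      by (rule psize_add psize_round_size psize_out ptime_rules)+
    show "cells (enc_assets (foldr (\<lambda>_ X. clear_round (fst z) X) t (snd z)))
        \<le> cells (enc_assets (snd z)) + round_size (fst z)"
      for z :: "bank_list \<times> (nat \<times> nat) list" and t :: "nat list"
      by (cases t) (simp_all add: cells_clear_round_le trans_le_add2)
  qed (rule ptime_fuel ptime_rules)+
  then show "ptime ?e enc_assets UNIV (\<lambda>z. clear_rounds (fst z) (snd z))" unfolding clear_rounds_def .
qed

lemma ptime_clear:
  assumes "ptime ea enc_banks D B"
  shows "ptime ea enc_assets D (\<lambda>x. clear (B x))"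
proof (rule ptime_comp[OF assms _ subset_UNIV])
  have "ptime enc_banks enc_assets UNIV
    (\<lambda>B. foldr (\<lambda>_ X. clear_rounds B X) (fuel B) (map (\<lambda>b. (fst b, 0)) B))"
  proof (rule ptime_foldr[where k = "\<lambda>B. cells (enc_assets (map (\<lambda>b. (fst b, 0)) B)) + round_size B"])
    show "ptime (enc_pair enc_banks (enc_pair enc_nat enc_assets)) enc_assets UNIV
      (\<lambda>z. clear_rounds (fst z) (snd (snd z)))"
      by (rule ptime_clear_rounds ptime_rules)+
    show "psize enc_banks UNIV (\<lambda>B. cells (enc_assets (map (\<lambda>b. (fst b, 0)) B)) + round_size B)"
      by (rule psize_add psize_round_size psize_out ptime_rules)+
    show "cells (enc_assets (foldr (\<lambda>_ X. clear_rounds B X) t (map (\<lambda>b. (fst b, 0)) B)))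
        \<le> cells (enc_assets (map (\<lambda>b. (fst b, 0)) B)) + round_size B"
      for B :: bank_list and t :: "nat list"
      \<comment> \<open>As \<open>fuel\<close> is nonempty, the last operation of
        \<open>clear_rounds\<close> is a round, so the size bound of a single round applies.\<close>
      by (cases t) (simp_all add: clear_rounds_def fuel_def cells_clear_round_le trans_le_add2)
  qed (rule ptime_fuel ptime_rules)+
  then show "ptime enc_banks enc_assets UNIV clear" unfolding clear_def .
qed

section \<open>Correctness of the clearing computation\<close>

definition bank_list :: "nat network \<Rightarrow> bank_list" where
  "bank_list N = map (\<lambda>u. (u, ext_assets N u, map (\<lambda>e. (snd e, liab N e)) (ranking N u)))
     (sorted_list_of_set (banks N))"

lemma enc_list_map: "enc_list f (map g xs) = enc_list (\<lambda>x. f (g x)) xs"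
  by (induction xs) auto

lemma enc_network_eq: "enc_network N = enc_banks (bank_list N)"
  by (simp add: enc_network_def bank_list_def enc_list_map enc_bank_def[abs_def])

definition slot :: "nat network \<Rightarrow> nat \<times> nat \<Rightarrow> nat \<times> nat \<times> nat \<times> nat" where
  "slot N p = (fst p, creditor N p, due N (fst p) (snd p), due N (fst p) (Suc (snd p)))"

lemma offsets_eq: "offsets es = map (\<lambda>i. (fst (es ! i), sum_list (take i (map snd es)),
    sum_list (take (Suc i) (map snd es)))) [0..<length es]"
proof (induction es)
  case (Cons h es)
  have "[0..<length (h # es)] = 0 # map Suc [0..<length es]"
    by (simp add: map_Suc_upt upt_conv_Cons del: upt_Suc)
  then show ?case by (simp add: offsets_Cons Cons.IH o_def add.commute del: upt_Suc)
qed (simp add: offsets_def)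

definition position_list :: "nat network \<Rightarrow> (nat \<times> nat) list" where
  "position_list N = concat (map (\<lambda>u. map (Pair u) [0..<length (ranking N u)])
     (sorted_list_of_set (banks N)))"

lemma position_list:
  assumes "finite (banks N)"
  shows "distinct (position_list N)" "set (position_list N) = positions N"
proof -
  show "set (position_list N) = positions N"
    using assms by (auto simp: position_list_def positions_def)
  have "distinct (concat (map (\<lambda>u. map (Pair u) [0..<f u]) us))"
    if "distinct us" for us and f :: "nat \<Rightarrow> nat"
    using that by (induction us) (auto simp: distinct_map inj_on_def)
  then show "distinct (position_list N)" by (simp add: position_list_def)
qed

lemma slots_bank_list:
  assumes N: "edge_ranking_network N"
  shows "slots (bank_list N) = map (slot N) (position_list N)"
proof -
  have eq: "map (Pair u) (offsets (map (\<lambda>e. (snd e, liab N e)) (ranking N u)))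
      = map (slot N) (map (Pair u) [0..<length (ranking N u)])"
    if u: "u \<in> set (sorted_list_of_set (banks N))" for u
  proof -
    have u': "u \<in> banks N" using u networkD(1)[OF N] by simp
    show ?thesis
      unfolding offsets_eq map_map length_map
      using u' by (intro map_cong refl)
        (simp add: slot_def creditor_def positions_def debt_at_def due_def o_def)
  qed
  show ?thesis
    unfolding slots_def bank_list_def position_list_def map_concat map_map
    by (intro arg_cong[of _ _ concat] map_cong refl) (simp add: eq)
qed

lemma asset_alist:
  "asset (map (\<lambda>u. (u, x u)) us) w = (if w \<in> set us then x w else 0)"
  by (induction us) (auto simp: asset_Cons, auto simp: asset_def)

text \<open>Links the computation on natural numbers to the real-valued theory: truncated
  subtraction is exact here because the ends of the slices are monotone.\<close>

lemma real_receive: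
  assumes N: "edge_ranking_network N"
  shows "real (ext_assets N w) + real (receive (slots (bank_list N)) X w) =
    debt_system.inflow (positions N) fst (lower N) (upper N) (ext_real N) (creditor N)
      (\<lambda>u. real (asset X u)) w"
proof -
  interpret network_system N using N by (rule network_systemI)
  note pl = position_list[OF networkD(1)[OF N]]
  have le: "due N u i \<le> due N u (Suc i)" for u i by (rule due_mono) simp
  let ?r = "\<lambda>p. real (min (asset X (fst p)) (due N (fst p) (Suc (snd p))) - due N (fst p) (snd p))"
  have "real (receive (slots (bank_list N)) X w)
      = (\<Sum>p\<leftarrow>position_list N. if creditor N p = w
          then ?r p else 0)"
    by (simp add: receive_def slots_bank_list[OF N] of_nat_sum_list o_def slot_def if_distrib cong: if_cong)
  also have "\<dots> = (\<Sum>p\<in>positions N. if creditor N p = w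
      then ?r p else 0)"
    by (simp add: sum_list_distinct_conv_sum_set[OF pl(1)] pl(2))
  also have "\<dots> = (\<Sum>p\<in>positions N. if creditor N p = w then slice (lower N p) (upper N p) (real (asset X (fst p))) else 0)"
  proof (intro sum.cong refl)
    fix p
    show "(if creditor N p = w
        then ?r p else 0) =
      (if creditor N p = w then slice (lower N p) (upper N p) (real (asset X (fst p))) else 0)"
      using le[of "fst p" "snd p"]
      by (auto simp: slice_def lower_def upper_def min_def max_def of_nat_diff)
  qed
  finally show ?thesis by (simp add: inflow_def)
qed

lemma mem_iff: "mem u Z \<longleftrightarrow> u \<in> set Z"
  by (auto simp: mem_def list_ex_iff)

lemma set_fed: "set (fed L Z) = {w \<in> set Z. \<exists>r\<in>set L. fst (snd r) = w \<and> fst r \<in> set Z}"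
  by (auto simp: fed_def list_ex_iff mem_iff)

text \<open>Each application before the fixpoint removes an entry, so it is reached after at most
  \<open>length Z\<close> applications.\<close>

lemma shrinking_funpow_fixpoint:
  fixes f :: "'a list \<Rightarrow> 'a list"
  assumes shrink: "\<And>Z. f Z = Z \<or> length (f Z) < length Z" and n: "length Z \<le> n"
  shows "f ((f ^^ n) Z) = (f ^^ n) Z"
proof -
  have "f ((f ^^ k) Z) = (f ^^ k) Z \<or> length ((f ^^ k) Z) + k \<le> length Z" for k
  proof (induction k)
    case (Suc k)
    then show ?case using shrink[of "(f ^^ k) Z"] by auto
  qed simp
  from this[of n] n shrink[of "(f ^^ n) Z"] show ?thesis by fastforce
qed

lemma fed_core: "fed (live_slots B X) (core B X) = core B X"
proof -
  let ?f = "fed (live_slots B X)"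
  have "?f Z = Z \<or> length (?f Z) < length Z" for Z
  proof (cases "?f Z = Z")
    case False
    then obtain w where "w \<in> set Z" "\<not> list_ex (\<lambda>r. fst (snd r) = w \<and> mem (fst r) Z) (live_slots B X)"
      unfolding fed_def filter_id_conv by blast
    then show ?thesis unfolding fed_def by (intro disjI2 length_filter_less)
  qed simp
  then have "?f ((?f ^^ length B) (map fst B)) = (?f ^^ length B) (map fst B)"
    by (rule shrinking_funpow_fixpoint) simp
  then show ?thesis by (simp add: core_def foldr_const)
qed

text \<open>A set whose members are all fed from the set itself survives each discarding step.
  Together with \<open>fed_core\<close> this makes the core the largest such set of banks.\<close>

lemma subset_core:
  assumes "C \<subseteq> set (map fst B)"
    and "\<And>w. w \<in> C \<Longrightarrow> \<exists>r\<in>set (live_slots B X). fst (snd r) = w \<and> fst r \<in> C"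
  shows "C \<subseteq> set (core B X)"
proof -
  have "C \<subseteq> set ((fed (live_slots B X) ^^ n) (map fst B))" for n
  proof (induction n)
    case (Suc n)
    show ?case
    proof
      fix w assume w: "w \<in> C"
      from assms(2)[OF w] obtain r where "r \<in> set (live_slots B X)" "fst (snd r) = w" "fst r \<in> C" by blast
      then show "w \<in> set ((fed (live_slots B X) ^^ Suc n) (map fst B))"
        using Suc w by (auto simp: set_fed)
    qed
  qed (use assms in simp)
  then show ?thesis by (simp add: core_def foldr_const)
qed

lemma minimum:
  assumes "ns \<noteq> []"
  shows "minimum ns \<in> set ns" "n \<in> set ns \<Longrightarrow> minimum ns \<le> n"
proof -
  obtain h t where ns: "ns = h # t" using assms by (cases ns) auto
  have "foldr (\<lambda>m acc. min m acc) t h = Min (insert h (set t))" for h :: nat and t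
  proof (induction t)
    case (Cons a t)
    then show ?case by (simp add: insert_commute[of h a])
  qed simp
  then have "minimum ns = Min (set ns)" by (simp add: minimum_def ns)
  then show "minimum ns \<in> set ns" "n \<in> set ns \<Longrightarrow> minimum ns \<le> n"
    using assms by simp_all
qed

text \<open>The witnesses are the core for \<open>Z\<close> and the smallest amount missing on a
  live debt of the core for \<open>\<epsilon>\<close>. The form of the asset list has to be kept as
  well, to repeat the argument in the next round.\<close>

lemma clear_round_advance:
  assumes N: "edge_ranking_network N" and X: "X = map (\<lambda>u. (u, x u)) (sorted_list_of_set (banks N))"
  shows "debt_system.advance (banks N) (positions N) fst (lower N) (upper N) (ext_real N) (creditor N)
      (\<lambda>w. real (asset X w)) (\<lambda>w. real (asset (clear_round (bank_list N) X) w))"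
    and "\<exists>x'. clear_round (bank_list N) X = map (\<lambda>u. (u, x' u)) (sorted_list_of_set (banks N))"
proof -
  interpret network_system N using N by (rule network_systemI)
  let ?B = "bank_list N" and ?us = "sorted_list_of_set (banks N)"
  have us: "set ?us = banks N" using networkD(1)[OF N] by simp
  have Bfst: "map fst ?B = ?us" by (simp add: bank_list_def o_def)
  define a where "a = (\<lambda>w. real (asset X w))"
  define Z where "Z = core ?B X"
  define \<epsilon> where "\<epsilon> = slack ?B X Z"
  define Y where "Y = lift X Z \<epsilon>"
  have round: "clear_round ?B X = map (\<lambda>u. (u, ext_assets N u + receive (slots ?B) Y u)) ?us"
    by (simp add: clear_round_def inflows_def Y_def \<epsilon>_def Z_def bank_list_def[of N] o_def)
  then show "\<exists>x'. clear_round ?B X = map (\<lambda>u. (u, x' u)) ?us" by (intro exI)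
  have live_slots: "set (live_slots ?B X) = slot N ` live a"
  proof -
    have "set (live_slots ?B X) = {r \<in> slot N ` positions N. fst (snd (snd r)) \<le> asset X (fst r) \<and>
        asset X (fst r) < snd (snd (snd r))}"
      by (simp add: live_slots_def slots_bank_list[OF N] position_list(2)[OF networkD(1)[OF N]])
    also have "\<dots> = slot N ` live a"
      by (auto simp: live_def a_def lower_def upper_def slot_def)
    finally show ?thesis .
  qed
  have slot_simps: "fst (slot N e) = fst e" "fst (snd (slot N e)) = creditor N e"
    "snd (snd (snd (slot N e))) = due N (fst e) (Suc (snd e))" for e by (simp_all add: slot_def)
  have Z1: "\<forall>w\<in>set Z. \<exists>e\<in>live a. fst e \<in> set Z \<and> creditor N e = w"
  proof
    fix w assume "w \<in> set Z"
    then have "w \<in> set (fed (live_slots ?B X) Z)" by (simp add: Z_def fed_core)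
    then show "\<exists>e\<in>live a. fst e \<in> set Z \<and> creditor N e = w"
      unfolding set_fed live_slots by (auto simp: slot_simps)
  qed
  \<comment> \<open>A live cycle is fed by itself and would have survived in the core.\<close>
  have Z2: "acyclic (live_graph (creditor N) a)" if "set Z = {}"
  proof (rule acyclicI, rule allI, rule notI)
    fix y assume "(y, y) \<in> (live_graph (creditor N) a)\<^sup>+"
    then obtain C where y: "y \<in> C" and C: "\<And>w. w \<in> C \<Longrightarrow> \<exists>e\<in>live a. fst e \<in> C \<and> creditor N e = w"
      by (rule live_cycle) blast
    have "C \<subseteq> set Z"
      unfolding Z_def
    proof (rule subset_core)
      show "C \<subseteq> set (map fst ?B)"
        unfolding Bfst us using C creditor_in_banks[OF N] by (auto simp: live_def)
      show "\<exists>r\<in>set (live_slots ?B X). fst (snd r) = w \<and> fst r \<in> C" if "w \<in> C" for w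
        using C[OF that] unfolding live_slots by (auto simp: slot_simps)
    qed
    then show False using that y by auto
  qed
  define ns where "ns = map (\<lambda>r. snd (snd (snd r)) - asset X (fst r))
    (filter (\<lambda>r. mem (fst r) Z) (live_slots ?B X))"
  have set_ns: "set ns = (\<lambda>e. due N (fst e) (Suc (snd e)) - asset X (fst e)) ` {e \<in> live a. fst e \<in> set Z}"
  proof -
    have "{r \<in> slot N ` live a. fst r \<in> set Z} = slot N ` {e \<in> live a. fst e \<in> set Z}"
      by (auto simp: slot_simps)
    then show ?thesis by (simp add: ns_def live_slots mem_iff image_image slot_simps)
  qed
  have \<epsilon>: "\<epsilon> = minimum ns" by (simp add: \<epsilon>_def slack_def ns_def)
  have slack: "a (fst e) + real (due N (fst e) (Suc (snd e)) - asset X (fst e)) = upper N e"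
    if "e \<in> live a" for e
    using that by (auto simp: live_def a_def upper_def of_nat_diff)
  have E1: "\<forall>e\<in>live a. fst e \<in> set Z \<longrightarrow> a (fst e) + real \<epsilon> \<le> upper N e"
  proof (intro ballI impI)
    fix e assume e: "e \<in> live a" "fst e \<in> set Z"
    then have "due N (fst e) (Suc (snd e)) - asset X (fst e) \<in> set ns" by (auto simp: set_ns)
    then have "\<epsilon> \<le> due N (fst e) (Suc (snd e)) - asset X (fst e)"
      unfolding \<epsilon> by (intro minimum(2)) auto
    then show "a (fst e) + real \<epsilon> \<le> upper N e" using slack[OF e(1)] by linarith
  qed
  \<comment> \<open>A member of the core is fed by a live debt from the core, so the minimum is
    taken over a nonempty list and attained.\<close>
  have E2: "\<exists>e\<in>live a. fst e \<in> set Z \<and> a (fst e) + real \<epsilon> = upper N e" if Z: "set Z \<noteq> {}"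
  proof -
    obtain w where w: "w \<in> set Z" using Z by (meson ex_in_conv)
    from bspec[OF Z1 w] obtain e where "e \<in> {e \<in> live a. fst e \<in> set Z}" by auto
    then have "set ns \<noteq> {}" unfolding set_ns by blast
    then have "\<epsilon> \<in> set ns" unfolding \<epsilon> by (intro minimum(1)) auto
    then obtain e where "e \<in> live a" "fst e \<in> set Z" "\<epsilon> = due N (fst e) (Suc (snd e)) - asset X (fst e)"
      by (auto simp: set_ns)
    then show ?thesis using slack by auto
  qed
  have Y: "Y = map (\<lambda>u. (u, if u \<in> set Z then x u + \<epsilon> else x u)) ?us"
    by (simp add: Y_def lift_def X mem_iff o_def)
  have Yw: "real (asset Y w) = (if w \<in> set Z then a w + real \<epsilon> else a w)" if "w \<in> banks N" for w
    using that by (simp add: Y X a_def asset_alist us)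
  have adv: "\<forall>w\<in>banks N. real (asset (clear_round ?B X) w) =
      inflow (creditor N) (\<lambda>w. if w \<in> set Z then a w + real \<epsilon> else a w) w"
  proof
    fix w assume w: "w \<in> banks N"
    then have "real (asset (clear_round ?B X) w) = inflow (creditor N) (\<lambda>u. real (asset Y u)) w"
      using real_receive[OF N, of w Y] by (simp add: round asset_alist us)
    also have "\<dots> = inflow (creditor N) (\<lambda>w. if w \<in> set Z then a w + real \<epsilon> else a w) w"
      by (rule inflow_cong) (rule Yw)
    finally show "real (asset (clear_round ?B X) w) =
      inflow (creditor N) (\<lambda>w. if w \<in> set Z then a w + real \<epsilon> else a w) w" .
  qed
  show "advance (creditor N) (\<lambda>w. real (asset X w)) (\<lambda>w. real (asset (clear_round ?B X) w))"
    unfolding advance_def a_def[symmetric]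
    using Z1 Z2 E1 E2 adv by (intro exI[of _ "set Z"] exI[of _ "real \<epsilon>"] conjI) auto
qed

lemma asset_clear:
  assumes N: "edge_ranking_network N" and w: "w \<in> banks N"
  shows "real (asset (clear (bank_list N)) w) = total_assets N w"
proof -
  interpret network_system N using N by (rule network_systemI)
  let ?B = "bank_list N" and ?us = "sorted_list_of_set (banks N)"
  let ?I = "map (\<lambda>b. (fst b, 0 :: nat)) ?B"
  let ?X = "\<lambda>k. (clear_round ?B ^^ k) ?I"
  have X0: "?I = map (\<lambda>u. (u, 0)) ?us" by (simp add: bank_list_def o_def)
  have alist: "\<exists>x. ?X k = map (\<lambda>u. (u, x u)) ?us" for k
  proof (induction k)
    case 0
    show ?case by (simp add: X0) (rule exI[of _ "\<lambda>_. 0"], simp)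
  next
    case (Suc k)
    then obtain x where "?X k = map (\<lambda>u. (u, x u)) ?us" by blast
    from clear_round_advance(2)[OF N this] show ?case by simp
  qed
  have adv: "advance (creditor N) (\<lambda>w. real (asset (?X k) w)) (\<lambda>w. real (asset (?X (Suc k)) w))" for k
  proof -
    obtain x where "?X k = map (\<lambda>u. (u, x u)) ?us" using alist by blast
    from clear_round_advance(1)[OF N this] show ?thesis by simp
  qed
  let ?m = "length (fuel ?B)"
  have m: "?m = Suc (card (banks N) + card (positions N))"
  proof -
    have "length (position_list N) = card (positions N)"
      using position_list[OF networkD(1)[OF N]] by (metis distinct_card)
    then show ?thesis by (simp add: fuel_def slots_bank_list[OF N], simp add: bank_list_def)
  qed
  have "clear ?B = ?X (?m * ?m)"
    by (simp add: clear_def clear_rounds_def foldr_const funpow_mult)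
  moreover have "real (asset (?X (?m * ?m)) w) = total_assets N w"
  proof (rule advance_converges[where x = "\<lambda>k w. real (asset (?X k) w)", OF _ clearing_total_assets[OF N] _ adv _ w])
    show "\<forall>e\<in>positions N. creditor N e \<in> banks N" using creditor_in_banks[OF N] by blast
    show "Suc (card (positions N)) * Suc (card (banks N)) \<le> ?m * ?m"
      unfolding m by (intro mult_le_mono) auto
    fix w assume "w \<in> banks N"
    then show "0 \<le> real (asset (?X 0) w) \<and> real (asset (?X 0) w)
        \<le> inflow (creditor N) (\<lambda>w. real (asset (?X 0) w)) w"
      using inflow_nonneg by (simp add: X0 asset_alist)
  qed
  ultimately show ?thesis by simp
qed

section \<open>Solving SemiSwap\<close>

abbreviation enc_swap :: "nat debt_swap \<Rightarrow> tree" where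
  "enc_swap \<equiv> enc_pair (enc_pair enc_nat enc_nat) (enc_pair enc_nat enc_nat)"

definition debt_list :: "bank_list \<Rightarrow> (nat \<times> nat \<times> nat) list" where
  "debt_list B = concat (map (\<lambda>b. map (\<lambda>c. (fst b, c)) (snd (snd b))) B)"

definition has_debt :: "bank_list \<Rightarrow> nat \<Rightarrow> nat \<Rightarrow> bool" where
  "has_debt B u c = list_ex (\<lambda>d. fst d = u \<and> fst (snd d) = c) (debt_list B)"

definition candidates :: "bank_list \<Rightarrow> nat debt_swap list" where
  "candidates B = concat (map (\<lambda>d. map (\<lambda>d'. ((fst d, fst (snd d)), (fst d', fst (snd d'))))
     (filter (\<lambda>d'. snd (snd d) = snd (snd d')) (debt_list B))) (debt_list B))"

definition redirect :: "nat debt_swap \<Rightarrow> nat \<Rightarrow> nat \<Rightarrow> nat" where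
  "redirect \<sigma> u c =
     (if u = fst (fst \<sigma>) \<and> c = snd (fst \<sigma>) then snd (snd \<sigma>)
      else if u = fst (snd \<sigma>) \<and> c = snd (snd \<sigma>) then snd (fst \<sigma>) else c)"

definition swap_banks :: "nat debt_swap \<Rightarrow> bank_list \<Rightarrow> bank_list" where
  "swap_banks \<sigma> B = map (\<lambda>b. (fst b, fst (snd b),
     map (\<lambda>c. (redirect \<sigma> (fst b) (fst c), snd c)) (snd (snd b)))) B"

definition valid_swap :: "bank_list \<Rightarrow> nat debt_swap \<Rightarrow> bool" where
  "valid_swap B \<sigma> \<longleftrightarrow>
     \<not> fst (fst \<sigma>) = snd (fst \<sigma>) \<and> \<not> fst (fst \<sigma>) = fst (snd \<sigma>) \<and> \<not> fst (fst \<sigma>) = snd (snd \<sigma>) \<and>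
     \<not> snd (fst \<sigma>) = fst (snd \<sigma>) \<and> \<not> snd (fst \<sigma>) = snd (snd \<sigma>) \<and> \<not> fst (snd \<sigma>) = snd (snd \<sigma>) \<and>
     \<not> has_debt B (fst (fst \<sigma>)) (snd (snd \<sigma>)) \<and> \<not> has_debt B (fst (snd \<sigma>)) (snd (fst \<sigma>))"

definition gains :: "(nat \<times> nat) list \<Rightarrow> (nat \<times> nat) list \<Rightarrow> nat \<Rightarrow> nat \<Rightarrow> nat \<Rightarrow> bool" where
  "gains X X' v1 v2 v \<longleftrightarrow>
     (asset X v1 < asset X' v1 \<and> asset X v2 = asset X' v2 \<or>
      asset X v1 = asset X' v1 \<and> asset X v2 < asset X' v2) \<and> asset X v < asset X' v"

definition good_swap :: "bank_list \<Rightarrow> nat \<Rightarrow> nat debt_swap \<Rightarrow> bool" where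
  "good_swap B v \<sigma> \<longleftrightarrow> valid_swap B \<sigma> \<and>
     gains (clear B) (clear (swap_banks \<sigma> B)) (snd (fst \<sigma>)) (snd (snd \<sigma>)) v"

text \<open>Without a suitable swap the state is left alone, so the loop may run longer than there
  are swaps to carry out.\<close>

definition improve :: "nat \<Rightarrow> bank_list \<times> nat debt_swap list \<Rightarrow> bank_list \<times> nat debt_swap list" where
  "improve v st = (case filter (\<lambda>\<sigma>. good_swap (fst st) v \<sigma>) (candidates (fst st)) of
     [] \<Rightarrow> st | \<sigma> # _ \<Rightarrow> (swap_banks \<sigma> (fst st), \<sigma> # snd st))"

definition square :: "nat list \<Rightarrow> nat list" where
  "square l = concat (map (\<lambda>_. l) l)"

text \<open>The counter is squared twice, so the loop runs for the fourth power of the length of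
  \<open>fuel\<close>, more than the cubic bound on the number of swaps. The swaps are collected in
  reverse order.\<close>

definition solve :: "bank_list \<times> nat \<Rightarrow> nat debt_swap list" where
  "solve I = rev (snd (foldr (\<lambda>_ st. improve (snd I) st) (square (square (fuel (fst I)))) (fst I, [])))"

section \<open>Running time of the search for swaps\<close>

lemma ptime_debt_list:
  assumes "ptime ea enc_banks D B"
  shows "ptime ea enc_triples D (\<lambda>x. debt_list (B x))"
  unfolding debt_list_def by (rule ptime_rules assms)+

lemma ptime_has_debt:
  assumes "ptime ea enc_banks D B" "ptime ea enc_nat D u" "ptime ea enc_nat D c"
  shows "ptime ea enc_bool D (\<lambda>x. has_debt (B x) (u x) (c x))"
  by (rule ptime_apply3[OF _ assms], unfold has_debt_def) (rule ptime_debt_list ptime_rules)+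

lemma ptime_candidates:
  assumes "ptime ea enc_banks D B"
  shows "ptime ea (enc_list enc_swap) D (\<lambda>x. candidates (B x))"
  by (rule ptime_comp[OF assms _ subset_UNIV], unfold candidates_def) (rule ptime_debt_list ptime_rules)+

lemma ptime_redirect:
  assumes "ptime ea enc_swap D \<sigma>" "ptime ea enc_nat D u" "ptime ea enc_nat D c"
  shows "ptime ea enc_nat D (\<lambda>x. redirect (\<sigma> x) (u x) (c x))"
  unfolding redirect_def by (rule ptime_rules assms)+

lemma ptime_swap_banks:
  assumes "ptime ea enc_swap D \<sigma>" "ptime ea enc_banks D B"
  shows "ptime ea enc_banks D (\<lambda>x. swap_banks (\<sigma> x) (B x))"
  by (rule ptime_apply2[OF _ assms], unfold swap_banks_def) (rule ptime_redirect ptime_rules)+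

lemma ptime_valid_swap:
  assumes "ptime ea enc_banks D B" "ptime ea enc_swap D \<sigma>"
  shows "ptime ea enc_bool D (\<lambda>x. valid_swap (B x) (\<sigma> x))"
  unfolding valid_swap_def by (rule ptime_has_debt ptime_rules assms)+

lemma ptime_gains:
  assumes "ptime ea enc_assets D X" "ptime ea enc_assets D X'"
    "ptime ea enc_nat D v1" "ptime ea enc_nat D v2" "ptime ea enc_nat D v"
  shows "ptime ea enc_bool D (\<lambda>x. gains (X x) (X' x) (v1 x) (v2 x) (v x))"
  unfolding gains_def by (rule ptime_asset ptime_rules assms)+

lemma ptime_good_swap:
  assumes "ptime ea enc_banks D B" "ptime ea enc_nat D v" "ptime ea enc_swap D \<sigma>"
  shows "ptime ea enc_bool D (\<lambda>x. good_swap (B x) (v x) (\<sigma> x))"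
  unfolding good_swap_def
  by (rule ptime_valid_swap ptime_gains ptime_clear ptime_swap_banks ptime_rules assms)+

lemma ptime_improve:
  assumes "ptime ea enc_nat D v" "ptime ea (enc_pair enc_banks enc_swaps) D st"
  shows "ptime ea (enc_pair enc_banks enc_swaps) D (\<lambda>x. improve (v x) (st x))"
  by (rule ptime_apply2[OF _ assms], unfold improve_def enc_swaps_def)
    (rule ptime_good_swap ptime_candidates ptime_swap_banks ptime_rules)+

lemma ptime_square:
  assumes "ptime ea (enc_list enc_nat) D l"
  shows "ptime ea (enc_list enc_nat) D (\<lambda>x. square (l x))"
  by (rule ptime_comp[OF assms _ subset_UNIV], unfold square_def) (rule ptime_rules)+

section \<open>Correctness of the search for swaps\<close>

lemma total_assets_less_iff:
  assumes N: "edge_ranking_network N" "edge_ranking_network N'" and w: "w \<in> banks N" "w \<in> banks N'"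
  shows "total_assets N w < total_assets N' w \<longleftrightarrow>
      asset (clear (bank_list N)) w < asset (clear (bank_list N')) w"
    and "total_assets N w \<le> total_assets N' w \<longleftrightarrow>
      asset (clear (bank_list N)) w \<le> asset (clear (bank_list N')) w"
  using asset_clear[OF N(1) w(1), symmetric] asset_clear[OF N(2) w(2), symmetric] by simp_all

lemma set_debt_list:
  assumes N: "edge_ranking_network N"
  shows "set (debt_list (bank_list N)) = (\<lambda>e. (fst e, snd e, liab N e)) ` debts N"
proof -
  have "(u, c, l) \<in> set (debt_list (bank_list N)) \<longleftrightarrow>
      u \<in> banks N \<and> (\<exists>e\<in>set (ranking N u). c = snd e \<and> l = liab N e)" for u c l
    using networkD(1)[OF N] by (auto simp: debt_list_def bank_list_def)
  also have "\<dots> u c l \<longleftrightarrow> (u, c, l) \<in> (\<lambda>e. (fst e, snd e, liab N e)) ` debts N" for u c l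
    using networkD(8)[OF N, of u] networkD(3)[OF N, of "(u, c)"] by force
  finally show ?thesis by auto
qed

lemma has_debt_iff:
  assumes N: "edge_ranking_network N"
  shows "has_debt (bank_list N) u c \<longleftrightarrow> (u, c) \<in> debts N"
  by (force simp: has_debt_def list_ex_iff set_debt_list[OF N])

lemma set_candidates:
  assumes N: "edge_ranking_network N"
  shows "((u1, v1), (u2, v2)) \<in> set (candidates (bank_list N)) \<longleftrightarrow>
    (u1, v1) \<in> debts N \<and> (u2, v2) \<in> debts N \<and> liab N (u1, v1) = liab N (u2, v2)"
  by (force simp: candidates_def set_debt_list[OF N])

lemma is_debt_swap_iff:
  assumes N: "edge_ranking_network N"
  shows "is_debt_swap N \<sigma> \<longleftrightarrow> \<sigma> \<in> set (candidates (bank_list N)) \<and> valid_swap (bank_list N) \<sigma>"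
proof -
  obtain u1 v1 u2 v2 where \<sigma>: "\<sigma> = ((u1, v1), (u2, v2))" by (metis surj_pair)
  show ?thesis
    unfolding \<sigma> set_candidates[OF N] by (auto simp: valid_swap_def has_debt_iff[OF N])
qed

lemma swap_banks_bank_list:
  assumes N: "edge_ranking_network N" and s: "is_debt_swap N \<sigma>"
  shows "swap_banks \<sigma> (bank_list N) = bank_list (apply_swap \<sigma> N)"
proof -
  obtain u1 v1 u2 v2 where \<sigma>: "\<sigma> = ((u1, v1), (u2, v2))" by (metis surj_pair)
  let ?f = "id((u1, v1) := (u1, v2), (u2, v2) := (u2, v1))"
  have e: "(redirect \<sigma> u (snd e), liab N e) = (snd (?f e), liab (apply_swap \<sigma> N) (?f e))"
    if "e \<in> debts N" "fst e = u" for e u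
    using s that by (cases e) (auto simp: \<sigma> redirect_def)
  have u: "map (\<lambda>e. (redirect \<sigma> u (snd e), liab N e)) (ranking N u) =
      map (\<lambda>e. (snd e, liab (apply_swap \<sigma> N) e)) (ranking (apply_swap \<sigma> N) u)"
    if u: "u \<in> set (sorted_list_of_set (banks N))" for u
  proof -
    have "u \<in> banks N" using u networkD(1)[OF N] by simp
    then have "set (ranking N u) = {e \<in> debts N. fst e = u}" by (rule networkD(8)[OF N])
    moreover have "ranking (apply_swap \<sigma> N) u = map ?f (ranking N u)" by (simp add: \<sigma>)
    ultimately show ?thesis by (simp add: e del: fun_upd_apply)
  qed
  have "banks (apply_swap \<sigma> N) = banks N" "ext_assets (apply_swap \<sigma> N) = ext_assets N"
    by (simp_all add: \<sigma>)
  then show ?thesis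
    unfolding swap_banks_def bank_list_def by (simp add: o_def u)
qed

lemma semi_swap_step_iff:
  assumes N: "edge_ranking_network N" and v: "v \<in> banks N"
  shows "semi_swap_step v N \<sigma> \<longleftrightarrow>
    \<sigma> \<in> set (candidates (bank_list N)) \<and> good_swap (bank_list N) v \<sigma>"
proof (cases "is_debt_swap N \<sigma>")
  case True
  obtain u1 v1 u2 v2 where \<sigma>: "\<sigma> = ((u1, v1), (u2, v2))" by (metis surj_pair)
  let ?N' = "apply_swap \<sigma> N"
  have N': "edge_ranking_network ?N'" using N True by (rule edge_ranking_network_apply_swap)
  have b: "banks ?N' = banks N" by (simp add: \<sigma>)
  have "(u1, v1) \<in> debts N" "(u2, v2) \<in> debts N" using True by (simp_all add: \<sigma>)
  then have v12: "v1 \<in> banks N" "v2 \<in> banks N"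
    using networkD(4)[OF N] by (metis snd_conv)+
  have iff: "total_assets N w < total_assets ?N' w \<longleftrightarrow>
      asset (clear (bank_list N)) w < asset (clear (bank_list ?N')) w"
    "total_assets N w \<le> total_assets ?N' w \<longleftrightarrow>
      asset (clear (bank_list N)) w \<le> asset (clear (bank_list ?N')) w" if "w \<in> banks N" for w
    using total_assets_less_iff[OF N N'] that b by simp_all
  have "semi_positive N \<sigma> \<and> improving v N \<sigma> \<longleftrightarrow>
      gains (clear (bank_list N)) (clear (bank_list ?N')) v1 v2 v"
    using iff[OF v] iff[OF v12(1)] iff[OF v12(2)]
    by (auto simp: \<sigma> Let_def improving_def gains_def simp del: apply_swap.simps)
  then show ?thesis
    using True is_debt_swap_iff[OF N] swap_banks_bank_list[OF N True]
    by (auto simp: semi_swap_step_def good_swap_def \<sigma> simp del: apply_swap.simps semi_positive.simps is_debt_swap.simps)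
qed (auto simp: semi_swap_step_def is_debt_swap_iff[OF N] good_swap_def)

lemma semi_swap_sequence_snoc:
  "semi_swap_sequence v N (\<sigma>s @ [\<sigma>]) \<longleftrightarrow>
    semi_swap_sequence v N \<sigma>s \<and> semi_swap_step v (fold apply_swap \<sigma>s N) \<sigma>"
  by (induction \<sigma>s arbitrary: N) auto

lemma edge_ranking_network_fold:
  "edge_ranking_network N \<Longrightarrow> semi_swap_sequence v N \<sigma>s \<Longrightarrow> edge_ranking_network (fold apply_swap \<sigma>s N)"
  by (induction \<sigma>s arbitrary: N) (auto simp: semi_swap_step_def edge_ranking_network_apply_swap)

lemma banks_fold: "banks (fold apply_swap \<sigma>s N) = banks N"
proof (induction \<sigma>s arbitrary: N)
  case (Cons \<sigma> \<sigma>s)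
  have "banks (apply_swap \<sigma> N) = banks N" by (cases "(\<sigma>, N)" rule: apply_swap.cases) simp
  then show ?case using Cons by simp
qed simp

text \<open>The invariant of the loop: either each of the \<open>k\<close> iterations has carried
  out a swap, or no swap is left, and then the state no longer changes.\<close>

lemma improve_funpow:
  assumes N: "edge_ranking_network N" and v: "v \<in> banks N"
  shows "\<exists>\<sigma>s. (improve v ^^ k) (bank_list N, []) = (bank_list (fold apply_swap \<sigma>s N), rev \<sigma>s) \<and>
    semi_swap_sequence v N \<sigma>s \<and> length \<sigma>s \<le> k \<and>
    (length \<sigma>s = k \<or> (\<nexists>\<sigma>. semi_swap_step v (fold apply_swap \<sigma>s N) \<sigma>))"
proof (induction k)
  case (Suc k)
  then obtain \<sigma>s where st: "(improve v ^^ k) (bank_list N, []) = (bank_list (fold apply_swap \<sigma>s N), rev \<sigma>s)"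
    and seq: "semi_swap_sequence v N \<sigma>s" and len: "length \<sigma>s \<le> k"
    and alt: "length \<sigma>s = k \<or> (\<nexists>\<sigma>. semi_swap_step v (fold apply_swap \<sigma>s N) \<sigma>)" by blast
  let ?M = "fold apply_swap \<sigma>s N"
  have M: "edge_ranking_network ?M" "v \<in> banks ?M"
    using edge_ranking_network_fold[OF N seq] v by (simp_all add: banks_fold)
  have step: "set (filter (\<lambda>\<sigma>. good_swap (bank_list ?M) v \<sigma>) (candidates (bank_list ?M)))
      = {\<sigma>. semi_swap_step v ?M \<sigma>}"
    using semi_swap_step_iff[OF M] by auto
  show ?case
  proof (cases "filter (\<lambda>\<sigma>. good_swap (bank_list ?M) v \<sigma>) (candidates (bank_list ?M))")
    case Nil
    then have "\<nexists>\<sigma>. semi_swap_step v ?M \<sigma>" using step by auto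
    moreover have "(improve v ^^ Suc k) (bank_list N, []) = (bank_list ?M, rev \<sigma>s)"
      using st Nil by (simp add: improve_def)
    ultimately show ?thesis using seq len by (intro exI[of _ \<sigma>s]) simp
  next
    case (Cons \<sigma> rest)
    then have \<sigma>: "semi_swap_step v ?M \<sigma>" using step by (metis list.set_intros(1) mem_Collect_eq)
    then have "length \<sigma>s = k" using alt by blast
    moreover have "(improve v ^^ Suc k) (bank_list N, []) = (bank_list (fold apply_swap (\<sigma>s @ [\<sigma>]) N), rev (\<sigma>s @ [\<sigma>]))"
      using st Cons \<sigma> swap_banks_bank_list[OF M(1)] by (simp add: improve_def semi_swap_step_def)
    ultimately show ?thesis
      using seq \<sigma> semi_swap_sequence_snoc[of v N \<sigma>s \<sigma>] by (intro exI[of _ "\<sigma>s @ [\<sigma>]"]) simp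
  qed
qed (simp add: exI[of _ "[]"])

lemma length_square: "length (square l) = length l * length l"
proof -
  have "length (concat (map (\<lambda>_. l) xs)) = length xs * length l" for xs :: "nat list"
    by (induction xs) auto
  then show ?thesis by (simp add: square_def)
qed

lemma solve_correct:
  assumes N: "edge_ranking_network N" and v: "v \<in> banks N"
  shows "semi_swap_solution (N, v) (solve (bank_list N, v))"
proof -
  let ?k = "length (square (square (fuel (bank_list N))))"
  obtain \<sigma>s where st: "(improve v ^^ ?k) (bank_list N, []) = (bank_list (fold apply_swap \<sigma>s N), rev \<sigma>s)"
    and seq: "semi_swap_sequence v N \<sigma>s"
    and alt: "length \<sigma>s = ?k \<or> (\<nexists>\<sigma>. semi_swap_step v (fold apply_swap \<sigma>s N) \<sigma>)"
    using improve_funpow[OF N v] by blast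
  have "solve (bank_list N, v) = \<sigma>s" by (simp add: solve_def foldr_const st)
  moreover have "\<nexists>\<sigma>. semi_swap_step v (fold apply_swap \<sigma>s N) \<sigma>"
  proof
    \<comment> \<open>A swap left over means that all \<open>?k\<close> iterations carried one out.
      With the additional swap the sequence would be longer than the potential allows.\<close>
    assume ex: "\<exists>\<sigma>. semi_swap_step v (fold apply_swap \<sigma>s N) \<sigma>"
    then obtain \<sigma> where "semi_swap_step v (fold apply_swap \<sigma>s N) \<sigma>" by blast
    then have "semi_swap_sequence v N (\<sigma>s @ [\<sigma>])" using seq by (simp add: semi_swap_sequence_snoc)
    then have "Suc ?k \<le> swap_potential v N"
      using length_semi_swap_sequence[OF N] alt ex by fastforce
    also have "\<dots> \<le> Suc (card (debts N)) ^ 3" by (rule swap_potential_le[OF N])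
    also have "\<dots> \<le> Suc (card (debts N)) ^ 4" by (rule power_increasing) auto
    also have "\<dots> \<le> length (fuel (bank_list N)) ^ 4"
    proof (rule power_mono)
      have "length (position_list N) = card (debts N)"
        using position_list[OF networkD(1)[OF N]] card_positions[OF N] by (metis distinct_card)
      then show "Suc (card (debts N)) \<le> length (fuel (bank_list N))"
        by (simp add: fuel_def slots_bank_list[OF N])
    qed simp
    also have "\<dots> = ?k" by (simp add: length_square power4_eq_xxxx mult.assoc)
    finally show False by simp
  qed
  ultimately show ?thesis using seq by simp
qed

text \<open>As a sum over banks and debts the size no longer depends on rankings, which makes it
  comparable before and after a swap.\<close>

lemma cells_bank_list:
  assumes N: "edge_ranking_network N"
  shows "cells (enc_banks (bank_list N)) =
    (\<Sum>u\<in>banks N. 3 + cells (enc_nat u) + cells (enc_nat (ext_assets N u))) +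
    (\<Sum>e\<in>debts N. 2 + cells (enc_nat (snd e)) + cells (enc_nat (liab N e)))"
proof -
  let ?g = "\<lambda>e. 2 + cells (enc_nat (snd e)) + cells (enc_nat (liab N e))"
  have row: "cells (enc_list (enc_pair enc_nat enc_nat) (map (\<lambda>e. (snd e, liab N e)) (ranking N u))) =
      (\<Sum>e | e \<in> debts N \<and> fst e = u. ?g e)" if "u \<in> banks N" for u
  proof -
    have "cells (enc_list (enc_pair enc_nat enc_nat) (map (\<lambda>e. (snd e, liab N e)) es)) = (\<Sum>e\<leftarrow>es. ?g e)" for es
      by (induction es) (simp_all add: cells_pair)
    then show ?thesis
      using networkD(7,8)[OF N that] by (simp add: sum_list_distinct_conv_sum_set)
  qed
  have "cells (enc_banks (bank_list N)) = (\<Sum>u\<leftarrow>sorted_list_of_set (banks N).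
      3 + cells (enc_nat u) + cells (enc_nat (ext_assets N u)) +
      cells (enc_list (enc_pair enc_nat enc_nat) (map (\<lambda>e. (snd e, liab N e)) (ranking N u))))"
  proof -
    have "cells (enc_banks (map (\<lambda>u. (u, ext_assets N u, map (\<lambda>e. (snd e, liab N e)) (ranking N u))) us)) =
      (\<Sum>u\<leftarrow>us. 3 + cells (enc_nat u) + cells (enc_nat (ext_assets N u)) +
      cells (enc_list (enc_pair enc_nat enc_nat) (map (\<lambda>e. (snd e, liab N e)) (ranking N u))))" for us
      by (induction us) (simp_all add: cells_pair)
    then show ?thesis by (simp add: bank_list_def)
  qed
  also have "\<dots> = (\<Sum>u\<in>banks N. 3 + cells (enc_nat u) + cells (enc_nat (ext_assets N u)) +
      (\<Sum>e | e \<in> debts N \<and> fst e = u. ?g e))"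
    using networkD(1)[OF N] by (simp add: sum_list_distinct_conv_sum_set row)
  also have "\<dots> = (\<Sum>u\<in>banks N. 3 + cells (enc_nat u) + cells (enc_nat (ext_assets N u))) +
      (\<Sum>u\<in>banks N. \<Sum>e | e \<in> debts N \<and> fst e = u. ?g e)" by (rule sum.distrib)
  also have "(\<Sum>u\<in>banks N. \<Sum>e | e \<in> debts N \<and> fst e = u. ?g e) = (\<Sum>e\<in>debts N. ?g e)"
    using networkD(1-3)[OF N] by (intro sum.group) auto
  finally show ?thesis .
qed

text \<open>A swap exchanges two creditor names and keeps the liabilities, so the network does not
  grow however many swaps are carried out.\<close>

lemma cells_bank_list_swap:
  assumes N: "edge_ranking_network N" and s: "is_debt_swap N \<sigma>"
  shows "cells (enc_banks (bank_list (apply_swap \<sigma> N))) = cells (enc_banks (bank_list N))"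
proof -
  obtain u1 v1 u2 v2 where \<sigma>: "\<sigma> = ((u1, v1), (u2, v2))" by (metis surj_pair)
  let ?N' = "apply_swap \<sigma> N" and ?E = "debts N - {(u1, v1), (u2, v2)}"
  let ?g = "\<lambda>N e. 2 + cells (enc_nat (snd e)) + cells (enc_nat (liab N e))"
  have N': "edge_ranking_network ?N'" using N s by (rule edge_ranking_network_apply_swap)
  have fin: "finite ?E" using networkD(2)[OF N] by simp
  have E: "debts N = insert (u1, v1) (insert (u2, v2) ?E)" "debts ?N' = insert (u1, v2) (insert (u2, v1) ?E)"
    using s by (auto simp: \<sigma>)
  have ne: "(u1, v1) \<noteq> (u2, v2)" "(u1, v2) \<noteq> (u2, v1)" "(u1, v2) \<notin> ?E" "(u2, v1) \<notin> ?E"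
    using s by (auto simp: \<sigma>)
  have "(\<Sum>e\<in>debts ?N'. ?g ?N' e) = ?g ?N' (u1, v2) + (?g ?N' (u2, v1) + (\<Sum>e\<in>?E. ?g ?N' e))"
    unfolding E(2) using fin ne by simp
  also have "(\<Sum>e\<in>?E. ?g ?N' e) = (\<Sum>e\<in>?E. ?g N e)"
    using s by (intro sum.cong) (auto simp: \<sigma>)
  also have "?g ?N' (u1, v2) + (?g ?N' (u2, v1) + (\<Sum>e\<in>?E. ?g N e)) =
      ?g N (u1, v1) + (?g N (u2, v2) + (\<Sum>e\<in>?E. ?g N e))"
    using s by (auto simp: \<sigma>)
  also have "\<dots> = (\<Sum>e\<in>debts N. ?g N e)"
    by (subst E(1)) (use fin ne in simp)
  finally have "(\<Sum>e\<in>debts ?N'. ?g ?N' e) = (\<Sum>e\<in>debts N. ?g N e)" .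
  moreover have "banks ?N' = banks N" "ext_assets ?N' = ext_assets N" by (simp_all add: \<sigma>)
  ultimately show ?thesis by (simp add: cells_bank_list[OF N] cells_bank_list[OF N'])
qed

lemma cells_enc_bank_le:
  assumes N: "edge_ranking_network N" and u: "u \<in> banks N"
  shows "cells (enc_nat u) \<le> cells (enc_banks (bank_list N))"
proof -
  have "(u, ext_assets N u, map (\<lambda>e. (snd e, liab N e)) (ranking N u)) \<in> set (bank_list N)"
    using networkD(1)[OF N] u by (auto simp: bank_list_def)
  from cells_enc_list_elem[OF this, of "enc_pair enc_nat (enc_pair enc_nat enc_assets)"]
  show ?thesis by (simp add: cells_pair)
qed

text \<open>A swap takes three cells for its pairs and four bank names, each of which already occurs
  in the initial bank list.\<close>

lemma cells_semi_swap_sequence: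
  assumes "edge_ranking_network N" "semi_swap_sequence v N \<sigma>s"
  shows "cells (enc_banks (bank_list (fold apply_swap \<sigma>s N))) = cells (enc_banks (bank_list N))"
    and "\<sigma> \<in> set \<sigma>s \<Longrightarrow> cells (enc_swap \<sigma>) \<le> 3 + 4 * cells (enc_banks (bank_list N))"
  using assms
proof (induction \<sigma>s arbitrary: N)
  case (Cons \<tau> \<sigma>s)
  {
    case 1
    then have s: "is_debt_swap N \<tau>" "semi_swap_sequence v (apply_swap \<tau> N) \<sigma>s" by (auto simp: semi_swap_step_def)
    then show ?case
      using Cons(1)[OF edge_ranking_network_apply_swap[OF 1(1) s(1)] s(2)] cells_bank_list_swap[OF 1(1) s(1)]
      by simp
  next
    case 2
    then have s: "is_debt_swap N \<tau>" "semi_swap_sequence v (apply_swap \<tau> N) \<sigma>s" by (auto simp: semi_swap_step_def)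
    show ?case
    proof (cases "\<sigma> = \<tau>")
      case True
      obtain u1 v1 u2 v2 where \<tau>: "\<tau> = ((u1, v1), (u2, v2))" by (metis surj_pair)
      have "(u1, v1) \<in> debts N" "(u2, v2) \<in> debts N" using s(1) by (simp_all add: \<tau>)
      then have "u1 \<in> banks N" "v1 \<in> banks N" "u2 \<in> banks N" "v2 \<in> banks N"
        using networkD(3,4)[OF 2(2)] by (metis fst_conv snd_conv)+
      note le = this[THEN cells_enc_bank_le[OF 2(2)]]
      show ?thesis using le by (simp add: True \<tau> cells_pair)
    next
      case False
      then show ?thesis
        using 2(1) Cons(2)[OF _ edge_ranking_network_apply_swap[OF 2(2) s(1)] s(2)] cells_bank_list_swap[OF 2(2) s(1)]
        by simp
    qed
  }
qed simp_all

text \<open>The domain consists of encoded networks because the size bound for the intermediate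
  states rests on the swaps being genuine ones.\<close>

lemma ptime_solve:
  "ptime (enc_pair enc_banks enc_nat) enc_swaps
    ((\<lambda>(N, v). (bank_list N, v)) ` semi_swap_instances) solve"
proof -
  let ?e = "enc_pair enc_banks enc_nat" and ?D = "(\<lambda>(N, v). (bank_list N, v)) ` semi_swap_instances"
  let ?L = "\<lambda>I :: bank_list \<times> nat. square (square (fuel (fst I)))"
  let ?k = "\<lambda>I. Suc (cells (enc_banks (fst I)) +
    cells (enc_list enc_nat (?L I)) * Suc (3 + 4 * cells (enc_banks (fst I))))"
  have L: "ptime ?e (enc_list enc_nat) ?D ?L" by (rule ptime_square ptime_fuel ptime_rules)+
  have B: "ptime ?e enc_banks ?D fst" by (rule ptime_rules)+
  have nil: "ptime ?e (enc_pair enc_banks enc_swaps) ?D (\<lambda>I. (fst I, []))"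
    by (rule ptime_rules)+
  have "ptime ?e (enc_pair enc_banks enc_swaps) ?D
      (\<lambda>I. foldr (\<lambda>_ st. improve (snd I) st) (?L I) (fst I, []))"
  proof (rule ptime_foldr[where k = ?k, OF L nil])
    show "ptime (enc_pair ?e (enc_pair enc_nat (enc_pair enc_banks enc_swaps)))
      (enc_pair enc_banks enc_swaps) UNIV (\<lambda>z. improve (snd (fst z)) (snd (snd z)))"
      by (rule ptime_improve ptime_snd ptime_fst ptime_id)+
    show "psize ?e ?D ?k"
      by (rule psize_Suc psize_add psize_mult psize_const psize_out[OF L] psize_out[OF B])+
    fix I p t assume "I \<in> ?D" and split: "?L I = p @ t"
    then obtain N v where I: "I = (bank_list N, v)" and N: "edge_ranking_network N" "v \<in> banks N"
      by (auto simp: semi_swap_instances_def)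
    obtain \<sigma>s where st: "(improve v ^^ length t) (bank_list N, []) = (bank_list (fold apply_swap \<sigma>s N), rev \<sigma>s)"
      and seq: "semi_swap_sequence v N \<sigma>s" and len: "length \<sigma>s \<le> length t"
      using improve_funpow[OF N] by blast
    have "length t \<le> cells (enc_list enc_nat (?L I))"
      using length_le_cells[of "?L I" enc_nat] unfolding split by simp
    then have "cells (enc_swaps (rev \<sigma>s)) \<le> cells (enc_list enc_nat (?L I)) * Suc (3 + 4 * cells (enc_banks (fst I)))"
      unfolding enc_swaps_def using len cells_semi_swap_sequence(2)[OF N(1) seq]
      by (intro cells_enc_list_le) (auto simp: I)
    then show "cells (enc_pair enc_banks enc_swaps (foldr (\<lambda>_ st. improve (snd I) st) t (fst I, []))) \<le> ?k I"
      using cells_semi_swap_sequence(1)[OF N(1) seq] by (simp add: foldr_const I st cells_pair)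
  qed
  then show ?thesis
    unfolding solve_def enc_swaps_def by (intro ptime_rev ptime_snd)
qed

text \<open>The main function has to come first, so a call of the implementing function is put in
  front of the program and all indices move up by one. The call costs 4 steps.\<close>

lemma poly_time_solvableI:
  assumes f: "ptime ea eb D f" and x: "\<And>x. x \<in> I \<Longrightarrow> g x \<in> D \<and> ea (g x) = enc x \<and> sol x (f (g x))"
  shows "poly_time_solvable enc eb I sol"
proof -
  obtain P i q where P: "implements P i q ea eb D f" using f by (auto simp: ptime_def)
  let ?P = "ECall (i + 1) [EVar 0] # map (shift 1) P"
  have "sol x (f (g x)) \<and> (\<exists>t. computes ?P (enc x) (eb (f (g x))) t \<and> t \<le> poly (q + [:4:]) (cells (enc x)))"
    if xI: "x \<in> I" for x
  proof -
    have gx: "g x \<in> D" using x[OF xI] by blast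
    obtain t where t: "i < length P" "eval P [ea (g x)] (P ! i) (eb (f (g x))) t" "t \<le> poly q (cells (ea (g x)))"
      using implementsD[OF P gx] .
    have "eval ?P [ea (g x)] (?P ! (i + 1)) (eb (f (g x))) t"
      using eval_shift(1)[OF t(2), of "[ECall (i + 1) [EVar 0]]"] t(1) by simp
    from eval_call_arg[OF _ this] have "computes ?P (enc x) (eb (f (g x))) (t + 4)"
      using t(1) x[OF xI] by (simp add: computes_def)
    then show ?thesis using t(3) x[OF xI] by (intro conjI exI[of _ "t + 4"]) auto
  qed
  then show ?thesis unfolding poly_time_solvable_def by blast
qed

theorem theorem3:
  shows "(\<exists>q :: nat poly. \<forall>(N :: 'v network) v \<sigma>s.
            edge_ranking_network N \<longrightarrow> v \<in> banks N \<longrightarrow> semi_swap_sequence v N \<sigma>s \<longrightarrow>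
            length \<sigma>s \<le> poly q (network_size N)) \<and>
         poly_time_solvable (enc_pair enc_network enc_nat) enc_swaps
           semi_swap_instances semi_swap_solution"
proof
  show "\<exists>q :: nat poly. \<forall>(N :: 'v network) v \<sigma>s.
      edge_ranking_network N \<longrightarrow> v \<in> banks N \<longrightarrow> semi_swap_sequence v N \<sigma>s \<longrightarrow>
      length \<sigma>s \<le> poly q (network_size N)"
    by (rule semi_swap_sequence_bound)
  show "poly_time_solvable (enc_pair enc_network enc_nat) enc_swaps
      semi_swap_instances semi_swap_solution"
  proof (rule poly_time_solvableI[OF ptime_solve])
    fix I :: "nat network \<times> nat" assume I: "I \<in> semi_swap_instances"
    then show "(case I of (N, v) \<Rightarrow> (bank_list N, v)) \<in> (\<lambda>(N, v). (bank_list N, v)) ` semi_swap_instances \<and>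
        enc_pair enc_banks enc_nat (case I of (N, v) \<Rightarrow> (bank_list N, v)) = enc_pair enc_network enc_nat I \<and>
        semi_swap_solution I (solve (case I of (N, v) \<Rightarrow> (bank_list N, v)))"
      by (auto simp: enc_pair_def enc_network_eq semi_swap_instances_def simp del: semi_swap_solution.simps
          intro!: solve_correct)
  qed
qed

end
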